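(* Any consistent system of proper congruences has a solution in the sphere $S^2$ using nonmeager sets with the property of Baire, where arbitrary isometries of $S^2$ may be used as witnesses. That is, for any consistent system of proper congruences $(L_i,R_i)$, $1\le i\le m$, on the index set $\{1,\dots,r\}$, there exist pairwise disjoint nonmeager sets $A_1,\dots,A_r\subseteq S^2$ with the property of Baire and with union $S^2$, and isometries $\sigma_1,\dots,\sigma_m$ of $S^2$, such that $\sigma_i\bigl(\bigcup_{k\in L_i}A_k\bigr)=\bigcup_{k\in R_i}A_k$ for each $i\le m$.
   Context: $S^2$ is the two-dimensional sphere. Fix a positive integer $r$; for $S\subseteq\{1,\dots,r\}$ write $S^c=\{1,\dots,r\}\setminus S$. A congruence is a pair $(L,R)$ of subsets of $\{1,\dots,r\}$, written formally $\bigcup_{k\in L}A_k\cong\bigcup_{k\in R}A_k$; it is proper if both $L$ and $R$ are nonempty proper subsets of $\{1,\dots,r\}$. A system of congruences is a finite list of pairs $(L_i,R_i)$, $i\le m$. Let $\preceq$ be the smallest transitive relation on subsets of $\{1,\dots,r\}$ such that $L\preceq R$ whenever $L\subseteq R$, and $L_i\preceq R_i$, $R_i\preceq L_i$, $L_i^c\preceq R_i^c$, $R_i^c\preceq L_i^c$ for all $i\le m$ (deducible subcongruences). The system is consistent if there are no $L,R$ with $R$ a proper subset of $L$ and $L\preceq R$. A set has the property of Baire if it differs from an open set by a meager set. *)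

theory Defs
  imports "HOL-Analysis.Analysis"
begin

definition nowhere_dense_in :: "'a topology \<Rightarrow> 'a set \<Rightarrow> bool" where
  "nowhere_dense_in X S \<longleftrightarrow> S \<subseteq> topspace X \<and> X interior_of (X closure_of S) = {}"

definition meager_in :: "'a topology \<Rightarrow> 'a set \<Rightarrow> bool" where
  "meager_in X = countable union_of nowhere_dense_in X"

definition Baire_property_in :: "'a topology \<Rightarrow> 'a set \<Rightarrow> bool" where
  "Baire_property_in X S \<longleftrightarrow>
     S \<subseteq> topspace X \<and> (\<exists>U. openin X U \<and> meager_in X (sym_diff S U))"

abbreviation S2 :: "(real^3) set" where
  "S2 \<equiv> sphere 0 1"

text \<open>
  The metric is the chordal one. Chordal distance is a strictly increasing function of geodesic
  distance on the sphere, so both metrics have the same isometries. Only the values of \<open>f\<close>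
  on \<open>S\<close> matter.
\<close>
definition isometry_of :: "'a::metric_space set \<Rightarrow> ('a \<Rightarrow> 'a) \<Rightarrow> bool" where
  "isometry_of S f \<longleftrightarrow> bij_betw f S S \<and> (\<forall>x\<in>S. \<forall>y\<in>S. dist (f x) (f y) = dist x y)"

type_synonym congruence = "nat set \<times> nat set"

definition proper_congruence :: "nat \<Rightarrow> congruence \<Rightarrow> bool" where
  "proper_congruence r = (\<lambda>(L, R). L \<noteq> {} \<and> L \<subset> {1..r} \<and> R \<noteq> {} \<and> R \<subset> {1..r})"

inductive subcongruence :: "nat \<Rightarrow> congruence list \<Rightarrow> nat set \<Rightarrow> nat set \<Rightarrow> bool"
  for r :: nat and C :: "congruence list"
where
  subset: "L \<subseteq> R \<Longrightarrow> R \<subseteq> {1..r} \<Longrightarrow> subcongruence r C L R"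
| left: "(L, R) \<in> set C \<Longrightarrow> subcongruence r C L R"
| right: "(L, R) \<in> set C \<Longrightarrow> subcongruence r C R L"
| compl_left: "(L, R) \<in> set C \<Longrightarrow> subcongruence r C ({1..r} - L) ({1..r} - R)"
| compl_right: "(L, R) \<in> set C \<Longrightarrow> subcongruence r C ({1..r} - R) ({1..r} - L)"
| trans: "subcongruence r C L M \<Longrightarrow> subcongruence r C M R \<Longrightarrow> subcongruence r C L R"

definition consistent_system :: "nat \<Rightarrow> congruence list \<Rightarrow> bool" where
  "consistent_system r C \<longleftrightarrow> \<not> (\<exists>L R. R \<subset> L \<and> subcongruence r C L R)"

end

theory Submission
  imports Defs
begin

text \<open>
  Choose one set \<open>v\<close> from every pair of complementary nonempty proper subsets of \<open>{1..r}\<close>, and let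
  \<open>A\<^sub>v\<close> be the union of the \<open>A\<^sub>k\<close> with \<open>k \<in> v\<close>. All \<open>A\<^sub>v\<close> with \<open>v\<close> in one class of congruent sets are to
  be images \<open>g\<^sub>v B\<close> of the same set \<open>B\<close> under free rotations \<open>g\<^sub>v\<close>; if the class contains complementary
  sets, a rotoreflection \<open>t\<close> of order 4 has to map \<open>B\<close> onto its complement. (An involution without fixed
  points would be \<open>- 1\<close>, which does not work for several such classes at once.) Thus a link
  \<open>(v, j, w)\<close>, acting by \<open>g\<^sub>w t\<^sup>j g\<^sub>v\<^sup>-\<^sup>1\<close>, has to map \<open>A\<^sub>v\<close> onto \<open>A\<^sub>w\<close> or, for odd \<open>j\<close>, onto its complement.

  Reduced chains of links act nontrivially. Indeed let \<open>g\<^sub>v\<close> be a conjugate, depending on \<open>v\<close>, of the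
  rotation with parameter \<open>\<tau> = tan (\<theta> / 2)\<close>. After clearing denominators a chain is polynomial in \<open>\<tau>\<close>,
  and at \<open>\<tau> = \<i>\<close> it is a nonzero product of matrices of rank one. So orbits are forests, except that
  an orbit meeting the fixed points of a chain contains one cycle, because the chains that fix a point
  commute.

  Knowing that a point lies in \<open>A\<^sub>v\<close> or in its complement forces such facts at other points of
  its orbit. By consistency \<open>H\<close> decreases strictly along forced implications. Hence a cycle can be
  coloured, and the colouring extends to the rest of the orbit. On free orbits it follows that
  a piece of knowledge spreads only over a bounded distance, so that a colour can be prescribed on
  every open set that returns to itself late enough, without destroying solvability. Doing this for
  small open subsets of all sets of a countable base colours an open dense set; the colouring
  extends along all free orbits, and the other points form a meager set.
\<close>

section \<open>Links and chains\<close>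

text \<open>An orbit is seen as a hypergraph. A point \<open>y\<close> carries a half-edge
  \<open>(y, v)\<close> for each \<open>v \<in> J\<close>; links leaving the same half-edge compose,
  so the half-edges they reach are the ends of one edge, and a chain is reduced when it never
  continues within the edge by which it has just arrived. A truth value at one end fixes those at
  all ends of the edge, while the colours available at a point relate the values on its half-edges.
  The obstacle is that infinitely many prescriptions have to be made in succession, each of which
  spreads through every orbit it meets. The invariant is therefore a statement about all solutions
  compatible with the state: if one is revealed on a connected set \<open>F\<close>, then, apart
  from the state itself, nothing beyond a distance \<open>L\<close> of \<open>F\<close> follows.
  Allowing arbitrary connected \<open>F\<close> lets the invariant survive a prescription with
  \<open>5 * L\<close> for \<open>L\<close>, because copies of the new pattern close to
  \<open>F\<close> can be absorbed into \<open>F\<close>. In the limit the bounds are lost; what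
  remains, closedness, is all that colouring a free orbit needs.\<close>

type_synonym ('j, 'g) link = "'j \<times> 'g \<times> 'j"

fun src :: "('j, 'g) link \<Rightarrow> 'j" where "src (v, j, w) = v"
fun amt :: "('j, 'g) link \<Rightarrow> 'g" where "amt (v, j, w) = j"
fun tgt :: "('j, 'g) link \<Rightarrow> 'j" where "tgt (v, j, w) = w"
fun trivial_link :: "('j, 'g::zero) link \<Rightarrow> bool" where
  "trivial_link (v, j, w) \<longleftrightarrow> v = w \<and> j = 0"
fun inv_link :: "('j, 'g::uminus) link \<Rightarrow> ('j, 'g) link" where
  "inv_link (v, j, w) = (w, - j, v)"
text \<open>The inner indices are not compared; composability \<open>tgt l = src m\<close> is
  imposed where it matters.\<close>

fun comp_link :: "('j, 'g::plus) link \<Rightarrow> ('j, 'g) link \<Rightarrow> ('j, 'g) link" where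
  "comp_link (v, j, w) (w', k, u) = (v, j + k, u)"

definition rev_chain :: "('j, 'g::uminus) link list \<Rightarrow> ('j, 'g) link list" where
  "rev_chain ls = rev (map inv_link ls)"

lemma rev_chain_simps [simp]:
  "rev_chain [] = []" "rev_chain (l # ls) = rev_chain ls @ [inv_link l]"
  "length (rev_chain ls) = length ls" "rev_chain ls = [] \<longleftrightarrow> ls = []"
  by (auto simp: rev_chain_def)

lemma src_inv_link [simp]: "src (inv_link l) = tgt l" by (cases l) auto
lemma tgt_inv_link [simp]: "tgt (inv_link l) = src l" by (cases l) auto
lemma amt_inv_link [simp]: "amt (inv_link l) = - amt l" by (cases l) auto
lemma src_comp_link [simp]: "src (comp_link l m) = src l" by (cases l; cases m) auto
lemma tgt_comp_link [simp]: "tgt (comp_link l m) = tgt m" by (cases l; cases m) auto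
lemma amt_comp_link [simp]: "amt (comp_link l m) = amt l + amt m" by (cases l; cases m) auto

lemma trivial_inv_link [simp]:
  "trivial_link (inv_link l) = trivial_link (l :: ('j, 'g::ab_group_add) link)"
  by (cases l) auto

lemma inv_inv_link [simp]: "inv_link (inv_link l) = (l :: ('j, 'g::ab_group_add) link)"
  by (cases l) auto

lemma trivial_comp_link:
  "trivial_link (comp_link l m) \<longleftrightarrow> src l = tgt m \<and> amt l + amt m = 0"
  by (cases l; cases m) auto

lemma hd_rev_chain: "ls \<noteq> [] \<Longrightarrow> hd (rev_chain ls) = inv_link (last ls)"
  by (simp add: rev_chain_def hd_rev last_map)

lemma last_rev_chain: "ls \<noteq> [] \<Longrightarrow> last (rev_chain ls) = inv_link (hd ls)"
  by (simp add: rev_chain_def last_rev hd_map)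

lemma rev_chain_rev_chain [simp]:
  "rev_chain (rev_chain ls) = (ls :: ('j, 'g::ab_group_add) link list)"
  by (simp add: rev_chain_def rev_map o_def)

text \<open>The links over \<open>J\<close> form a groupoid with vertex group \<open>'g\<close>
  acting on \<open>'x\<close>, and \<open>od\<close> is a homomorphism from \<open>'g\<close> to the
  group of order two. \<open>sy\<close> will mark the classes that contain complementary sets; only
  there may a valid link use a nonzero amount.\<close>

locale chain_system =
  fixes J :: "'j set" and cls :: "'j \<Rightarrow> 'k" and sy :: "'j \<Rightarrow> bool"
    and od :: "'g::{ab_group_add,finite} \<Rightarrow> bool"
    and lk :: "('j, 'g) link \<Rightarrow> 'x \<Rightarrow> 'x"
  assumes finite_J: "finite J"
    and sy_cls: "\<lbrakk>cls v = cls w; v \<in> J; w \<in> J\<rbrakk> \<Longrightarrow> sy v = sy w"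
    and od_add: "od (a + b) = (od a \<noteq> od b)"
    and lk_id: "v \<in> J \<Longrightarrow> lk (v, 0, v) x = x"
    and lk_comp': "\<lbrakk>v \<in> J; w \<in> J; u \<in> J\<rbrakk> \<Longrightarrow> lk (w, k, u) (lk (v, j, w) x) = lk (v, j + k, u) x"
begin

lemma od_0 [simp]: "\<not> od 0"
  using od_add[of 0 0] by simp

lemma od_uminus [simp]: "od (- a) = od a"
  using od_add[of a "- a"] by simp

fun valid :: "('j, 'g) link \<Rightarrow> bool" where
  "valid (v, j, w) \<longleftrightarrow> v \<in> J \<and> w \<in> J \<and> cls v = cls w \<and> (j = 0 \<or> sy v)"

lemma valid_J: "valid l \<Longrightarrow> src l \<in> J" "valid l \<Longrightarrow> tgt l \<in> J"
  by (cases l; auto)+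

lemma valid_inv [simp]: "valid (inv_link l) = valid l"
  by (cases l) (auto dest: sy_cls)

lemma valid_comp: "\<lbrakk>valid l; valid m; tgt l = src m\<rbrakk> \<Longrightarrow> valid (comp_link l m)"
  by (cases l; cases m) (auto dest: sy_cls)

lemma lk_comp: "\<lbrakk>valid l; valid m; tgt l = src m\<rbrakk> \<Longrightarrow> lk m (lk l x) = lk (comp_link l m) x"
  by (cases l; cases m) (auto simp: lk_comp')

lemma lk_trivial: "\<lbrakk>valid l; trivial_link l\<rbrakk> \<Longrightarrow> lk l x = x"
  by (cases l) (auto simp: lk_id)

lemma lk_inv [simp]: "valid l \<Longrightarrow> lk (inv_link l) (lk l x) = x"
  by (simp add: lk_comp lk_trivial valid_comp trivial_comp_link)

lemma lk_inv' [simp]: "valid l \<Longrightarrow> lk l (lk (inv_link l) x) = x"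
  using lk_inv[of "inv_link l"] by simp

lemma finite_valid: "finite {l. valid l}"
  by (rule finite_subset[of _ "J \<times> UNIV \<times> J"]) (auto simp: finite_J)

section \<open>Evaluation and normal forms of chains\<close>

text \<open>The head of a chain is the link that is traversed last.\<close>

primrec ev :: "('j, 'g) link list \<Rightarrow> 'x \<Rightarrow> 'x" where
  "ev [] x = x"
| "ev (l # ls) x = lk l (ev ls x)"

text \<open>A link that starts at the half-edge just entered would compose with its predecessor into
  a single link, so these are the normal forms of walks.\<close>

fun red :: "('j, 'g) link list \<Rightarrow> bool" where
  "red [] = True"
| "red (l # ls) \<longleftrightarrow> valid l \<and> \<not> trivial_link l \<and> red ls \<and> (ls = [] \<or> tgt (hd ls) \<noteq> src l)"

definition walk :: "('j, 'g) link list \<Rightarrow> bool" where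
  "walk ls \<longleftrightarrow> (\<forall>l \<in> set ls. valid l)"

lemma walk_simps [simp]:
  "walk []" "walk (l # ls) \<longleftrightarrow> valid l \<and> walk ls" "walk (ls @ ms) \<longleftrightarrow> walk ls \<and> walk ms"
  "walk (rev_chain ls) \<longleftrightarrow> walk ls"
  by (auto simp: walk_def rev_chain_def)

lemma red_walk: "red ls \<Longrightarrow> walk ls"
  by (induction ls) auto

lemma ev_append: "ev (ls @ ms) x = ev ls (ev ms x)"
  by (induction ls) auto

lemma ev_rev_chain [simp]: "walk ls \<Longrightarrow> ev (rev_chain ls) (ev ls x) = x"
  by (induction ls arbitrary: x) (auto simp: ev_append)

lemma ev_rev_chain' [simp]: "walk ls \<Longrightarrow> ev ls (ev (rev_chain ls) x) = x"
  using ev_rev_chain[of "rev_chain ls"] by simp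

lemma red_append:
  "red (ls @ ms) \<longleftrightarrow>
     red ls \<and> red ms \<and> (ls = [] \<or> ms = [] \<or> src (last ls) \<noteq> tgt (hd ms))"
  by (induction ls) auto

lemma red_rev_chain [simp]: "red (rev_chain ls) = red ls"
proof (induction ls)
  case (Cons l ls)
  then show ?case
    by (cases "ls = []") (auto simp: red_append last_rev_chain)
qed auto

text \<open>When \<open>a # as\<close> is run backwards after \<open>b # bs\<close>, the two links
  meeting at \<open>tgt a\<close> are replaced by their composite, which is nontrivial because
  \<open>a \<noteq> b\<close>.\<close>

lemma red_merge:
  assumes "red (a # as)" "red (b # bs)" "tgt a = tgt b" "a \<noteq> b"
  shows "red (rev_chain as @ comp_link b (inv_link a) # bs)"
    and "ev (rev_chain as @ comp_link b (inv_link a) # bs) x = ev (rev_chain (a # as)) (ev (b # bs) x)"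
proof -
  have nt: "\<not> trivial_link (comp_link b (inv_link a))"
    using assms(3,4) by (cases a; cases b) (auto simp: trivial_comp_link)
  have "valid (comp_link b (inv_link a))"
    using assms by (auto intro: valid_comp)
  then show "red (rev_chain as @ comp_link b (inv_link a) # bs)"
    using nt assms by (cases "as = []") (auto simp: red_append last_rev_chain)
  show "ev (rev_chain as @ comp_link b (inv_link a) # bs) x = ev (rev_chain (a # as)) (ev (b # bs) x)"
    using assms by (simp add: ev_append lk_comp)
qed

text \<open>Common final links are cancelled; once the final links differ, the reversal of one chain
  after the other is reduced up to one merge. The chain \<open>cs\<close> does not depend on the
  point, so the lemma serves freeness of a point as well as faithfulness.\<close>

lemma red_distinct:
  assumes "red as" "red bs" "as \<noteq> bs"
  obtains cs where "red cs" "cs \<noteq> []" "\<And>x. ev as x = ev bs x \<Longrightarrow> ev cs x = x"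
proof -
  have "\<exists>cs. red cs \<and> cs \<noteq> [] \<and> (\<forall>x. ev as x = ev bs x \<longrightarrow> ev cs x = x)"
    using assms
  proof (induction as arbitrary: bs)
    case Nil
    then show ?case by (metis ev.simps(1))
  next
    case (Cons a as)
    show ?case
    proof (cases bs)
      case Nil
      then show ?thesis using Cons.prems by (intro exI[of _ "a # as"]) auto
    next
      case bs: (Cons b bs')
      consider (eq) "a = b" | (same) "a \<noteq> b" "tgt a = tgt b" | (diff) "tgt a \<noteq> tgt b"
        by blast
      then show ?thesis
      proof cases
        case eq
        then obtain cs where cs: "red cs" "cs \<noteq> []" "\<And>x. ev as x = ev bs' x \<Longrightarrow> ev cs x = x"
          using Cons.IH[of bs'] Cons.prems bs by auto
        have "ev as x = ev bs' x" if "ev (a # as) x = ev bs x" for x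
        proof -
          have "lk (inv_link a) (ev (a # as) x) = lk (inv_link a) (ev bs x)" using that by simp
          then show ?thesis using Cons.prems bs eq by simp
        qed
        then show ?thesis using cs by blast
      next
        case same
        have "red (a # as)" "red (b # bs')" using Cons.prems bs by auto
        note m = red_merge[OF this same(2,1)]
        have "ev (rev_chain (a # as)) (ev (b # bs') x) = x" if "ev (a # as) x = ev bs x" for x
        proof -
          have "ev (rev_chain (a # as)) (ev (b # bs') x) = ev (rev_chain (a # as)) (ev (a # as) x)"
            using that bs by simp
          also have "\<dots> = x" by (rule ev_rev_chain) (use Cons.prems red_walk in blast)
          finally show ?thesis .
        qed
        then show ?thesis using m
          by (intro exI[of _ "rev_chain as @ comp_link b (inv_link a) # bs'"]) auto
      next
        case diff
        have "ev (rev_chain (a # as) @ bs) x = x" if "ev (a # as) x = ev bs x" for x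
        proof -
          have "ev (rev_chain (a # as) @ bs) x = ev (rev_chain (a # as)) (ev (a # as) x)"
            using that by (simp add: ev_append)
          also have "\<dots> = x" by (rule ev_rev_chain) (use Cons.prems red_walk in blast)
          finally show ?thesis .
        qed
        moreover have "red (rev_chain (a # as) @ bs)"
          using Cons.prems diff bs red_rev_chain[of "a # as"]
          by (simp only: red_append) (simp add: last_rev_chain)
        ultimately show ?thesis using bs by (intro exI[of _ "rev_chain (a # as) @ bs"]) auto
      qed
    qed
  qed
  then show ?thesis using that by blast
qed

definition free :: "'x \<Rightarrow> bool" where
  "free x \<longleftrightarrow> (\<forall>ls. red ls \<and> ls \<noteq> [] \<longrightarrow> ev ls x \<noteq> x)"

lemma free_unique: "\<lbrakk>free x; red as; red bs; ev as x = ev bs x\<rbrakk> \<Longrightarrow> as = bs"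
proof (rule ccontr)
  assume r: "free x" "red as" "red bs" and eq: "ev as x = ev bs x" and ne: "as \<noteq> bs"
  obtain cs where cs: "red cs" "cs \<noteq> []" "\<And>x. ev as x = ev bs x \<Longrightarrow> ev cs x = x"
    using red_distinct[OF r(2,3) ne] by blast
  show False using r(1) cs(1,2) cs(3)[OF eq] unfolding free_def by blast
qed

text \<open>Multiplication of a normal form by one link, including the single reduction step that it
  may cause.\<close>

definition push :: "('j, 'g) link \<Rightarrow> ('j, 'g) link list \<Rightarrow> ('j, 'g) link list" where
  "push l ls = (if trivial_link l then ls else if ls = [] \<or> tgt (hd ls) \<noteq> src l then l # ls
     else if trivial_link (comp_link (hd ls) l) then tl ls else comp_link (hd ls) l # tl ls)"

lemma push:
  assumes "red ls" "valid l"
  shows "red (push l ls)" "ev (push l ls) x = lk l (ev ls x)" "length (push l ls) \<le> Suc (length ls)"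
proof -
  show "red (push l ls)"
    using assms by (cases ls) (auto simp: push_def intro: valid_comp)
  show "ev (push l ls) x = lk l (ev ls x)"
    using assms by (cases ls) (auto simp: push_def lk_trivial lk_comp valid_comp)
  show "length (push l ls) \<le> Suc (length ls)"
    by (cases ls) (auto simp: push_def)
qed

lemma walk_red:
  assumes "walk ls"
  obtains ms where "red ms" "length ms \<le> length ls" "\<And>x. ev ms x = ev ls x"
proof -
  have "\<exists>ms. red ms \<and> length ms \<le> length ls \<and> (\<forall>x. ev ms x = ev ls x)"
    using assms
  proof (induction ls)
    case Nil
    then show ?case by (intro exI[of _ "[]"]) auto
  next
    case (Cons l ls)
    then obtain ms where ms: "red ms" "length ms \<le> length ls" "\<forall>x. ev ms x = ev ls x"
      by auto
    have "valid l" using Cons.prems by simp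
    with ms push[of ms l] show ?case
      by (intro exI[of _ "push l ms"]) (auto intro: order_trans)
  qed
  then show ?thesis using that by blast
qed

section \<open>Orbits\<close>

definition orb :: "'x \<Rightarrow> 'x set" where
  "orb x = {ev ls x | ls. walk ls}"

lemma orb_self [simp]: "x \<in> orb x"
  unfolding orb_def by (auto intro: exI[of _ "[]"])

lemma orb_red: 
  assumes "y \<in> orb x"
  obtains ls where "red ls" "y = ev ls x"
proof -
  obtain ms where ms: "walk ms" "y = ev ms x" using assms unfolding orb_def by blast
  obtain ls where "red ls" "\<And>z. ev ls z = ev ms z" using walk_red[OF ms(1)] by blast
  then show ?thesis using that ms(2) by simp
qed

lemma orb_ev: 
  assumes "y \<in> orb x" "walk ls"
  shows "ev ls y \<in> orb x"
proof -
  obtain ms where ms: "walk ms" "y = ev ms x" using assms unfolding orb_def by blast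
  then have "ev ls y = ev (ls @ ms) x" "walk (ls @ ms)" using assms by (auto simp: ev_append)
  then show ?thesis unfolding orb_def by blast
qed

lemma orb_lk: "\<lbrakk>y \<in> orb x; valid l\<rbrakk> \<Longrightarrow> lk l y \<in> orb x"
  using orb_ev[of y x "[l]"] by simp

lemma orb_sym: 
  assumes "y \<in> orb x"
  shows "x \<in> orb y"
proof -
  obtain ms where ms: "walk ms" "y = ev ms x" using assms unfolding orb_def by blast
  then have "x = ev (rev_chain ms) y" "walk (rev_chain ms)" by auto
  then show ?thesis unfolding orb_def by blast
qed

lemma orb_subset: "y \<in> orb x \<Longrightarrow> orb y \<subseteq> orb x"
  using orb_ev by (auto simp: orb_def[of y])

lemma orb_eq: "y \<in> orb x \<Longrightarrow> orb y = orb x"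
  using orb_subset[of y x] orb_subset[of x y] orb_sym[of y x] by blast

end

locale free_chain_system = chain_system +
  assumes faithful: "\<lbrakk>red ls; \<And>x. ev ls x = x\<rbrakk> \<Longrightarrow> ls = []"
begin

lemma ev_unique: "\<lbrakk>red as; red bs; \<And>x. ev as x = ev bs x\<rbrakk> \<Longrightarrow> as = bs"
proof (rule ccontr)
  assume r: "red as" "red bs" and eq: "\<And>x. ev as x = ev bs x" and ne: "as \<noteq> bs"
  obtain cs where cs: "red cs" "cs \<noteq> []" "\<And>x. ev as x = ev bs x \<Longrightarrow> ev cs x = x"
    using red_distinct[OF r ne] by blast
  show False using faithful[OF cs(1) cs(3)[OF eq]] cs(2) by blast
qed

text \<open>If \<open>ls\<close> fixes \<open>y\<close>, a conjugate of it fixes \<open>x\<close>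
  and therefore reduces to the empty chain. So the conjugate, and with it \<open>ls\<close>, acts as
  the identity everywhere, against faithfulness.\<close>

lemma free_orb: 
  assumes "free x" "y \<in> orb x" 
  shows "free y"
  unfolding free_def
proof (intro allI impI notI)
  fix ls assume ls: "red ls \<and> ls \<noteq> []" "ev ls y = y"
  obtain as where as: "red as" "y = ev as x" using orb_red[OF assms(2)] by blast
  have w: "walk ls" "walk as" using ls as red_walk by auto
  obtain ds where ds: "red ds" "\<And>z. ev ds z = ev (rev_chain as @ ls @ as) z"
  proof (rule walk_red)
    show "walk (rev_chain as @ ls @ as)" using w by simp
  qed blast
  have "ev ds x = x" using ds(2)[of x] ls as w by (simp add: ev_append)
  then have "ds = []" using assms(1) ds(1) unfolding free_def by blast
  then have eq: "ev (rev_chain as) (ev ls (ev as z)) = z" for z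
    using ds(2)[of z] by (simp add: ev_append)
  have "ev ls z = z" for z
  proof -
    have "ev as (ev (rev_chain as) (ev ls (ev as (ev (rev_chain as) z)))) = ev as (ev (rev_chain as) z)"
      using eq[of "ev (rev_chain as) z"] by simp
    then show ?thesis using w by simp
  qed
  then show False using faithful ls by blast
qed

end

section \<open>Colouring a forest\<close>

text \<open>\<open>H v e\<close> ranks the literal "value \<open>e\<close> on half-edge
  \<open>v\<close>". Links carry a literal to an equivalent one and preserve the rank; an
  implication between literals at one point lowers it.\<close>

locale congruence_csp = free_chain_system J cls sy od lk
  for J :: "'j set" and cls :: "'j \<Rightarrow> 'k" and sy :: "'j \<Rightarrow> bool"
    and od :: "'g::{ab_group_add,finite} \<Rightarrow> bool"
    and lk :: "('j, 'g) link \<Rightarrow> 'x \<Rightarrow> 'x" +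
  fixes Col :: "'c set" and S :: "'j \<Rightarrow> 'c set" and H :: "'j \<Rightarrow> bool \<Rightarrow> nat"
  assumes Col_nonempty: "Col \<noteq> {}"
    and literal_nonempty: "v \<in> J \<Longrightarrow> \<exists>k\<in>Col. (k \<in> S v) = e"
    and H_link: "valid l \<Longrightarrow> H (tgt l) (e \<noteq> od (amt l)) = H (src l) e"
    and H_less: "\<lbrakk>v \<in> J; u \<in> J; u \<noteq> v; \<And>k. \<lbrakk>k \<in> Col; (k \<in> S v) = e\<rbrakk> \<Longrightarrow> (k \<in> S u) = d\<rbrakk>
      \<Longrightarrow> H u d < H v e"
begin

definition obeys :: "('x \<Rightarrow> 'c) \<Rightarrow> ('j, 'g) link \<Rightarrow> 'x \<Rightarrow> bool" where
  "obeys c l y \<longleftrightarrow> (c (lk l y) \<in> S (tgt l)) = ((c y \<in> S (src l)) \<noteq> od (amt l))"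

definition solution :: "('x \<Rightarrow> 'c) \<Rightarrow> 'x set \<Rightarrow> bool" where
  "solution c Y \<longleftrightarrow> (\<forall>y\<in>Y. c y \<in> Col \<and> (\<forall>l. valid l \<longrightarrow> obeys c l y))"

definition options :: "('x \<Rightarrow> 'j \<Rightarrow> bool option) \<Rightarrow> 'x \<Rightarrow> 'c set" where
  "options s y = {k \<in> Col. \<forall>v\<in>J. \<forall>e. s y v = Some e \<longrightarrow> (k \<in> S v) = e}"

text \<open>A state is a partial assignment of truth values to half-edges. In a closed state an
  undetermined half-edge can still take both values, so a colouring can be continued through it
  whatever arrives there.\<close>

definition closed_state :: "('x \<Rightarrow> 'j \<Rightarrow> bool option) \<Rightarrow> 'x set \<Rightarrow> bool" where
  "closed_state s Y \<longleftrightarrow> (\<forall>y\<in>Y.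
     (\<forall>l. valid l \<longrightarrow> s (lk l y) (tgt l) = map_option (\<lambda>e. e \<noteq> od (amt l)) (s y (src l))) \<and>
     options s y \<noteq> {} \<and>
     (\<forall>u\<in>J. s y u = None \<longrightarrow> (\<forall>e. \<exists>k\<in>options s y. (k \<in> S u) = e)))"

lemma closed_stateD:
  assumes "closed_state s Y" "y \<in> Y"
  shows "valid l \<Longrightarrow> s (lk l y) (tgt l) = map_option (\<lambda>e. e \<noteq> od (amt l)) (s y (src l))"
    and "options s y \<noteq> {}"
    and "\<lbrakk>u \<in> J; s y u = None\<rbrakk> \<Longrightarrow> \<exists>k\<in>options s y. (k \<in> S u) = e"
  using assms unfolding closed_state_def by blast+

lemma options_Some: "\<lbrakk>k \<in> options s y; s y v = Some e; v \<in> J\<rbrakk> \<Longrightarrow> (k \<in> S v) = e"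
  unfolding options_def by blast

lemma options_Col: "k \<in> options s y \<Longrightarrow> k \<in> Col"
  unfolding options_def by blast

text \<open>
  \<open>par y\<close> is the half-edge of \<open>y\<close> that points towards the root set \<open>C\<close>.
\<close>
lemma extend_solution:
  fixes par :: "'x \<Rightarrow> 'j" and rk :: "'x \<Rightarrow> nat"
  assumes Y: "\<And>y l. \<lbrakk>y \<in> Y; valid l\<rbrakk> \<Longrightarrow> lk l y \<in> Y"
    and cl: "closed_state s Y" and C: "C \<subseteq> Y"
    and A1: "\<And>y. y \<in> Y - C \<Longrightarrow> \<exists>l z. valid l \<and> z \<in> Y \<and> lk l z = y \<and> tgt l = par y \<and>
               rk z < rk y \<and> (z \<in> C \<or> par z \<noteq> src l)"
    and A2: "\<And>y l. \<lbrakk>y \<in> Y - C; valid l; \<not> trivial_link l; src l \<noteq> par y\<rbrakk>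
               \<Longrightarrow> lk l y \<notin> C \<and> par (lk l y) = tgt l"
    and A3: "\<And>y. y \<in> C \<Longrightarrow> cC y \<in> options s y"
            "\<And>y l. \<lbrakk>y \<in> C; valid l; lk l y \<in> C\<rbrakk> \<Longrightarrow> obeys cC l y"
  obtains c where "solution c Y" "\<And>y. y \<in> Y \<Longrightarrow> c y \<in> options s y" "\<And>y. y \<in> C \<Longrightarrow> c y = cC y"
proof -
  obtain lo zo where o: "\<And>y. y \<in> Y - C \<Longrightarrow> valid (lo y) \<and> zo y \<in> Y \<and> lk (lo y) (zo y) = y \<and>
      tgt (lo y) = par y \<and> rk (zo y) < rk y \<and> (zo y \<in> C \<or> par (zo y) \<noteq> src (lo y))"
    using A1 by metis
  \<comment> \<open>Off \<open>C\<close> a colour has to agree with its predecessor only across the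
    half-edge \<open>par y\<close>; the other half-edges are taken care of by the points behind
    them.\<close>
  define P where "P f y k \<longleftrightarrow> (if y \<in> Y - C
      then k \<in> options s y \<and> (k \<in> S (par y)) = ((f (zo y) \<in> S (src (lo y))) \<noteq> od (amt (lo y)))
      else k = cC y)" for f :: "'x \<Rightarrow> 'c" and y k
  have P_opt: "k \<in> options s y" if "P f y k" "y \<in> Y" for f y k
    using that A3(1) unfolding P_def by (auto split: if_splits)
  have "\<exists>c. \<forall>y. P c y (c y)"
  proof (rule dependent_wf_choice[of "inv_image less_than rk"])
    show "wf (inv_image less_than rk)" by (simp add: wf_inv_image)
  next
    fix f g :: "'x \<Rightarrow> 'c" and y k
    assume "\<And>z. (z, y) \<in> inv_image less_than rk \<Longrightarrow> f z = g z"
    then show "P f y k = P g y k" using o[of y] unfolding P_def by auto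
  next
    fix y and f :: "'x \<Rightarrow> 'c"
    assume IH: "\<And>z. (z, y) \<in> inv_image less_than rk \<Longrightarrow> P f z (f z)"
    show "\<exists>k. P f y k"
    proof (cases "y \<in> Y - C")
      case True
      note oy = o[OF True]
      define d where "d = ((f (zo y) \<in> S (src (lo y))) \<noteq> od (amt (lo y)))"
      have fz: "f (zo y) \<in> options s (zo y)" using P_opt IH oy by auto
      have J: "par y \<in> J" "src (lo y) \<in> J" using oy valid_J by metis+
      have "\<exists>k\<in>options s y. (k \<in> S (par y)) = d"
      proof (cases "s y (par y)")
        case None
        then show ?thesis using closed_stateD(3)[OF cl] True J by blast
      next
        case (Some e)
        have "s y (par y) = map_option (\<lambda>e. e \<noteq> od (amt (lo y))) (s (zo y) (src (lo y)))"
          using closed_stateD(1)[OF cl, of "zo y" "lo y"] oy by simp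
        then obtain e' where e': "s (zo y) (src (lo y)) = Some e'" "e = (e' \<noteq> od (amt (lo y)))"
          using Some by (cases "s (zo y) (src (lo y))") auto
        have "e = d" unfolding d_def using options_Some[OF fz e'(1) J(2)] e'(2) by simp
        moreover obtain k where "k \<in> options s y" using closed_stateD(2)[OF cl] True by blast
        ultimately show ?thesis using options_Some[of _ s y, OF _ Some J(1)] by blast
      qed
      then show ?thesis unfolding P_def d_def using True by auto
    next
      case False
      then show ?thesis unfolding P_def by auto
    qed
  qed
  then obtain c where c: "\<And>y. P c y (c y)" by blast
  have c_opt: "c y \<in> options s y" if "y \<in> Y" for y using P_opt c that by blast
  have c_C: "c y = cC y" if "y \<in> C" for y using c[of y] that unfolding P_def by auto
  \<comment> \<open>Every half-edge is linked to a top end of its edge, namely one at a point of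
    \<open>C\<close> or one that is not the parent half-edge of its point.\<close>
  have base: "\<exists>z m. z \<in> Y \<and> valid m \<and> tgt m = v \<and> lk m z = y \<and> (z \<in> C \<or> par z \<noteq> src m) \<and>
      obeys c m z" if "y \<in> Y" "v \<in> J" for y v
  proof (cases "y \<in> C \<or> v \<noteq> par y")
    case True
    then show ?thesis using that
      by (intro exI[of _ y] exI[of _ "(v, 0, v)"]) (auto simp: obeys_def lk_id)
  next
    case False
    then have y: "y \<in> Y - C" "v = par y" using that by auto
    note oy = o[OF y(1)]
    have "obeys c (lo y) (zo y)"
      using c[of y] y oy unfolding P_def obeys_def by simp
    then show ?thesis using oy y by blast
  qed
  have "obeys c l y" if y: "y \<in> Y" and l: "valid l" for y l
  proof -
    obtain z m where z: "z \<in> Y" "valid m" "tgt m = src l" "lk m z = y" "z \<in> C \<or> par z \<noteq> src m"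
      "obeys c m z" using base[OF y, of "src l"] valid_J l by metis
    have y': "lk l y \<in> Y" using Y y l by blast
    obtain z' m' where z': "z' \<in> Y" "valid m'" "tgt m' = tgt l" "lk m' z' = lk l y"
      "z' \<in> C \<or> par z' \<noteq> src m'" "obeys c m' z'" using base[OF y', of "tgt l"] valid_J l by metis
    \<comment> \<open>\<open>n\<close> joins the top ends belonging to the two half-edges of
      \<open>l\<close>. By \<open>A2\<close> an edge has a single top end unless its top ends are at
      points of \<open>C\<close>; so \<open>n\<close> is trivial or is governed by
      \<open>cC\<close>.\<close>
    define n where "n = comp_link (comp_link m l) (inv_link m')"
    have n: "valid n" "src n = src m" "tgt n = src m'" "amt n = amt m + amt l - amt m'"
      using z z' l by (auto simp: n_def intro!: valid_comp)
    have "lk n z = lk (inv_link m') (lk l (lk m z))"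
      using z(2,3) z'(2,3) l by (simp add: n_def lk_comp[symmetric] valid_comp)
    then have nz: "lk n z = z'" using z z' by (metis lk_inv)
    have od_n: "od (amt n) = ((od (amt m) \<noteq> od (amt l)) \<noteq> od (amt m'))"
      unfolding n(4) using od_add[of "amt m + amt l" "- amt m'"] od_add[of "amt m" "amt l"] by simp
    have "obeys c n z"
    proof (cases "trivial_link n")
      case True
      then have "src n = tgt n" "amt n = 0" "z' = z" using nz n lk_trivial[of n z] by (cases n; auto)+
      then show ?thesis using nz by (simp add: obeys_def)
    next
      case False
      have zC: "z \<in> C"
      proof (rule ccontr)
        assume "z \<notin> C"
        then have "lk n z \<notin> C \<and> par (lk n z) = tgt n"
          using A2[OF _ n(1) False, of z] z(1,5) n(2) by auto
        then show False using nz z'(5) n(3) by auto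
      qed
      have nz': "lk (inv_link n) z' = z" using nz n by (metis lk_inv)
      have "z' \<in> C"
      proof (rule ccontr)
        assume "z' \<notin> C"
        then have "lk (inv_link n) z' \<notin> C \<and> par (lk (inv_link n) z') = tgt (inv_link n)"
          using A2[of z' "inv_link n"] z'(1,5) n(1,3) False by auto
        then show False using nz' z(5) n(2) by auto
      qed
      then show ?thesis using A3(2)[OF zC n(1)] c_C zC nz by (simp add: obeys_def)
    qed
    then show ?thesis
      using z(3,4,6) z'(3,4,6) n(2,3) nz od_n unfolding obeys_def by auto
  qed
  then have "solution c Y" unfolding solution_def using c_opt options_Col by blast
  then show ?thesis using that c_opt c_C by blast
qed

text \<open>Normal forms turn the orbit of a free point into a tree rooted at \<open>x\<close>; the
  parent half-edge of a point is the one by which its normal form arrives.\<close>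

lemma extend_free:
  assumes x: "free x" and cl: "closed_state s (orb x)" and k: "k \<in> options s x"
  obtains c where "solution c (orb x)" "\<And>y. y \<in> orb x \<Longrightarrow> c y \<in> options s y" "c x = k"
proof -
  define nf where "nf y = (THE ls. red ls \<and> ev ls x = y)" for y
  have nf_ev: "nf (ev ls x) = ls" if "red ls" for ls
    unfolding nf_def using free_unique[OF x] that by (intro the_equality) auto
  have ex: "\<exists>ls. red ls \<and> y = ev ls x" if "y \<in> orb x" for y using that orb_red by metis
  have nfx: "nf x = []" using nf_ev[of "[]"] by simp
  show ?thesis
  proof (rule extend_solution[of "orb x" s "{x}" "\<lambda>y. tgt (hd (nf y))" "\<lambda>y. length (nf y)" "\<lambda>_. k"])
    fix y assume "y \<in> orb x - {x}"
    then obtain l ls where y: "red (l # ls)" "y = ev (l # ls) x"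
      using ex[of y] by (metis DiffE ev.simps(1) list.exhaust singletonI)
    have ls: "red ls" "valid l" using y by auto
    have "ev ls x \<in> orb x" using ls red_walk orb_ev by auto
    moreover have "ev ls x \<in> {x} \<or> tgt (hd (nf (ev ls x))) \<noteq> src l"
      using y nf_ev[OF ls(1)] by (cases "ls = []") auto
    ultimately show "\<exists>l z. valid l \<and> z \<in> orb x \<and> lk l z = y \<and> tgt l = tgt (hd (nf y)) \<and>
        length (nf z) < length (nf y) \<and> (z \<in> {x} \<or> tgt (hd (nf z)) \<noteq> src l)"
      using y ls nf_ev[OF y(1)] nf_ev[OF ls(1)]
      by (intro exI[of _ l] exI[of _ "ev ls x"]) auto
  next
    fix y l assume "y \<in> orb x - {x}" and l: "valid l" "\<not> trivial_link l" "src l \<noteq> tgt (hd (nf y))"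
    then obtain ls where ls: "red ls" "y = ev ls x" using ex[of y] by auto
    have r: "red (l # ls)" using l ls nf_ev[OF ls(1)] by auto
    have e: "lk l y = ev (l # ls) x" using ls by simp
    have "nf (lk l y) = l # ls" unfolding e by (rule nf_ev[OF r])
    then show "lk l y \<notin> {x} \<and> tgt (hd (nf (lk l y))) = tgt l" using nfx by auto
  next
    fix y l assume y: "y \<in> {x}" "valid l" "lk l y \<in> {x}"
    have "trivial_link l"
    proof (rule ccontr)
      assume "\<not> trivial_link l"
      then have "red [l]" using y by simp
      then show False using x y unfolding free_def by (metis ev.simps list.discI singletonD)
    qed
    then have "src l = tgt l" "amt l = 0" by (cases l; auto)+
    then show "obeys (\<lambda>_. k) l y" by (simp add: obeys_def)
  qed (use k cl orb_lk that in auto)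
qed

end

section \<open>Orbits with a closed chain\<close>

context chain_system
begin

primrec odd_chain :: "('j, 'g) link list \<Rightarrow> bool" where
  "odd_chain [] = False"
| "odd_chain (l # ls) = (od (amt l) \<noteq> odd_chain ls)"

lemma odd_chain_append: "odd_chain (ls @ ms) = (odd_chain ls \<noteq> odd_chain ms)"
  by (induction ls) auto

definition closed_chain :: "('j, 'g) link list \<Rightarrow> 'x \<Rightarrow> bool" where
  "closed_chain c y \<longleftrightarrow> red c \<and> c \<noteq> [] \<and> ev c y = y"

definition departure :: "('j, 'g) link list \<Rightarrow> 'j" where "departure c = src (last c)"
definition arrival :: "('j, 'g) link list \<Rightarrow> 'j" where "arrival c = tgt (hd c)"

lemma closed_chain_rev: "closed_chain c y \<Longrightarrow> closed_chain (rev_chain c) y"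
  unfolding closed_chain_def using ev_rev_chain[of c y] red_walk by auto

lemma departure_rev: "c \<noteq> [] \<Longrightarrow> departure (rev_chain c) = arrival c"
  by (simp add: departure_def arrival_def last_rev_chain)

lemma arrival_rev: "c \<noteq> [] \<Longrightarrow> arrival (rev_chain c) = departure c"
  by (simp add: departure_def arrival_def hd_rev_chain)

text \<open>
  In a forest with a single cycle, a closed chain at a point off the cycle runs to the cycle, around
  it and back the same way, so it leaves and returns through the same half-edge.
\<close>
definition lollipop :: "'x \<Rightarrow> 'j \<Rightarrow> bool" where
  "lollipop y p \<longleftrightarrow> (\<exists>c. closed_chain c y \<and> departure c = p \<and> arrival c = p)"

text \<open>A chain that returns by the half-edge it left by is conjugated by its first step
  \<open>last c\<close>: seen from the neighbouring point, its final and first steps compose into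
  one link or cancel. Conjugation preserves parity.\<close>

lemma closed_chain_shorten:
  assumes "closed_chain c y" "departure c = arrival c" "length c \<noteq> 1"
  obtains c' where "closed_chain c' (lk (last c) y)" "length c' < length c" "odd_chain c' = odd_chain c"
proof -
  obtain a t where at: "c = a # t" using assms(1) by (cases c) (auto simp: closed_chain_def)
  then obtain m l where ml: "t = m @ [l]" using assms(3) by (cases t rule: rev_cases) auto
  have c: "c = a # m @ [l]" using at ml by simp
  have r: "red (a # m @ [l])" "ev (a # m @ [l]) y = y" "tgt a = src l"
    using assms unfolding c closed_chain_def departure_def arrival_def by auto
  then have v: "valid a" "valid l" "red m" "\<not> trivial_link a" "\<not> trivial_link l"
    by (auto simp: red_append)
  define y1 where "y1 = lk l y"
  have e: "lk l (lk a (ev m y1)) = y1" using r(2) unfolding y1_def by (simp add: ev_append)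
  have e': "lk (comp_link a l) (ev m y1) = y1" using lk_comp[OF v(1,2) r(3)] e by simp
  have vc: "valid (comp_link a l)" using v r by (auto intro: valid_comp)
  show ?thesis
  proof (cases "trivial_link (comp_link a l)")
    case True
    have "m \<noteq> []"
    proof
      assume "m = []"
      then have "tgt l \<noteq> src a" using r(1) by simp
      then show False using True by (simp add: trivial_comp_link)
    qed
    moreover have "ev m y1 = y1" using e' lk_trivial[OF vc True] by simp
    moreover have "amt a + amt l = 0" using True by (simp add: trivial_comp_link)
    then have "od (amt a) = od (amt l)" using od_add[of "amt a" "amt l"] by simp
    ultimately show ?thesis using that[of m] v c unfolding closed_chain_def y1_def
      by (auto simp: odd_chain_append)
  next
    case False
    have "red (comp_link a l # m)" using r(1) vc False by (cases "m = []") (auto simp: red_append)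
    then show ?thesis using that[of "comp_link a l # m"] e' c unfolding closed_chain_def y1_def
      by (auto simp: odd_chain_append od_add)
  qed
qed

lemma lollipop_forward:
  assumes "lollipop y p" "valid l" "\<not> trivial_link l" "src l \<noteq> p"
  shows "lollipop (lk l y) (tgt l)"
proof -
  obtain c where c: "closed_chain c y" "departure c = p" "arrival c = p" using assms(1) unfolding lollipop_def by blast
  have "closed_chain (l # c @ [inv_link l]) (lk l y)"
    using c assms unfolding closed_chain_def departure_def arrival_def by (auto simp: red_append ev_append)
  then show ?thesis unfolding lollipop_def departure_def arrival_def
    by (intro exI[of _ "l # c @ [inv_link l]"]) auto
qed

text \<open>The edge at the departure half-edge may have other ends than the next point of the
  cycle. From such an end the cycle is entered directly, \<open>inv_link l\<close> and the first
  step \<open>f\<close> being composed, and the return is along \<open>l\<close>.\<close>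

lemma lollipop_leave_departure:
  assumes c: "closed_chain c y" "departure c \<noteq> arrival c" and l: "valid l" "\<not> trivial_link l"
    "src l = departure c" "l \<noteq> last c"
  shows "lollipop (lk l y) (tgt l)"
proof -
  obtain d f where df: "c = d @ [f]" using c(1) by (cases c rule: rev_cases) (auto simp: closed_chain_def)
  have r: "red d" "valid f" "\<not> trivial_link f" "d = [] \<or> src (last d) \<noteq> tgt f" "src l = src f" "l \<noteq> f"
    using c l unfolding closed_chain_def df departure_def by (auto simp: red_append)
  have fix_y: "ev d (lk f y) = y" using c unfolding closed_chain_def df by (simp add: ev_append)
  have nt: "\<not> trivial_link (comp_link (inv_link l) f)"
    using r(5,6) by (cases l; cases f) (auto simp: trivial_comp_link)
  have vc: "valid (comp_link (inv_link l) f)" using r l by (auto intro: valid_comp)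
  have "closed_chain (l # d @ [comp_link (inv_link l) f]) (lk l y)"
  proof -
    have "lk (comp_link (inv_link l) f) (lk l y) = lk f y"
      using l r by (simp flip: lk_comp)
    then have "ev (l # d @ [comp_link (inv_link l) f]) (lk l y) = lk l y"
      using fix_y by (simp add: ev_append)
    moreover have "red (l # d @ [comp_link (inv_link l) f])"
      using r l nt vc c(2) unfolding df departure_def arrival_def
      by (cases "d = []") (auto simp: red_append)
    ultimately show ?thesis unfolding closed_chain_def by simp
  qed
  then show ?thesis unfolding lollipop_def departure_def arrival_def
    by (intro exI[of _ "l # d @ [comp_link (inv_link l) f]"]) auto
qed

lemma lollipop_leave:
  assumes c: "closed_chain c y" "departure c \<noteq> arrival c" and l: "valid l" "\<not> trivial_link l"
    "l \<noteq> last c" "l \<noteq> inv_link (hd c)"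
  shows "lollipop (lk l y) (tgt l)"
proof -
  have ne: "c \<noteq> []" using c by (simp add: closed_chain_def)
  consider "src l = departure c" | "src l = arrival c" | "src l \<noteq> departure c" "src l \<noteq> arrival c" by blast
  then show ?thesis
  proof cases
    case 1
    then show ?thesis using lollipop_leave_departure assms by blast
  next
    case 2
    have "src l = departure (rev_chain c)" "departure (rev_chain c) \<noteq> arrival (rev_chain c)" "l \<noteq> last (rev_chain c)"
      using 2 c l ne by (auto simp: departure_rev arrival_rev last_rev_chain)
    then show ?thesis using lollipop_leave_departure[OF closed_chain_rev[OF c(1)]] l by blast
  next
    case 3
    have "closed_chain (l # c @ [inv_link l]) (lk l y)"
      using c l 3 unfolding closed_chain_def departure_def arrival_def by (auto simp: red_append ev_append)
    then show ?thesis unfolding lollipop_def departure_def arrival_def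
      by (intro exI[of _ "l # c @ [inv_link l]"]) auto
  qed
qed

text \<open>Departure and arrival being different makes the new seam reduced; the old junction of
  \<open>p\<close> and \<open>q\<close> was reduced, which makes the new departure and arrival
  different.\<close>

lemma closed_chain_rotate:
  assumes "closed_chain (p @ q) y" "departure (p @ q) \<noteq> arrival (p @ q)" "p \<noteq> []"
  shows "closed_chain (q @ p) (ev q y)" "departure (q @ p) \<noteq> arrival (q @ p)"
proof -
  show "closed_chain (q @ p) (ev q y)"
    using assms unfolding closed_chain_def departure_def arrival_def
    by (auto simp: red_append ev_append split: if_splits)
  show "departure (q @ p) \<noteq> arrival (q @ p)"
    using assms unfolding closed_chain_def departure_def arrival_def
    by (cases "q = []") (auto simp: red_append ev_append)
qed

end

text \<open>The last three assumptions abstract isometries of the sphere that fix a point: improper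
  ones are reflections, proper ones are rotations about a common axis, and an odd link from
  \<open>v\<close> to \<open>v\<close> is conjugate to an odd power of the rotoreflection, which
  fixes nothing.\<close>

locale axial_csp = congruence_csp J cls sy od lk Col S H
  for J :: "'j set" and cls :: "'j \<Rightarrow> 'k" and sy :: "'j \<Rightarrow> bool"
    and od :: "'g::{ab_group_add,finite} \<Rightarrow> bool"
    and lk :: "('j, 'g) link \<Rightarrow> 'x \<Rightarrow> 'x"
    and Col :: "'c set" and S :: "'j \<Rightarrow> 'c set" and H :: "'j \<Rightarrow> bool \<Rightarrow> nat" +
  fixes M :: "'x set"
  assumes lk_M: "\<lbrakk>valid l; x \<in> M\<rbrakk> \<Longrightarrow> lk l x \<in> M"
    and odd_involution: "\<lbrakk>walk c; x \<in> M; ev c x = x; odd_chain c\<rbrakk> \<Longrightarrow> ev c (ev c z) = z"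
    and even_commute: "\<lbrakk>walk a; walk b; x \<in> M; ev a x = x; ev b x = x; \<not> odd_chain a; \<not> odd_chain b\<rbrakk>
      \<Longrightarrow> ev a (ev b z) = ev b (ev a z)"
    and odd_link: "\<lbrakk>valid l; src l = tgt l; od (amt l); x \<in> M\<rbrakk> \<Longrightarrow> lk l x \<noteq> x"
begin

lemma ev_M: "\<lbrakk>walk ls; x \<in> M\<rbrakk> \<Longrightarrow> ev ls x \<in> M"
  by (induction ls) (auto simp: lk_M)

lemma orb_M: "\<lbrakk>y \<in> orb x; x \<in> M\<rbrakk> \<Longrightarrow> y \<in> M"
  unfolding orb_def using ev_M by blast

text \<open>If departure and arrival differ, \<open>c @ c\<close> is reduced, yet for odd
  \<open>c\<close> it would act as the identity. Otherwise \<open>c\<close> can be shortened until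
  it is a single link, which cannot be odd.\<close>

lemma closed_chain_even:
  assumes "closed_chain c y" "y \<in> M"
  shows "\<not> odd_chain c"
  using assms
proof (induction "length c" arbitrary: c y rule: less_induct)
  case less
  have w: "walk c" using less.prems(1) red_walk unfolding closed_chain_def by blast
  show ?case
  proof (cases "departure c = arrival c")
    case False
    show ?thesis
    proof
      assume "odd_chain c"
      then have "ev c (ev c z) = z" for z
        using odd_involution[OF w less.prems(2)] less.prems(1) unfolding closed_chain_def by blast
      then have "ev (c @ c) z = z" for z by (simp add: ev_append)
      moreover have "red (c @ c)"
        using less.prems(1) False unfolding closed_chain_def departure_def arrival_def by (simp add: red_append)
      ultimately show False using faithful[of "c @ c"] less.prems(1) unfolding closed_chain_def by blast
    qed
  next
    case True
    show ?thesis
    proof (cases "length c = 1")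
      case 1: True
      then obtain l where l: "c = [l]" by (cases c) auto
      then show ?thesis
        using odd_link[of l y] less.prems True unfolding closed_chain_def departure_def arrival_def by auto
    next
      case False
      obtain c' where c': "closed_chain c' (lk (last c) y)" "length c' < length c" "odd_chain c' = odd_chain c"
        using closed_chain_shorten[OF less.prems(1) True False] .
      have "valid (last c)" using w less.prems(1) unfolding closed_chain_def walk_def by simp
      then show ?thesis using less.hyps[OF c'(2,1)] lk_M less.prems(2) c'(3) by blast
    qed
  qed
qed

text \<open>Closed chains at a point commute, and reduced chains are determined by their action.\<close>
lemma closed_chain_no_conjugate:
  assumes "closed_chain a y" "closed_chain b y" "y \<in> M"
  shows "\<not> red (a @ b @ rev_chain a)"
proof
  assume r: "red (a @ b @ rev_chain a)"
  have w: "walk a" "walk b" using assms red_walk unfolding closed_chain_def by blast+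
  have "ev a (ev b z) = ev b (ev a z)" for z
    using even_commute[OF w assms(3)] closed_chain_even assms unfolding closed_chain_def by blast
  then have "ev (a @ b @ rev_chain a) z = ev b z" for z using w by (simp add: ev_append)
  moreover have "red b" using assms unfolding closed_chain_def by blast
  ultimately have "a @ b @ rev_chain a = b" using ev_unique[OF r] by blast
  then have "length (a @ b @ rev_chain a) = length b" by simp
  then show False using assms(1) unfolding closed_chain_def by simp
qed

text \<open>At different half-edges nothing cancels in the conjugate of one closed chain by the
  other, although the two commute.\<close>

lemma lollipop_unique:
  assumes "lollipop y p" "lollipop y q" "y \<in> M"
  shows "p = q"
proof (rule ccontr)
  assume "p \<noteq> q"
  obtain a b where ab: "closed_chain a y" "departure a = p" "arrival a = p" "closed_chain b y" "departure b = q" "arrival b = q"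
    using assms unfolding lollipop_def by blast
  then have "red (a @ b @ rev_chain a)" using \<open>p \<noteq> q\<close>
    unfolding closed_chain_def departure_def arrival_def by (auto simp: red_append hd_rev_chain)
  then show False using closed_chain_no_conjugate ab assms by blast
qed

text \<open>The half-edge \<open>p\<close> differs from the departure or from the arrival of
  \<open>b\<close>; conjugation by \<open>b\<close> in the corresponding direction is free of
  cancellation.\<close>

lemma lollipop_not_cyclic:
  assumes "lollipop y p" "closed_chain b y" "y \<in> M"
  shows "departure b = arrival b"
proof (rule ccontr)
  assume ne: "departure b \<noteq> arrival b"
  obtain a where a: "closed_chain a y" "departure a = p" "arrival a = p"
    using assms unfolding lollipop_def by blast
  show False
  proof (cases "departure b = p")
    case True
    then have "red (rev_chain b @ a @ rev_chain (rev_chain b))"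
      using a assms(2) ne unfolding closed_chain_def departure_def arrival_def
      by (auto simp: red_append hd_rev_chain last_rev_chain)
    then show False using closed_chain_no_conjugate closed_chain_rev a assms by blast
  next
    case False
    then have "red (b @ a @ rev_chain b)"
      using a assms(2) ne unfolding closed_chain_def departure_def arrival_def
      by (auto simp: red_append hd_rev_chain last_rev_chain)
    then show False using closed_chain_no_conjugate a assms by blast
  qed
qed

section \<open>Colouring the orbit of a non-free point\<close>

lemma closed_state_None: "closed_state (\<lambda>_ _. None) Y"
  unfolding closed_state_def options_def using Col_nonempty literal_nonempty by auto

lemma options_None [simp]: "options (\<lambda>_ _. None) y = Col"
  unfolding options_def by auto

text \<open>The hypotheses make the orbit of \<open>y0\<close> a forest rooted at \<open>C\<close>.\<close>

lemma extend_from_root: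
  assumes M: "y0 \<in> M" and C: "C \<subseteq> orb y0" "y0 \<in> C"
    and root: "\<And>ls. red ls \<Longrightarrow> ev ls y0 \<in> C \<or> ls \<noteq> [] \<and> lollipop (ev ls y0) (tgt (hd ls))"
    and notC: "\<And>y l. \<lbrakk>y \<in> orb y0 - C; valid l; \<not> trivial_link l; \<not> lollipop y (src l)\<rbrakk> \<Longrightarrow> lk l y \<notin> C"
    and cC: "\<And>y. y \<in> C \<Longrightarrow> cC y \<in> Col" "\<And>y l. \<lbrakk>y \<in> C; valid l; lk l y \<in> C\<rbrakk> \<Longrightarrow> obeys cC l y"
  shows "\<exists>c. solution c (orb y0)"
proof -
  \<comment> \<open>Off \<open>C\<close> a closed chain has to set out towards the root, so its
    half-edge serves as parent; the distance from \<open>y0\<close> serves as rank.\<close>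
  define par where "par y = (SOME p. lollipop y p)" for y
  have par: "par y = p" if "lollipop y p" "y \<in> orb y0" for y p
    using lollipop_unique[of y "par y" p] that orb_M[OF _ M] someI[of "lollipop y" p]
    unfolding par_def by blast
  define rk where "rk y = (LEAST n. \<exists>ls. red ls \<and> ev ls y0 = y \<and> length ls = n)" for y
  have rk_le: "rk (ev ls y0) \<le> length ls" if "red ls" for ls
    unfolding rk_def using that by (intro Least_le) blast
  have rk_ex: "\<exists>ls. red ls \<and> ev ls y0 = y \<and> length ls = rk y" if "y \<in> orb y0" for y
  proof -
    obtain ls where "red ls" "y = ev ls y0" using orb_red[OF \<open>y \<in> orb y0\<close>] .
    then have "\<exists>n ls. red ls \<and> ev ls y0 = y \<and> length ls = n" by blast
    then show ?thesis unfolding rk_def by (rule LeastI_ex)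
  qed
  show ?thesis
  proof (rule extend_solution[of "orb y0" "\<lambda>_ _. None" C par rk cC])
    fix y assume y: "y \<in> orb y0 - C"
    then obtain ls where ls: "red ls" "ev ls y0 = y" "length ls = rk y" using rk_ex by blast
    then obtain l ms where lm: "ls = l # ms" using y C(2) by (cases ls) auto
    have ms: "red ms" "valid l" using ls lm by auto
    have z: "ev ms y0 \<in> orb y0" using ms red_walk orb_ev by auto
    have "tgt l = par y" using root[OF ls(1)] ls lm y par by auto
    moreover have "ev ms y0 \<in> C \<or> par (ev ms y0) \<noteq> src l"
      using root[OF ms(1)] par[OF _ z] ls(1) lm by auto
    moreover have "rk (ev ms y0) < rk y" using rk_le[OF ms(1)] ls(3) lm by simp
    ultimately show "\<exists>l z. valid l \<and> z \<in> orb y0 \<and> lk l z = y \<and> tgt l = par y \<and>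
        rk z < rk y \<and> (z \<in> C \<or> par z \<noteq> src l)"
      using ms(2) z ls(2) lm by (intro exI[of _ l] exI[of _ "ev ms y0"]) simp
  next
    fix y l assume y: "y \<in> orb y0 - C" and l: "valid l" "\<not> trivial_link l" "src l \<noteq> par y"
    then obtain ls where ls: "red ls" "ev ls y0 = y" using rk_ex by blast
    then have lp: "lollipop y (tgt (hd ls))" using root[OF ls(1)] y by auto
    then have p: "par y = tgt (hd ls)" using par y by blast
    have "lollipop (lk l y) (tgt l)" using lollipop_forward[OF lp l(1,2)] l(3) p by simp
    moreover have "lk l y \<in> orb y0" using y l orb_lk by blast
    moreover have "\<not> lollipop y (src l)" using par[of y "src l"] y l(3) by auto
    ultimately show "lk l y \<notin> C \<and> par (lk l y) = tgt l"
      using par notC[OF y l(1,2)] by blast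
  qed (use C cC closed_state_None orb_lk in auto)
qed


text \<open>\<open>f i\<close> is the colour of the point reached after \<open>i\<close> links,
  \<open>e\<close> the value on the half-edge \<open>w0\<close> by which the start is entered, and
  \<open>d\<close> the value on the half-edge by which the end is entered; the end itself is not yet
  coloured.\<close>

primrec traces :: "'j \<Rightarrow> bool \<Rightarrow> (nat \<Rightarrow> 'c) \<Rightarrow> ('j, 'g) link list \<Rightarrow> bool \<Rightarrow> bool" where
  "traces w0 e f [] d \<longleftrightarrow> d = e"
| "traces w0 e f (l # ls) d \<longleftrightarrow> f (length ls) \<in> Col \<and>
     traces w0 e f ls (f (length ls) \<in> S (if ls = [] then w0 else tgt (hd ls))) \<and>
     d = ((f (length ls) \<in> S (src l)) \<noteq> od (amt l))"

lemma traces_cong: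
  "(\<And>i. i < length ls \<Longrightarrow> f i = g i) \<Longrightarrow> traces w0 e f ls d = traces w0 e g ls d"
  by (induction ls arbitrary: d) auto

text \<open>At each point the arriving value either leaves the next half-edge open, and then both
  values can be carried to the end, or it forces the next value and \<open>H\<close> drops. The
  empty chain is separate because no drop has occurred yet.\<close>

lemma traces_steer:
  assumes "red ls" "ls = [] \<or> src (last ls) \<noteq> w0" "w0 \<in> J"
  shows "(\<forall>d. \<exists>f. traces w0 e f ls d) \<or>
    (\<exists>d f. traces w0 e f ls d \<and> (if ls = [] then d = e else H (tgt (hd ls)) d < H w0 e))"
  using assms
proof (induction ls)
  case (Cons l ls)
  define a where "a = (if ls = [] then w0 else tgt (hd ls))"
  have l: "valid l" "src l \<noteq> a" "src l \<in> J" "a \<in> J"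
    using Cons.prems valid_J by (cases ls; auto simp: a_def)+
  have ext: "traces w0 e (f(length ls := k)) (l # ls) ((k \<in> S (src l)) \<noteq> od (amt l))"
    if "traces w0 e f ls (k \<in> S a)" "k \<in> Col" for f k
    using that traces_cong[of ls f "f(length ls := k)" w0 e "k \<in> S a"] by (simp add: a_def)
  have "(\<forall>d. \<exists>f. traces w0 e f ls d) \<or>
    (\<exists>d f. traces w0 e f ls d \<and> (if ls = [] then d = e else H (tgt (hd ls)) d < H w0 e))"
  proof (rule Cons.IH)
    show "red ls" "w0 \<in> J" using Cons.prems by simp_all
    show "ls = [] \<or> src (last ls) \<noteq> w0" using Cons.prems(2) by (cases "ls = []") simp_all
  qed
  then consider (all) "\<forall>d. \<exists>f. traces w0 e f ls d"
    | (forced) d f where "traces w0 e f ls d" "H a d \<le> H w0 e"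
    unfolding a_def by (auto split: if_splits intro: less_imp_le)
  then show ?case
  proof cases
    case all
    have "\<exists>f. traces w0 e f (l # ls) d" for d
    proof -
      obtain k where k: "k \<in> Col" "(k \<in> S (src l)) = (d \<noteq> od (amt l))"
        using literal_nonempty[OF l(3)] by blast
      obtain f where "traces w0 e f ls (k \<in> S a)" using all by blast
      moreover have eq: "((k \<in> S (src l)) \<noteq> od (amt l)) = d" using k(2) by auto
      ultimately show ?thesis using ext[OF _ k(1), unfolded eq] by blast
    qed
    then show ?thesis by blast
  next
    case forced
    obtain k0 where k0: "k0 \<in> Col" "(k0 \<in> S a) = d" using literal_nonempty[OF l(4)] by blast
    define b where "b = (k0 \<in> S (src l))"
    show ?thesis
    proof (cases "\<exists>k\<in>Col. (k \<in> S a) = d \<and> (k \<in> S (src l)) \<noteq> b")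
      case True
      then obtain k where k: "k \<in> Col" "(k \<in> S a) = d" "(k \<in> S (src l)) = (\<not> b)" by blast
      have "\<exists>f. traces w0 e f (l # ls) x" for x
      proof -
        obtain k1 where k1: "k1 \<in> Col" "(k1 \<in> S a) = d" "(k1 \<in> S (src l)) = (x \<noteq> od (amt l))"
          using k0 k b_def by (cases "b = (x \<noteq> od (amt l))") auto
        have eq: "((k1 \<in> S (src l)) \<noteq> od (amt l)) = x" using k1(3) by auto
        have "traces w0 e f ls (k1 \<in> S a)" using forced(1) k1(2) by simp
        from ext[OF this k1(1), unfolded eq] show ?thesis by blast
      qed
      then show ?thesis by blast
    next
      case False
      have "H (src l) b < H a d"
        using H_less[of a "src l" d b] l False by blast
      then have "H (tgt l) (b \<noteq> od (amt l)) < H w0 e"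
        using H_link[OF l(1), of b] forced(2) by simp
      moreover have "traces w0 e (f(length ls := k0)) (l # ls) (b \<noteq> od (amt l))"
        using ext[of f k0] forced(1) k0 b_def by simp
      ultimately show ?thesis
        by (intro disjI2 exI[of _ "b \<noteq> od (amt l)"] exI[of _ "f(length ls := k0)"])
          (simp del: traces.simps fun_upd_apply)
    qed
  qed
qed auto

text \<open>
  If neither truth value could be carried around the cycle unchanged, each would be forced into the
  other one, and \<open>H\<close> would decrease strictly both ways.
\<close>
lemma traces_closed:
  assumes "red c" "c \<noteq> []" "departure c \<noteq> arrival c"
  obtains e f where "traces (arrival c) e f c e"
proof -
  have J: "arrival c \<in> J" using assms valid_J by (cases c) (auto simp: arrival_def)
  have st: "(\<exists>f. traces (arrival c) e f c e) \<or> H (arrival c) (\<not> e) < H (arrival c) e" for e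
  proof -
    have "(\<forall>d. \<exists>f. traces (arrival c) e f c d) \<or>
        (\<exists>d f. traces (arrival c) e f c d \<and> H (arrival c) d < H (arrival c) e)"
      using traces_steer[OF assms(1) _ J, of e] assms(2,3) unfolding departure_def arrival_def by simp
    then show ?thesis
    proof
      assume "\<exists>d f. traces (arrival c) e f c d \<and> H (arrival c) d < H (arrival c) e"
      then obtain d f where "traces (arrival c) e f c d" "H (arrival c) d < H (arrival c) e" by blast
      then show ?thesis by (cases "d = e") auto
    qed blast
  qed
  from st[of True] st[of False] show ?thesis using that by auto
qed

lemma traces_obeys:
  assumes "traces w0 e f (p @ l # q) d"
  shows "f (length q) \<in> Col"
    and "((f (length q) \<in> S (src l)) \<noteq> od (amt l)) =
      (if p = [] then d else f (Suc (length q)) \<in> S (tgt l))"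
proof -
  have "f (length q) \<in> Col \<and> ((f (length q) \<in> S (src l)) \<noteq> od (amt l)) =
      (if p = [] then d else f (Suc (length q)) \<in> S (tgt l))"
    using assms
  proof (induction p arbitrary: d)
    case (Cons a p)
    then show ?case by (cases p) auto
  qed simp
  then show "f (length q) \<in> Col"
    and "((f (length q) \<in> S (src l)) \<noteq> od (amt l)) =
      (if p = [] then d else f (Suc (length q)) \<in> S (tgt l))" by auto
qed

lemma traces_start:
  assumes "traces w0 e f c d" "c \<noteq> []"
  shows "(f 0 \<in> S w0) = e"
  using assms
proof (induction c arbitrary: d)
  case (Cons l c)
  then show ?case by (cases c) auto
qed simp

lemma solution_on_cycle:
  assumes M: "y0 \<in> M" and c: "closed_chain c y0" "departure c \<noteq> arrival c"
    and min: "\<And>y c'. \<lbrakk>y \<in> orb y0; closed_chain c' y\<rbrakk> \<Longrightarrow> length c \<le> length c'"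
  shows "\<exists>c. solution c (orb y0)"
proof -
  have rc: "red c" "c \<noteq> []" "ev c y0 = y0" using c unfolding closed_chain_def by auto
  \<comment> \<open>The condition \<open>p \<noteq> []\<close> omits the full chain, whose end is
    \<open>y0\<close> again, so that each point of the cycle belongs to one suffix only.\<close>
  define C where "C = {ev q y0 | p q. c = p @ q \<and> p \<noteq> []}"
  obtain e f where tr: "traces (arrival c) e f c e" using traces_closed[OF rc(1,2) c(2)] .
  \<comment> \<open>Two suffixes with the same end would differ by a closed chain shorter than
    \<open>c\<close>.\<close>
  have inj: "length q = length q'" if q: "c = p @ q" "p \<noteq> []" "c = p' @ q'" "p' \<noteq> []"
    "ev q y0 = ev q' y0" for p q p' q'
  proof -
    have less: "\<not> length q < length q'" if q: "c = p @ q" "p \<noteq> []" "c = p' @ q'" "p' \<noteq> []"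
      "ev q y0 = ev q' y0" for p q p' q'
    proof
      assume "length q < length q'"
      moreover have "length p + length q = length p' + length q'"
        using q(1,3) by (metis length_append)
      ultimately have p: "length q' - length q + length p' = length p" by simp
      have "q' = drop (length p') c" using q(3) by simp
      moreover have "q = drop (length p) c" using q(1) by simp
      ultimately have "drop (length q' - length q) q' = q" using p by simp
      then obtain r where r: "q' = r @ q" by (metis append_take_drop_id)
      then have "r \<noteq> []" using \<open>length q < length q'\<close> by auto
      have "red q'" using rc(1) q(3) by (simp add: red_append)
      then have "red r" "red q" using r(1) by (auto simp: red_append)
      moreover have "ev r (ev q y0) = ev q y0" using q(5) r(1) by (simp add: ev_append)
      ultimately have "closed_chain r (ev q y0)" using \<open>r \<noteq> []\<close> unfolding closed_chain_def by blast
      moreover have "ev q y0 \<in> orb y0" using \<open>red q\<close> red_walk orb_ev by auto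
      ultimately have "length c \<le> length r" using min by blast
      moreover have "length c = length p' + length r + length q" using q(3) r by simp
      ultimately show False using q(4) by simp
    qed
    show ?thesis using less[OF q] less[OF q(3,4,1,2) q(5)[symmetric]] by simp
  qed
  define cC where "cC y = f (SOME n. \<exists>p q. c = p @ q \<and> p \<noteq> [] \<and> ev q y0 = y \<and> length q = n)" for y
  have cC: "cC (ev q y0) = f (length q)" if "c = p @ q" "p \<noteq> []" for p q
  proof -
    have "(SOME n. \<exists>p' q'. c = p' @ q' \<and> p' \<noteq> [] \<and> ev q' y0 = ev q y0 \<and> length q' = n) = length q"
      by (rule some_equality) (use that inj in blast)+
    then show ?thesis unfolding cC_def by simp
  qed
  \<comment> \<open>For \<open>p = []\<close> the link leads back to \<open>y0\<close>; there it
    matters that the traced end value equals the start value \<open>e\<close>.\<close>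
  have step: "lk l (ev q y0) \<in> C \<and> obeys cC l (ev q y0)" if q: "c = p @ l # q" for p l q
  proof (cases "p = []")
    case True
    then have "ev [] y0 = lk l (ev q y0)" using rc q by simp
    then have y0: "lk l (ev q y0) = y0" by simp
    have "y0 \<in> C" unfolding C_def using rc(2) by (intro CollectI exI[of _ "[]"] exI[of _ c]) auto
    moreover have "cC y0 = f 0" using cC[of c "[]"] rc(2) by simp
    moreover have "cC (ev q y0) = f (length q)" using cC[of "p @ [l]" q] q by simp
    moreover have "arrival c = tgt l" using True q by (simp add: arrival_def)
    ultimately show ?thesis
      using traces_obeys(2)[of _ _ _ p l q] tr q True traces_start[OF tr rc(2)] y0
      unfolding obeys_def by auto
  next
    case False
    have "cC (ev q y0) = f (length q)" using cC[of "p @ [l]" q] q by simp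
    moreover have "cC (ev (l # q) y0) = f (Suc (length q))" using cC[of p "l # q"] q False by simp
    moreover have "ev (l # q) y0 \<in> C" unfolding C_def using q False by blast
    ultimately show ?thesis
      using traces_obeys(2)[of _ _ _ p l q] tr q False unfolding obeys_def by auto
  qed
  have obeys_inv: "obeys cC (inv_link l) (lk l y)" if "obeys cC l y" "valid l" for l y
    using that unfolding obeys_def by auto
  have rot: "closed_chain (q @ p) (ev q y0) \<and> departure (q @ p) \<noteq> arrival (q @ p)" if "c = p @ q" "p \<noteq> []" for p q
    using closed_chain_rotate[of p q y0] c that by blast
  have C_orb: "C \<subseteq> orb y0"
    unfolding C_def using rc(1) red_walk orb_ev by (auto simp: red_append)
  have C_step: "lk l y \<in> C \<and> obeys cC l y \<or> lollipop (lk l y) (tgt l)"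
    if y: "y \<in> C" and l: "valid l" "\<not> trivial_link l" for y l
  proof -
    obtain p q where q: "c = p @ q" "p \<noteq> []" "y = ev q y0" using y unfolding C_def by blast
    show ?thesis
    proof (cases "l = last (q @ p) \<or> l = inv_link (hd (q @ p))")
      case False
      then show ?thesis using lollipop_leave[of "q @ p" y l] rot[OF q(1,2)] q(3) l by blast
    next
      case True
      then consider (fwd) "l = last p" | (bwd) "l = inv_link (hd (q @ p))" using q(2) by auto
      then show ?thesis
      proof cases
        case fwd
        then have "c = butlast p @ l # q" using q(1,2) by simp
        then show ?thesis using step q(3) by blast
      next
        case bwd
        obtain p' h q' where h: "c = p' @ h # q'" "l = inv_link h" "y = lk h (ev q' y0)"
        proof (cases q)
          case Nil
          then have "c = [] @ hd c # tl c" "l = inv_link (hd c)" using q(1) bwd rc(2) by auto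
          moreover have "y = lk (hd c) (ev (tl c) y0)"
            using q(3) Nil rc(2,3) by (cases c) auto
          ultimately show ?thesis using that by blast
        next
          case (Cons h q')
          then show ?thesis using that[of p h q'] q bwd by simp
        qed
        have "valid h" using l(1) h(2) by simp
        have "ev q' y0 \<in> C" unfolding C_def using h(1)
          by (intro CollectI exI[of _ q'] exI[of _ "p' @ [h]"]) auto
        then show ?thesis using step[OF h(1)] obeys_inv[of h "ev q' y0"] \<open>valid h\<close> h(2,3) by simp
      qed
    qed
  qed
  have C_cyc: "\<exists>b. closed_chain b y \<and> departure b \<noteq> arrival b" if "y \<in> C" for y
    using that rot unfolding C_def by blast
  have C_not: "\<not> lollipop y p" if "y \<in> C" for y p
    using C_cyc[OF that] lollipop_not_cyclic orb_M[OF _ M] C_orb that by blast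
  show ?thesis
  proof (rule extend_from_root[OF M C_orb])
    show y0C: "y0 \<in> C" unfolding C_def using rc(2)
      by (intro CollectI exI[of _ "[]"] exI[of _ c]) auto
    show "ev ls y0 \<in> C \<or> ls \<noteq> [] \<and> lollipop (ev ls y0) (tgt (hd ls))" if "red ls" for ls
      using that
    proof (induction ls)
      case (Cons l ls)
      then have l: "valid l" "\<not> trivial_link l" "red ls" by auto
      from Cons.IH[OF l(3)] show ?case
      proof
        assume "ev ls y0 \<in> C"
        then show ?thesis using C_step[OF _ l(1,2)] by auto
      next
        assume "ls \<noteq> [] \<and> lollipop (ev ls y0) (tgt (hd ls))"
        then show ?thesis using lollipop_forward[of _ _ l] Cons.prems l by auto
      qed
    qed (use y0C in simp)
    show "lk l y \<notin> C" if "y \<in> orb y0 - C" "valid l" "\<not> trivial_link l" "\<not> lollipop y (src l)" for y l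
    proof
      assume "lk l y \<in> C"
      from C_step[OF this, of "inv_link l"] that show False by auto
    qed
    show "cC y \<in> Col" if y: "y \<in> C" for y
    proof -
      obtain p q where q: "c = p @ q" "p \<noteq> []" "y = ev q y0" using y unfolding C_def by blast
      then have "c = butlast p @ last p # q" by simp
      then show ?thesis using traces_obeys(1) tr cC[OF q(1,2)] q(3) by metis
    qed
    show "obeys cC l y" if "y \<in> C" "valid l" "lk l y \<in> C" for y l
    proof (cases "trivial_link l")
      case True
      then have "src l = tgt l" "amt l = 0" by (cases l; auto)+
      then show ?thesis using lk_trivial[OF that(2) True] by (simp add: obeys_def)
    next
      case False
      then show ?thesis using C_step that C_not by blast
    qed
  qed
qed

text \<open>The cycle degenerates to one link fixing \<open>y0\<close>. Conjugating this loop along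
  its edge makes all other ends of the edge lollipops. Any colour suits \<open>y0\<close>, since a
  link from \<open>y0\<close> to itself stays on one half-edge and is even.\<close>

lemma solution_on_pole:
  assumes M: "y0 \<in> M" and l0: "valid l0" "\<not> trivial_link l0" "src l0 = tgt l0" "lk l0 y0 = y0"
    and no_cycle: "\<And>l. \<lbrakk>valid l; \<not> trivial_link l; lk l y0 = y0\<rbrakk> \<Longrightarrow> src l = tgt l"
  shows "\<exists>c. solution c (orb y0)"
proof -
  obtain k where k: "k \<in> Col" using Col_nonempty by blast
  have transfer: "lollipop (lk l y) (tgt l)" 
    if l: "valid l" "src l = src m" and m: "valid m" "\<not> trivial_link m" "src m = tgt m" "lk m y = y" for l m y
  proof -
    define n where "n = comp_link (comp_link (inv_link l) m) l"
    have n: "valid n" "src n = tgt l" "tgt n = tgt l" "amt n = amt m"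
      using l m by (auto simp: n_def intro!: valid_comp)
    have "lk n (lk l y) = lk l (lk m (lk (inv_link l) (lk l y)))"
      unfolding n_def using l m by (simp add: lk_comp[symmetric] valid_comp)
    then have "lk n (lk l y) = lk l y" using l m by simp
    moreover have "\<not> trivial_link n" using n m by (cases n; cases m) auto
    ultimately have "closed_chain [n] (lk l y)" using n unfolding closed_chain_def by simp
    then show ?thesis using n unfolding lollipop_def departure_def arrival_def by (intro exI[of _ "[n]"]) auto
  qed
  have y0: "lollipop y0 (src l0)"
    using l0 unfolding lollipop_def closed_chain_def departure_def arrival_def by (intro exI[of _ "[l0]"]) auto
  show ?thesis
  proof (rule extend_from_root[OF M, of "{y0}" "\<lambda>_. k"])
    show "ev ls y0 \<in> {y0} \<or> ls \<noteq> [] \<and> lollipop (ev ls y0) (tgt (hd ls))" if "red ls" for ls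
    proof -
      have "ls \<noteq> [] \<longrightarrow> lollipop (ev ls y0) (tgt (hd ls))"
        using that
      proof (induction ls)
        case (Cons l ls)
        then have l: "valid l" "\<not> trivial_link l" "red ls" by auto
        show ?case
        proof (cases "ls = []")
          case True
          then show ?thesis using l lollipop_forward[OF y0] transfer[of l l0] l0 by (cases "src l = src l0") auto
        next
          case False
          then show ?thesis using lollipop_forward[of _ _ l] Cons l by auto
        qed
      qed simp
      then show ?thesis by (cases "ls = []") auto
    qed
    show "lk l y \<notin> {y0}" if "y \<in> orb y0 - {y0}" "valid l" "\<not> trivial_link l" "\<not> lollipop y (src l)" for y l
    proof
      assume "lk l y \<in> {y0}"
      then have y: "y = lk (inv_link l) y0" using that(2) by auto
      show False
        using that transfer[of "inv_link l" l0 y0] lollipop_forward[OF y0, of "inv_link l"] l0 y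
        by (cases "tgt l = src l0") auto
    qed
    show "obeys (\<lambda>_. k) l y" if "y \<in> {y0}" "valid l" "lk l y \<in> {y0}" for y l
    proof -
      have "src l = tgt l" using no_cycle[of l] that by (cases "trivial_link l"; cases l) auto
      then show ?thesis using odd_link[of l y0] M that unfolding obeys_def by auto
    qed
  qed (use k in auto)
qed

text \<open>A closed chain that is shortest in the whole orbit either is a genuine cycle or, by
  \<open>closed_chain_shorten\<close>, consists of one link.\<close>

theorem solution_not_free:
  assumes "x \<in> M" "\<not> free x"
  shows "\<exists>c. solution c (orb x)"
proof -
  have "\<exists>n. \<exists>y c. y \<in> orb x \<and> closed_chain c y \<and> length c = n"
    using assms(2) orb_self unfolding free_def closed_chain_def by blast
  then obtain n where "\<exists>y c. y \<in> orb x \<and> closed_chain c y \<and> length c = n"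
    and n: "\<And>m. m < n \<Longrightarrow> \<not> (\<exists>y c. y \<in> orb x \<and> closed_chain c y \<and> length c = m)"
    using exists_least_iff[of "\<lambda>n. \<exists>y c. y \<in> orb x \<and> closed_chain c y \<and> length c = n"] by blast
  then obtain y c where y: "y \<in> orb x" "closed_chain c y" "length c = n" by blast
  have orb: "orb y = orb x" using orb_eq y by blast
  have yM: "y \<in> M" using orb_M y assms by blast
  have min: "length c \<le> length c'" if "z \<in> orb y" "closed_chain c' z" for z c'
    using n[of "length c'"] that y(3) orb by (cases "length c' < length c") auto
  show ?thesis
  proof (cases "departure c = arrival c")
    case False
    then show ?thesis using solution_on_cycle[OF yM y(2) False min] orb by simp
  next
    case True
    have "length c = 1"
    proof (rule ccontr)
      assume "length c \<noteq> 1"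
      then obtain c' where c': "closed_chain c' (lk (last c) y)" "length c' < length c"
        using closed_chain_shorten[OF y(2) True] by blast
      have "valid (last c)" using y(2) red_walk unfolding closed_chain_def walk_def by auto
      then have "lk (last c) y \<in> orb y" by (simp add: orb_lk)
      then show False using min c' by fastforce
    qed
    then obtain l0 where "c = [l0]" by (cases c) auto
    then have l0: "valid l0" "\<not> trivial_link l0" "src l0 = tgt l0" "lk l0 y = y"
      using y(2) True unfolding closed_chain_def departure_def arrival_def by auto
    then have "lollipop y (src l0)"
      unfolding lollipop_def closed_chain_def departure_def arrival_def by (intro exI[of _ "[l0]"]) auto
    then have "src l = tgt l" if "valid l" "\<not> trivial_link l" "lk l y = y" for l
      using lollipop_not_cyclic[of y _ "[l]"] that yM unfolding closed_chain_def departure_def arrival_def by auto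
    then show ?thesis using solution_on_pole[OF yM l0] orb by auto
  qed
qed

end

section \<open>How far knowledge spreads\<close>

context congruence_csp
begin

definition near :: "nat \<Rightarrow> 'x set \<Rightarrow> 'x \<Rightarrow> bool" where
  "near n F y \<longleftrightarrow> (\<exists>w f. walk w \<and> length w \<le> n \<and> f \<in> F \<and> y = ev w f)"

lemma nearI: "\<lbrakk>walk w; length w \<le> n; f \<in> F; y = ev w f\<rbrakk> \<Longrightarrow> near n F y"
  unfolding near_def by blast

lemma near_self: "f \<in> F \<Longrightarrow> near n F f"
  by (rule nearI[of "[]"]) auto

lemma near_trans:
  assumes "near m G y" "\<And>g. g \<in> G \<Longrightarrow> near n F g" "m + n \<le> p"
  shows "near p F y"
proof -
  obtain w g where w: "walk w" "length w \<le> m" "g \<in> G" "y = ev w g" using assms(1) near_def by auto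
  obtain u f where u: "walk u" "length u \<le> n" "f \<in> F" "g = ev u f" using assms(2)[OF w(3)] near_def by auto
  show ?thesis using w u assms(3) by (intro nearI[of "w @ u" p f]) (auto simp: ev_append)
qed

lemma near_lk: "\<lbrakk>near n F y; valid l\<rbrakk> \<Longrightarrow> near (Suc n) F (lk l y)"
  by (rule near_trans[of 1 "{y}" _ n]) (auto intro: nearI[of "[l]"])

lemma near_sym: "near n {z} y \<Longrightarrow> near n {y} z"
proof -
  assume "near n {z} y"
  then obtain w where w: "walk w" "length w \<le> n" "y = ev w z" unfolding near_def by auto
  show ?thesis by (rule nearI[of "rev_chain w"]) (use w in auto)
qed

lemma near_orb: "\<lbrakk>near n F y; F \<subseteq> orb x\<rbrakk> \<Longrightarrow> y \<in> orb x"
  unfolding near_def using orb_ev by blast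

definition steps_in :: "'x set \<Rightarrow> ('x \<times> 'x) set" where
  "steps_in F = {(a, b). a \<in> F \<and> b \<in> F \<and> (\<exists>l. valid l \<and> b = lk l a)}"

text \<open>Connectedness of \<open>F\<close> inside the orbit; on a free orbit this means a subtree
  containing \<open>x\<close>.\<close>

definition rooted :: "'x set \<Rightarrow> 'x \<Rightarrow> bool" where
  "rooted F x \<longleftrightarrow> x \<in> F \<and> F \<subseteq> orb x \<and> (\<forall>y\<in>F. (x, y) \<in> (steps_in F)\<^sup>*)"

lemma rooted_singleton: "rooted {x} x"
  unfolding rooted_def by auto

lemma steps_in_walk:
  assumes "walk w" "\<And>n. ev (drop n w) a \<in> F"
  shows "(a, ev w a) \<in> (steps_in F)\<^sup>*"
  using assms
proof (induction w)
  case (Cons l w)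
  have F: "ev (drop n w) a \<in> F" for n using Cons.prems(2)[of "Suc n"] by simp
  have "(a, ev w a) \<in> (steps_in F)\<^sup>*" using Cons F by simp
  moreover have "(ev w a, ev (l # w) a) \<in> steps_in F"
    using F[of 0] Cons.prems(2)[of 0] Cons.prems(1) unfolding steps_in_def
    by (auto simp del: split_paired_Ex)
  ultimately show ?case by (rule rtrancl_into_rtrancl)
qed simp

text \<open>
  Knowledge is a set of half-edges on which a solution \<open>c\<close> is revealed; it is closed when no
  other truth value can be inferred from it locally.
\<close>
definition closed_knowledge :: "('x \<Rightarrow> 'c) \<Rightarrow> ('x \<times> 'j) set \<Rightarrow> 'x set \<Rightarrow> bool" where
  "closed_knowledge c K Y \<longleftrightarrow> (\<forall>y\<in>Y.
     (\<forall>l. valid l \<and> (y, src l) \<in> K \<longrightarrow> (lk l y, tgt l) \<in> K) \<and>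
     (\<forall>u\<in>J. (y, u) \<notin> K \<longrightarrow>
        (\<exists>k\<in>Col. (\<forall>v\<in>J. (y, v) \<in> K \<longrightarrow> (k \<in> S v) = (c y \<in> S v)) \<and> (k \<in> S u) \<noteq> (c y \<in> S u))))"

definition infers :: "('x \<Rightarrow> 'j \<Rightarrow> bool option) \<Rightarrow> nat \<Rightarrow> ('x \<Rightarrow> 'c) \<Rightarrow> 'x set \<Rightarrow> 'x set \<Rightarrow> ('x \<times> 'j) set \<Rightarrow> bool" where
  "infers s L c F Y K \<longleftrightarrow> closed_knowledge c K Y \<and>
     (\<forall>y\<in>Y. \<forall>v\<in>J. s y v \<noteq> None \<or> y \<in> F \<longrightarrow> (y, v) \<in> K) \<and>
     (\<forall>y\<in>Y. \<forall>v\<in>J. (y, v) \<in> K \<longrightarrow> s y v \<noteq> None \<or> near L F y)"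

lemma infersD:
  assumes "infers s L c F Y K"
  shows "closed_knowledge c K Y"
    and "\<lbrakk>y \<in> Y; v \<in> J; s y v \<noteq> None \<or> y \<in> F\<rbrakk> \<Longrightarrow> (y, v) \<in> K"
    and "\<lbrakk>y \<in> Y; v \<in> J; (y, v) \<in> K\<rbrakk> \<Longrightarrow> s y v \<noteq> None \<or> near L F y"
  using assms unfolding infers_def by blast+

text \<open>Connectedness of \<open>F\<close> is what makes the empty state qualify: inference then
  reaches a point off \<open>F\<close> from one side only. Between two separate revealed points a
  value could be forced by two literals jointly, and \<open>H\<close> controls only implications
  from a single literal.\<close>

definition spreads_within :: "('x \<Rightarrow> 'j \<Rightarrow> bool option) \<Rightarrow> nat \<Rightarrow> 'x \<Rightarrow> bool" where
  "spreads_within s L x \<longleftrightarrow> (\<forall>c F. solution c (orb x) \<and> (\<forall>y\<in>orb x. c y \<in> options s y) \<and> rooted F x \<longrightarrow>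
     (\<exists>K. infers s L c F (orb x) K))"

text \<open>In the tree of normal forms a connected set that contains the root contains the path
  from the root to each of its points.\<close>

lemma rooted_prefix:
  assumes x: "free x" and F: "rooted F x" and ls: "red ls" "ev ls x \<in> F"
  shows "ev (drop n ls) x \<in> F"
proof -
  have "\<forall>ls n. red ls \<and> ev ls x = y \<longrightarrow> ev (drop n ls) x \<in> F" if "(x, y) \<in> (steps_in F)\<^sup>*" for y
    using that
  proof (induction rule: rtrancl_induct)
    case base
    show ?case
    proof (intro allI impI)
      fix ls n assume "red ls \<and> ev ls x = x"
      then have "ls = []" using x unfolding free_def by blast
      then show "ev (drop n ls) x \<in> F" using F by (simp add: rooted_def)
    qed
  next
    case (step y z)
    show ?case
    proof (intro allI impI)
      fix ls n assume ls: "red ls \<and> ev ls x = z"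
      obtain l where l: "valid l" "z = lk l y" "z \<in> F" "y \<in> F" using step(2) unfolding steps_in_def by blast
      then have "y \<in> orb x" using F unfolding rooted_def by blast
      then obtain ms where ms: "red ms" "y = ev ms x" by (rule orb_red)
      have "ls = push l ms"
        by (rule free_unique[OF x]) (use ls push[OF ms(1) l(1)] ms l in auto)
      have IH: "ev (drop n ms) x \<in> F" for n using step.IH ms by blast
      have IH': "ev (drop n (tl ms)) x \<in> F" for n using IH[of "Suc n"] by (simp add: drop_Suc)
      consider "ls = ms" | "ls = tl ms" | "n = 0" | m where "n = Suc m" "tl ls = ms" | m where "n = Suc m" "tl ls = tl ms"
        using \<open>ls = push l ms\<close> by (cases n) (auto simp: push_def split: if_splits)
      then show "ev (drop n ls) x \<in> F"
      proof cases
        case 3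
        then show ?thesis using ls l by simp
      qed (use IH IH' in \<open>auto simp: drop_Suc\<close>)
    qed
  qed
  then show ?thesis using F ls unfolding rooted_def by blast
qed

text \<open>A point off \<open>F\<close> has no point of \<open>F\<close> behind it, so all
  information arrives by the half-edge \<open>tgt l\<close> towards the root.\<close>

primrec known :: "('x \<Rightarrow> 'c) \<Rightarrow> 'x set \<Rightarrow> 'x \<Rightarrow> ('j, 'g) link list \<Rightarrow> 'j set" where
  "known c F x [] = J"
| "known c F x (l # ls) = (if lk l (ev ls x) \<in> F then J
     else if src l \<in> known c F x ls then
       {u \<in> J. \<forall>k\<in>Col. (k \<in> S (tgt l)) = (c (lk l (ev ls x)) \<in> S (tgt l)) \<longrightarrow>
          (k \<in> S u) = (c (lk l (ev ls x)) \<in> S u)}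
     else {})"

lemma known_F: "ev ls x \<in> F \<Longrightarrow> known c F x ls = J"
  by (cases ls) auto

lemma known_push:
  assumes x: "free x" and F: "rooted F x" and ls: "red ls" and l: "valid l" "src l \<in> known c F x ls"
  shows "tgt l \<in> known c F x (push l ls)"
proof -
  have J: "tgt l \<in> J" "src l \<in> J" using l valid_J by auto
  show ?thesis
  proof (cases "trivial_link l")
    case True
    then have "src l = tgt l" by (cases l) auto
    then show ?thesis using True l by (simp add: push_def)
  next
    case nt: False
    show ?thesis
    proof (cases "ls = [] \<or> tgt (hd ls) \<noteq> src l")
      case True
      then show ?thesis using nt l J by (auto simp: push_def)
    next
      case False
      then obtain m ms where m: "ls = m # ms" "tgt m = src l" by (cases ls) auto
      have "src m \<in> known c F x ms"
      proof (cases "ev ls x \<in> F")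
        case True
        then have "ev ms x \<in> F" using rooted_prefix[OF x F ls, of 1] m by simp
        then show ?thesis using known_F valid_J ls m by simp
      next
        case False
        then show ?thesis using l(2) m by (auto split: if_splits)
      qed
      moreover have "tgt l = src m" if "trivial_link (comp_link m l)"
        using that by (simp add: trivial_comp_link)
      ultimately show ?thesis using nt m J by (auto simp: push_def)
    qed
  qed
qed

text \<open>One step away from \<open>F\<close> the rank is at most \<open>B\<close>, and it drops
  at every further point, so \<open>n + H\<close> never exceeds \<open>Suc B\<close>. The second
  conjunct records the drop made in passing from the entering half-edge to another one.\<close>

lemma known_near:
  assumes B: "\<And>v e. v \<in> J \<Longrightarrow> H v e \<le> B" and sol: "solution c (orb x)" and xF: "x \<in> F"
    and "red ls" "ev ls x \<notin> F" "known c F x ls \<noteq> {}"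
  shows "\<exists>n. near n F (ev ls x) \<and> (\<forall>u\<in>known c F x ls. n + H u (c (ev ls x) \<in> S u) \<le> Suc B \<and>
     (u \<noteq> tgt (hd ls) \<longrightarrow> Suc n + H u (c (ev ls x) \<in> S u) \<le> Suc B))"
  using assms(4-)
proof (induction ls)
  case Nil
  then show ?case using xF by simp
next
  case (Cons l ls)
  let ?y = "ev ls x" and ?z = "ev (l # ls) x"
  have l: "valid l" "red ls" "src l \<in> J" "tgt l \<in> J" using Cons.prems valid_J by auto
  have src: "src l \<in> known c F x ls" using Cons.prems by (auto split: if_splits)
  have "?y \<in> orb x" using l(2) red_walk orb_ev by auto
  then have "obeys c l ?y" using sol l(1) unfolding solution_def by blast
  then have H_tgt: "H (tgt l) (c ?z \<in> S (tgt l)) = H (src l) (c ?y \<in> S (src l))"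
    using H_link[OF l(1), of "c ?y \<in> S (src l)"] unfolding obeys_def by simp
  have H_u: "H u (c ?z \<in> S u) < H (tgt l) (c ?z \<in> S (tgt l))"
    if "u \<in> known c F x (l # ls)" "u \<noteq> tgt l" for u
    by (rule H_less) (use that l Cons.prems src in auto)
  obtain n where n: "near n F ?z" "n + H (tgt l) (c ?z \<in> S (tgt l)) \<le> Suc B"
  proof (cases "?y \<in> F")
    case True
    then have "near 1 F ?z" using near_lk[OF near_self[of ?y F 0] l(1)] by simp
    then show ?thesis using that[of 1] B l(4) by simp
  next
    case False
    then obtain n where n: "near n F ?y" "\<forall>u\<in>known c F x ls. n + H u (c ?y \<in> S u) \<le> Suc B \<and>
     (u \<noteq> tgt (hd ls) \<longrightarrow> Suc n + H u (c ?y \<in> S u) \<le> Suc B)" using Cons.IH l(2) src by blast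
    have "ls \<noteq> []" using False xF by auto
    then have "src l \<noteq> tgt (hd ls)" using Cons.prems(1) by auto
    then have "Suc n + H (src l) (c ?y \<in> S (src l)) \<le> Suc B" using n(2) src by blast
    then show ?thesis using that[of "Suc n"] near_lk[OF n(1) l(1)] H_tgt by simp
  qed
  have "n + H u (c ?z \<in> S u) \<le> Suc B \<and> (u \<noteq> tgt l \<longrightarrow> Suc n + H u (c ?z \<in> S u) \<le> Suc B)"
    if "u \<in> known c F x (l # ls)" for u
    using n(2) H_u[OF that] by (cases "u = tgt l") auto
  then show ?case using n(1) by auto
qed

text \<open>The radius is one more than a bound for the finitely many values of \<open>H\<close>,
  hence the same for all free points.\<close>

lemma spreads_within_empty: "\<exists>L. \<forall>x. free x \<longrightarrow> spreads_within (\<lambda>_ _. None) L x"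
proof -
  have "finite ((\<lambda>(v, e). H v e) ` (J \<times> UNIV))" using finite_J by simp
  then obtain B where "\<forall>h\<in>(\<lambda>(v, e). H v e) ` (J \<times> UNIV). h \<le> B"
    using finite_nat_set_iff_bounded_le by blast
  then have B: "H v e \<le> B" if "v \<in> J" for v e using that by auto
  have "spreads_within (\<lambda>_ _. None) (Suc B) x" if x: "free x" for x
    unfolding spreads_within_def
  proof (intro allI impI)
    fix c F assume a: "solution c (orb x) \<and> (\<forall>y\<in>orb x. c y \<in> options (\<lambda>_ _. None) y) \<and> rooted F x"
    then have sol: "solution c (orb x)" and F: "rooted F x" "x \<in> F" by (auto simp: rooted_def)
    define K where "K = {(ev ls x, u) | ls u. red ls \<and> u \<in> known c F x ls}"
    have K: "(ev ls x, u) \<in> K \<longleftrightarrow> u \<in> known c F x ls" if "red ls" for ls u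
      unfolding K_def using that free_unique[OF x that] by auto
    have "infers (\<lambda>_ _. None) (Suc B) c F (orb x) K"
      unfolding infers_def
    proof (intro conjI)
      show "closed_knowledge c K (orb x)"
        unfolding closed_knowledge_def
      proof (intro ballI conjI allI impI)
        fix y l assume y: "y \<in> orb x" and l: "valid l \<and> (y, src l) \<in> K"
        obtain ls where ls: "red ls" "y = ev ls x" using orb_red[OF y] .
        have p: "red (push l ls)" "ev (push l ls) x = lk l y" using push[OF ls(1)] l ls(2) by auto
        show "(lk l y, tgt l) \<in> K"
          using K[OF p(1)] K[OF ls(1)] known_push[OF x F(1) ls(1)] l p(2) ls(2) by auto
      next
        fix y u assume y: "y \<in> orb x" and u: "u \<in> J" "(y, u) \<notin> K"
        obtain ls where ls: "red ls" "y = ev ls x" using orb_red[OF y] .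
        have nk: "u \<notin> known c F x ls" using K[OF ls(1)] ls(2) u by simp
        then obtain l ms where lm: "ls = l # ms" using u(1) by (cases ls) auto
        have yF: "y \<notin> F" using nk known_F[of ls x F c] ls(2) u(1) by auto
        have "\<exists>k\<in>Col. (\<forall>v\<in>known c F x ls. (k \<in> S v) = (c y \<in> S v)) \<and> (k \<in> S u) \<noteq> (c y \<in> S u)"
        proof (cases "src l \<in> known c F x ms")
          case True
          then have "\<exists>k\<in>Col. (k \<in> S (tgt l)) = (c y \<in> S (tgt l)) \<and> (k \<in> S u) \<noteq> (c y \<in> S u)"
            using nk yF u(1) ls(2) unfolding lm by auto
          then show ?thesis using True yF ls(2) unfolding lm by auto
        next
          case False
          obtain k where "k \<in> Col" "(k \<in> S u) = (c y \<notin> S u)" using literal_nonempty[OF u(1)] by blast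
          then show ?thesis using False yF ls(2) unfolding lm by auto
        qed
        then show "\<exists>k\<in>Col. (\<forall>v\<in>J. (y, v) \<in> K \<longrightarrow> (k \<in> S v) = (c y \<in> S v)) \<and> (k \<in> S u) \<noteq> (c y \<in> S u)"
          using K[OF ls(1)] ls(2) by auto
      qed
    next
      show "\<forall>y\<in>orb x. \<forall>v\<in>J. None \<noteq> None \<or> y \<in> F \<longrightarrow> (y, v) \<in> K"
      proof (intro ballI impI)
        fix y v assume y: "y \<in> orb x" "v \<in> J" "None \<noteq> None \<or> y \<in> F"
        obtain ls where ls: "red ls" "y = ev ls x" using orb_red[OF y(1)] .
        then show "(y, v) \<in> K" using K[OF ls(1)] known_F[of ls x F] y by auto
      qed
    next
      show "\<forall>y\<in>orb x. \<forall>v\<in>J. (y, v) \<in> K \<longrightarrow> None \<noteq> None \<or> near (Suc B) F y"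
      proof (intro ballI impI)
        fix y v assume y: "y \<in> orb x" "v \<in> J" "(y, v) \<in> K"
        obtain ls where ls: "red ls" "y = ev ls x" using orb_red[OF y(1)] .
        have "near (Suc B) F y"
        proof (cases "y \<in> F")
          case True
          then show ?thesis by (rule near_self)
        next
          case False
          have "v \<in> known c F x ls" using K[OF ls(1)] ls(2) y(3) by simp
          then obtain n where n: "near n F y" "n \<le> Suc B"
            using known_near[OF B sol F(2) ls(1)] False ls(2) by fastforce
          show ?thesis by (rule near_trans[of 0 "{y}" y n]) (use n near_self in auto)
        qed
        then show "None \<noteq> None \<or> near (Suc B) F y" ..
      qed
    qed
    then show "\<exists>K. infers (\<lambda>_ _. None) (Suc B) c F (orb x) K" by blast
  qed
  then show ?thesis by blast
qed

end

section \<open>Prescribing colours on open sets\<close>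

text \<open>Allowing a finite set \<open>A\<close> to be avoided in \<open>free_dense\<close> makes
  it possible to pick points off a bounded piece of an orbit.\<close>

locale generic_csp = axial_csp J cls sy od lk Col S H M
  for J :: "'j set" and cls :: "'j \<Rightarrow> 'k" and sy :: "'j \<Rightarrow> bool"
    and od :: "'g::{ab_group_add,finite} \<Rightarrow> bool"
    and lk :: "('j, 'g) link \<Rightarrow> 'x::t2_space \<Rightarrow> 'x"
    and Col :: "'c set" and S :: "'j \<Rightarrow> 'c set" and H :: "'j \<Rightarrow> bool \<Rightarrow> nat"
    and M :: "'x set" +
  assumes lk_continuous: "valid l \<Longrightarrow> continuous_on M (lk l)"
    and free_dense: "\<lbrakk>openin (top_of_set M) V; V \<noteq> {}; finite A\<rbrakk> \<Longrightarrow> \<exists>x\<in>V - A. free x"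
begin

abbreviation "openM \<equiv> openin (top_of_set M)"

definition M0 :: "'x set" where "M0 = {x \<in> M. free x}"

lemma M0D: "x \<in> M0 \<Longrightarrow> x \<in> M" "x \<in> M0 \<Longrightarrow> free x"
  by (auto simp: M0_def)

lemma M0_orb: "\<lbrakk>x \<in> M0; y \<in> orb x\<rbrakk> \<Longrightarrow> y \<in> M0"
  using orb_M free_orb unfolding M0_def by blast

lemma M0_ev: "\<lbrakk>walk w; x \<in> M0\<rbrakk> \<Longrightarrow> ev w x \<in> M0"
  using M0_orb orb_ev orb_self by blast

lemma openM_subset: "openM V \<Longrightarrow> V \<subseteq> M"
  using openin_imp_subset by blast

lemma ev_continuous: "walk w \<Longrightarrow> continuous_on M (ev w)"
proof (induction w)
  case (Cons l w)
  then show ?case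
    using continuous_on_compose2[OF lk_continuous[of l], of M "ev w"] ev_M by auto
qed simp

lemma openM_vimage: 
  assumes "walk w" "openM U"
  shows "openM {y \<in> M. ev w y \<in> U}"
proof -
  have "openin (top_of_set M) (M \<inter> ev w -` U)"
    using continuous_openin_preimage[OF ev_continuous[OF assms(1)] _ assms(2)] ev_M assms(1) by auto
  moreover have "M \<inter> ev w -` U = {y \<in> M. ev w y \<in> U}" by auto
  ultimately show ?thesis by simp
qed

lemma openM_image: 
  assumes "walk w" "openM V"
  shows "openM (ev w ` V)"
proof -
  have "ev w ` V = {y \<in> M. ev (rev_chain w) y \<in> V}"
  proof (intro equalityI subsetI)
    fix y assume "y \<in> ev w ` V"
    then show "y \<in> {y \<in> M. ev (rev_chain w) y \<in> V}" using assms openM_subset ev_M by auto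
  next
    fix y assume "y \<in> {y \<in> M. ev (rev_chain w) y \<in> V}"
    then show "y \<in> ev w ` V" using assms(1) by (intro image_eqI[of _ _ "ev (rev_chain w) y"]) auto
  qed
  then show ?thesis using openM_vimage[of "rev_chain w" V] assms by simp
qed

text \<open>Meant for the open sets that describe a state near \<open>V\<close>: after shrinking,
  the state looks the same around all free points of the set.\<close>

lemma shrink_to_constant:
  assumes "finite \<U>" "\<And>U. U \<in> \<U> \<Longrightarrow> openM U" "openM V" "V \<noteq> {}"
  obtains V' where "openM V'" "V' \<noteq> {}" "V' \<subseteq> V" "\<And>U. U \<in> \<U> \<Longrightarrow> V' \<subseteq> U \<or> V' \<inter> U = {}"
proof -
  have "\<exists>V'. openM V' \<and> V' \<noteq> {} \<and> V' \<subseteq> V \<and> (\<forall>U\<in>\<U>. V' \<subseteq> U \<or> V' \<inter> U = {})"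
    using assms(1,2)
  proof (induction \<U>)
    case empty
    then show ?case using assms(3,4) by blast
  next
    case (insert U \<U>)
    then obtain V' where V': "openM V'" "V' \<noteq> {}" "V' \<subseteq> V" "\<forall>U\<in>\<U>. V' \<subseteq> U \<or> V' \<inter> U = {}"
      by auto
    show ?case
    proof (cases "V' \<inter> U = {}")
      case True
      then show ?thesis using V' by blast
    next
      case False
      have "openM (V' \<inter> U)" using V'(1) insert.prems by (intro openin_Int) auto
      then show ?thesis using V' False by (intro exI[of _ "V' \<inter> U"]) auto
    qed
  qed
  then obtain V' where V': "openM V'" "V' \<noteq> {}" "V' \<subseteq> V" "\<forall>U\<in>\<U>. V' \<subseteq> U \<or> V' \<inter> U = {}"
    by (elim exE conjE)
  show ?thesis by (rule that[OF V'(1-3) bspec[OF V'(4)]])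
qed

text \<open>With \<open>z = x\<close> it postpones the returns of a neighbourhood of a free point;
  with another \<open>z\<close> it keeps a second region out of reach.\<close>

lemma separate_images:
  assumes "finite A" "\<And>w. w \<in> A \<Longrightarrow> walk w \<and> ev w x \<noteq> z" "x \<in> M" "z \<in> M"
  obtains V W where "openM V" "openM W" "x \<in> V" "z \<in> W" "\<And>w y. \<lbrakk>w \<in> A; y \<in> V\<rbrakk> \<Longrightarrow> ev w y \<notin> W"
proof -
  have "\<exists>V W. openM V \<and> openM W \<and> x \<in> V \<and> z \<in> W \<and> (\<forall>w\<in>A. \<forall>y\<in>V. ev w y \<notin> W)"
    using assms(1,2)
  proof (induction A)
    case empty
    then show ?case using assms(3,4) by (intro exI[of _ M]) auto
  next
    case (insert w A)
    then obtain V W where VW: "openM V" "openM W" "x \<in> V" "z \<in> W" "\<forall>w\<in>A. \<forall>y\<in>V. ev w y \<notin> W"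
      by auto
    have w: "walk w" "ev w x \<noteq> z" using insert.prems by auto
    obtain P Q where PQ: "open P" "open Q" "ev w x \<in> P" "z \<in> Q" "P \<inter> Q = {}"
      using hausdorff[OF w(2)] by blast
    define V' where "V' = V \<inter> {y \<in> M. ev w y \<in> M \<inter> P}"
    have "openM V'" unfolding V'_def
      using VW(1) openM_vimage[OF w(1), of "M \<inter> P"] PQ(1) by (auto intro!: openin_Int openin_open_Int)
    moreover have "openM (W \<inter> (M \<inter> Q))" using VW(2) PQ(2) by (auto intro!: openin_Int openin_open_Int)
    moreover have "x \<in> V'" using VW PQ assms(3) ev_M w(1) unfolding V'_def by auto
    moreover have "z \<in> W \<inter> (M \<inter> Q)" using VW PQ assms(4) by auto
    moreover have "\<forall>u\<in>insert w A. \<forall>y\<in>V'. ev u y \<notin> W \<inter> (M \<inter> Q)"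
      using VW(5) PQ(5) unfolding V'_def by auto
    ultimately show ?case by blast
  qed
  then obtain V W where VW: "openM V" "openM W" "x \<in> V" "z \<in> W" "\<forall>w\<in>A. \<forall>y\<in>V. ev w y \<notin> W"
    by (elim exE conjE)
  show ?thesis by (rule that[OF VW(1-4) bspec[OF bspec[OF VW(5)]]])
qed

lemma finite_red: "finite {ls. red ls \<and> length ls \<le> n}"
  by (rule finite_subset[OF _ finite_lists_length_le[OF finite_valid, of n]])
    (use red_walk in \<open>unfold walk_def, blast\<close>)

text \<open>Openness relative to the free points is what allows a state to be made constant on
  smaller open sets, so that a pattern found at one point fits at its neighbours.\<close>

definition open_state :: "('x \<Rightarrow> 'j \<Rightarrow> bool option) \<Rightarrow> bool" where
  "open_state s \<longleftrightarrow> (\<forall>v\<in>J. \<forall>e. \<exists>U. openM U \<and> (\<forall>y\<in>M0. s y v = Some e \<longleftrightarrow> y \<in> U))"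

definition good_state :: "('x \<Rightarrow> 'j \<Rightarrow> bool option) \<Rightarrow> bool" where
  "good_state s \<longleftrightarrow> closed_state s M0 \<and> open_state s \<and> (\<exists>L. \<forall>x\<in>M0. spreads_within s L x)"

definition extends :: "('x \<Rightarrow> 'j \<Rightarrow> bool option) \<Rightarrow> ('x \<Rightarrow> 'j \<Rightarrow> bool option) \<Rightarrow> bool" where
  "extends s' s \<longleftrightarrow> (\<forall>y v e. s y v = Some e \<longrightarrow> s' y v = Some e)"

lemma good_state_None: "good_state (\<lambda>_ _. None)"
proof -
  have "open_state (\<lambda>_ _. None)" unfolding open_state_def by (auto intro: exI[of _ "{}"])
  then show ?thesis unfolding good_state_def
    using closed_state_None spreads_within_empty M0D(2) by blast
qed

lemma closed_knowledge_link_iff: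
  assumes "closed_knowledge c K Y" "y \<in> Y" "lk l y \<in> Y" "valid l"
  shows "(lk l y, tgt l) \<in> K \<longleftrightarrow> (y, src l) \<in> K"
proof
  assume "(lk l y, tgt l) \<in> K"
  then have "(lk (inv_link l) (lk l y), tgt (inv_link l)) \<in> K"
    using assms unfolding closed_knowledge_def by (metis src_inv_link valid_inv)
  then show "(y, src l) \<in> K" using assms(4) by simp
next
  assume "(y, src l) \<in> K"
  then show "(lk l y, tgt l) \<in> K" using assms unfolding closed_knowledge_def by blast
qed

text \<open>
  Returns of \<open>V\<close> to itself are so long that the pattern prescribed around \<open>x\<close> can be copied around
  every point of \<open>V\<close> without the copies interfering.
\<close>
lemma transport:
  assumes cl: "closed_state s M0" and op: "open_state s"
    and sp: "\<And>x. x \<in> M0 \<Longrightarrow> spreads_within s L x"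
    and x: "x \<in> M0" "x \<in> V" and V: "openM V"
    and const: "\<And>ls v y. \<lbrakk>red ls; length ls \<le> Suc L; v \<in> J; y \<in> V \<inter> M0\<rbrakk> \<Longrightarrow> s (ev ls y) v = s (ev ls x) v"
    and rec: "\<And>ls y. \<lbrakk>red ls; ls \<noteq> []; length ls \<le> 4 * L + 2; y \<in> V\<rbrakk> \<Longrightarrow> ev ls y \<notin> V"
    and k: "k \<in> options s x"
  shows "\<exists>s'. good_state s' \<and> extends s' s \<and> (\<forall>y\<in>V \<inter> M0. \<forall>v\<in>J. s' y v = Some (k \<in> S v)) \<and>
    (\<forall>y\<in>M0. (\<forall>z\<in>V. \<forall>ls. red ls \<and> length ls \<le> L \<longrightarrow> y \<noteq> ev ls z) \<longrightarrow> s' y = s y)"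
proof -
  have fx: "free x" using x M0D by blast
  have clx: "closed_state s (orb x)" using cl M0_orb[OF x(1)] unfolding closed_state_def by blast
  \<comment> \<open>The pattern to be copied consists of a solution with colour \<open>k\<close> at
    \<open>x\<close>, revealed at \<open>x\<close> alone, and of the knowledge \<open>K\<close> that
    follows from this.\<close>
  obtain c where c: "solution c (orb x)" "\<And>y. y \<in> orb x \<Longrightarrow> c y \<in> options s y" "c x = k"
    using extend_free[OF fx clx k] by blast
  obtain K where iK: "infers s L c {x} (orb x) K"
    using sp[OF x(1)] c(1,2) rooted_singleton[of x] unfolding spreads_within_def by blast
  note K = infersD(1)[OF iK] and K_dom = infersD(2)[OF iK] and K_near = infersD(3)[OF iK]
  have in_orb: "ev ls x \<in> orb x" if "red ls" for ls using that red_walk orb_ev by auto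
  have K_red: "\<exists>ls. red ls \<and> length ls \<le> L \<and> y = ev ls x" if y: "near L {x} y" for y
  proof -
    obtain w where w: "walk w" "length w \<le> L" "y = ev w x" using y unfolding near_def by auto
    obtain ms where "red ms" "length ms \<le> length w" "\<And>x. ev ms x = ev w x" using walk_red[OF w(1)] by blast
    then show ?thesis using w by (intro exI[of _ ms]) auto
  qed
  define Q where "Q = {(ls, v). red ls \<and> length ls \<le> L \<and> v \<in> J \<and> (ev ls x, v) \<in> K}"
  have finQ: "finite Q"
    by (rule finite_subset[of _ "{ls. red ls \<and> length ls \<le> L} \<times> J"]) (auto simp: Q_def finite_red finite_J)
  define new where "new y v e \<longleftrightarrow> (\<exists>z\<in>V \<inter> M0. \<exists>ls. (ls, v) \<in> Q \<and> y = ev ls z \<and> e = (c (ev ls x) \<in> S v))"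
    for y v e
  define s' where "s' y v = (if s y v \<noteq> None then s y v else if \<exists>e. new y v e then Some (SOME e. new y v e) else None)"
    for y v
  have recw: "z' = z" if z: "z \<in> V" "z' \<in> V" "walk w" "length w \<le> 4 * L + 2" "z' = ev w z" for z z' w
  proof -
    obtain ms where ms: "red ms" "length ms \<le> length w" "\<And>x. ev ms x = ev w x" using walk_red[OF z(3)] by blast
    have "ms = []" using rec[OF ms(1) _ _ z(1)] ms z(2,4,5) by auto
    then show ?thesis using ms(3)[of z] z(5) by simp
  qed
  \<comment> \<open>Near \<open>V\<close> a point has only one pair of coordinates
    \<open>(z, ls)\<close>: two pairs would give a return to \<open>V\<close> of length at most
    \<open>2 * L + 2\<close>.\<close>
  have unique: "z = z' \<and> ls = ls'"
    if "z \<in> V \<inter> M0" "z' \<in> V \<inter> M0" "red ls" "red ls'" "length ls \<le> Suc L" "length ls' \<le> Suc L"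
      "length ls + length ls' \<le> 4 * L + 2" "ev ls z = ev ls' z'" for z z' ls ls'
  proof -
    have w: "walk ls" "walk ls'" using that red_walk by auto
    have "z' = ev (rev_chain ls' @ ls) z" using that w by (simp add: ev_append)
    then have "z' = z" using recw[of z z' "rev_chain ls' @ ls"] that w by simp
    moreover have "ls = ls'" by (rule free_unique[of z]) (use that calculation M0D in auto)
    ultimately show ?thesis by simp
  qed
  \<comment> \<open>Copies have radius \<open>L\<close>; the description reaches one step further so
    that it also covers the neighbours of copied points.\<close>
  have local: "s' (ev ls z) v = (if (ev ls x, v) \<in> K then Some (c (ev ls x) \<in> S v) else None)"
    if z: "z \<in> V \<inter> M0" and ls: "red ls" "length ls \<le> Suc L" and v: "v \<in> J" for z ls v
  proof (cases "s (ev ls x) v")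
    case (Some e)
    have "s (ev ls z) v = Some e" using const[OF ls v z] Some by simp
    moreover have "(ev ls x, v) \<in> K" using K_dom[OF in_orb[OF ls(1)] v] Some by simp
    moreover have "(c (ev ls x) \<in> S v) = e" using options_Some[OF c(2)[OF in_orb[OF ls(1)]] Some v] .
    ultimately show ?thesis unfolding s'_def by simp
  next
    case None
    have sN: "s (ev ls z) v = None" using const[OF ls v z] None by simp
    have new_iff: "new (ev ls z) v e \<longleftrightarrow> (ls, v) \<in> Q \<and> e = (c (ev ls x) \<in> S v)" for e
    proof
      assume "new (ev ls z) v e"
      then obtain z' ls' where z': "z' \<in> V \<inter> M0" "(ls', v) \<in> Q" "ev ls z = ev ls' z'" "e = (c (ev ls' x) \<in> S v)"
        unfolding new_def by blast
      then have "ls = ls'" using unique[OF z z'(1) ls(1), of ls'] ls(2) unfolding Q_def by auto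
      then show "(ls, v) \<in> Q \<and> e = (c (ev ls x) \<in> S v)" using z' by simp
    qed (use z in \<open>auto simp: new_def\<close>)
    have "(ls, v) \<in> Q \<longleftrightarrow> (ev ls x, v) \<in> K"
    proof
      assume a: "(ev ls x, v) \<in> K"
      then have "near L {x} (ev ls x)" using K_near[OF in_orb[OF ls(1)] v] None by simp
      then obtain ms where "red ms" "length ms \<le> L" "ev ls x = ev ms x" using K_red by blast
      then have "length ls \<le> L" using free_unique[OF fx ls(1)] by auto
      then show "(ls, v) \<in> Q" using ls v a unfolding Q_def by simp
    qed (simp add: Q_def)
    moreover have "s' (ev ls z) v = (if (ls, v) \<in> Q then Some (c (ev ls x) \<in> S v) else None)"
    proof (cases "(ls, v) \<in> Q")
      case True
      then have "new (ev ls z) v = (\<lambda>e. e = (c (ev ls x) \<in> S v))"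
        using new_iff by (intro HOL.ext) simp
      then show ?thesis using True sN by (simp add: s'_def)
    next
      case False
      then have "new (ev ls z) v = (\<lambda>e. False)"
        using new_iff by (intro HOL.ext) simp
      then show ?thesis using False sN by (simp add: s'_def)
    qed
    ultimately show ?thesis by simp
  qed
  have ext: "extends s' s" unfolding extends_def s'_def by auto
  have far: "s' y v = s y v" if "\<And>z ls. \<lbrakk>z \<in> V \<inter> M0; red ls; length ls \<le> L\<rbrakk> \<Longrightarrow> y \<noteq> ev ls z" for y v
    using that unfolding s'_def new_def Q_def by fastforce
  have visit: "\<exists>z\<in>V \<inter> M0. \<exists>ls. red ls \<and> length ls \<le> L \<and> y = ev ls z \<and> (ev ls x, v) \<in> K"
    if "s' y v \<noteq> None" "s y v = None" for y v
    using that unfolding s'_def new_def Q_def by (auto split: if_splits)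
  have link: "s' (lk l y) (tgt l) = map_option (\<lambda>e. e \<noteq> od (amt l)) (s' y (src l))"
    if y: "y \<in> M0" and l: "valid l" for y l
  proof -
    have close: ?thesis if z: "z \<in> V \<inter> M0" and ls: "red ls" "length ls \<le> L" "y = ev ls z" for z ls
    proof -
      have p: "red (push l ls)" "length (push l ls) \<le> Suc L" "ev (push l ls) z = lk l y"
        "ev (push l ls) x = lk l (ev ls x)"
        using push(1,3)[OF ls(1) l] ls(2) by (simp_all add: push(2)[OF ls(1) l] ls(3))
      have J: "src l \<in> J" "tgt l \<in> J" using l valid_J by auto
      have "obeys c l (ev ls x)" using c(1) in_orb[OF ls(1)] l unfolding solution_def by blast
      moreover have "(lk l (ev ls x), tgt l) \<in> K \<longleftrightarrow> (ev ls x, src l) \<in> K"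
        using closed_knowledge_link_iff[OF K in_orb[OF ls(1)] _ l] orb_lk[OF in_orb[OF ls(1)] l] by blast
      ultimately show ?thesis
        using local[OF z p(1,2) J(2)] local[OF z ls(1) _ J(1)] ls p(3,4) unfolding obeys_def by auto
    qed
    show ?thesis
    proof (cases "\<exists>z\<in>V \<inter> M0. \<exists>ls. red ls \<and> length ls \<le> L \<and> y = ev ls z")
      case True
      then show ?thesis using close by blast
    next
      case False
      then have y_far: "s' y v = s y v" for v using far[of y v] by blast
      have s_link: "s (lk l y) (tgt l) = map_option (\<lambda>e. e \<noteq> od (amt l)) (s y (src l))"
        using closed_stateD(1)[OF cl y l] .
      \<comment> \<open>A value newly given to the neighbour would come from a copy of
        \<open>K\<close>; as \<open>K\<close> is closed under links, \<open>y\<close> would have a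
        value too.\<close>
      have "s' (lk l y) (tgt l) = s (lk l y) (tgt l)"
      proof (rule ccontr)
        assume ne: "s' (lk l y) (tgt l) \<noteq> s (lk l y) (tgt l)"
        then have sN: "s (lk l y) (tgt l) = None" unfolding s'_def by (auto split: if_splits)
        then obtain z ls where z: "z \<in> V \<inter> M0" "red ls" "length ls \<le> L" "lk l y = ev ls z" "(ev ls x, tgt l) \<in> K"
          using visit[of "lk l y" "tgt l"] ne by auto
        have J: "src l \<in> J" using l valid_J by auto
        have iv: "valid (inv_link l)" using l by simp
        have p: "red (push (inv_link l) ls)" "length (push (inv_link l) ls) \<le> Suc L"
          "ev (push (inv_link l) ls) z = y" "ev (push (inv_link l) ls) x = lk (inv_link l) (ev ls x)"
            using push(1,3)[OF z(2) iv] z(3) l by (simp_all add: push(2)[OF z(2) iv] z(4)[symmetric])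
        have "(lk (inv_link l) (ev ls x), src l) \<in> K"
          using K in_orb[OF z(2)] z(5) iv unfolding closed_knowledge_def by (metis src_inv_link tgt_inv_link)
        then have "s' y (src l) \<noteq> None" using local[OF z(1) p(1,2) J] p(3,4) by simp
        then have "s y (src l) \<noteq> None" using y_far by simp
        then show False using s_link sN by simp
      qed
      then show ?thesis using s_link y_far by simp
    qed
  qed
  have closed': "closed_state s' M0"
    unfolding closed_state_def
  proof (intro ballI conjI allI impI)
    fix y l assume "y \<in> M0" "valid l"
    then show "s' (lk l y) (tgt l) = map_option (\<lambda>e. e \<noteq> od (amt l)) (s' y (src l))" by (rule link)
  next
    fix y assume y: "y \<in> M0"
    have "options s' y \<noteq> {} \<and> (\<forall>u\<in>J. s' y u = None \<longrightarrow> (\<forall>e. \<exists>k\<in>options s' y. (k \<in> S u) = e))"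
    proof (cases "\<exists>z\<in>V \<inter> M0. \<exists>ls. red ls \<and> length ls \<le> L \<and> y = ev ls z")
      case True
      then obtain z ls where z: "z \<in> V \<inter> M0" "red ls" "length ls \<le> Suc L" "y = ev ls z" by fastforce
      note loc = local[OF z(1,2,3)]
      let ?y = "ev ls x"
      have yo: "?y \<in> orb x" using in_orb z(2) by blast
      have "k' \<in> options s' y" if "k' \<in> Col" "\<And>v. v \<in> J \<Longrightarrow> (?y, v) \<in> K \<Longrightarrow> (k' \<in> S v) = (c ?y \<in> S v)" for k'
        using that loc z(4) unfolding options_def by (auto split: if_splits)
      then have opt: "c ?y \<in> options s' y"
        "\<And>k'. k' \<in> Col \<Longrightarrow> \<forall>v\<in>J. (?y, v) \<in> K \<longrightarrow> (k' \<in> S v) = (c ?y \<in> S v) \<Longrightarrow> k' \<in> options s' y"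
        using options_Col[OF c(2)[OF yo]] by auto
      have "\<exists>k\<in>options s' y. (k \<in> S u) = e" if u: "u \<in> J" "s' y u = None" for u e
      proof -
        have "(?y, u) \<notin> K" using loc[OF u(1)] u(2) z(4) by auto
        then obtain k' where "k' \<in> Col" "\<forall>v\<in>J. (?y, v) \<in> K \<longrightarrow> (k' \<in> S v) = (c ?y \<in> S v)"
          "(k' \<in> S u) \<noteq> (c ?y \<in> S u)" using K yo u(1) unfolding closed_knowledge_def by blast
        then show ?thesis using opt by (cases "(c ?y \<in> S u) = e") auto
      qed
      then show ?thesis using opt(1) by blast
    next
      case False
      then have "s' y v = s y v" for v using far[of y v] by blast
      then have "options s' y = options s y" "\<And>u. s' y u = s y u" unfolding options_def by auto
      then show ?thesis using closed_stateD(2,3)[OF cl y] by simp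
    qed
    then show "options s' y \<noteq> {}" 
      and "\<And>u e. u \<in> J \<Longrightarrow> s' y u = None \<Longrightarrow> \<exists>k\<in>options s' y. (k \<in> S u) = e" by blast+
  qed
  have open': "open_state s'"
    unfolding open_state_def
  proof (intro ballI allI)
    fix v e assume v: "v \<in> J"
    from op[unfolded open_state_def, rule_format, OF v, of e]
    obtain U where U1: "openM U" and U2: "\<forall>y\<in>M0. s y v = Some e \<longleftrightarrow> y \<in> U" by (elim exE conjE)
    note U = U1 U2[rule_format]
    let ?A = "{ls. (ls, v) \<in> Q \<and> (c (ev ls x) \<in> S v) = e}"
    define U' where "U' = U \<union> (\<Union>ls\<in>?A. ev ls ` V)"
    have "openM (\<Union>ls\<in>?A. ev ls ` V)"
      using openM_image[OF _ V] red_walk unfolding Q_def by (intro openin_Union) auto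
    then have "openM U'" unfolding U'_def using U(1) by blast
    moreover have "s' y v = Some e \<longleftrightarrow> y \<in> U'" if y: "y \<in> M0" for y
    proof
      assume a: "s' y v = Some e"
      show "y \<in> U'"
      proof (cases "s y v")
        case None
        then obtain z ls where z: "z \<in> V \<inter> M0" "red ls" "length ls \<le> L" "y = ev ls z" "(ev ls x, v) \<in> K"
          using visit[of y v] a by auto
        then have "(c (ev ls x) \<in> S v) = e" using local[OF z(1,2) _ v] a by auto
        then show ?thesis using z v unfolding U'_def Q_def by auto
      next
        case (Some e')
        then show ?thesis using a U(2)[OF y] ext unfolding extends_def U'_def by fastforce
      qed
    next
      assume "y \<in> U'"
      then consider "y \<in> U" | ls z where "(ls, v) \<in> Q" "(c (ev ls x) \<in> S v) = e" "z \<in> V" "y = ev ls z"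
        unfolding U'_def by blast
      then show "s' y v = Some e"
      proof cases
        case 1
        then show ?thesis using U(2)[OF y] ext unfolding extends_def by blast
      next
        case 2
        then have ls: "red ls" "length ls \<le> Suc L" "walk ls" "(ev ls x, v) \<in> K" using red_walk unfolding Q_def by auto
        have "z = ev (rev_chain ls) y" using 2 ls by simp
        then have "z \<in> M0" using M0_ev[of "rev_chain ls" y] y ls by simp
        then show ?thesis using local[OF _ ls(1,2) v, of z] 2 ls by simp
      qed
    qed
    ultimately show "\<exists>U. openM U \<and> (\<forall>y\<in>M0. s' y v = Some e \<longleftrightarrow> y \<in> U)"
      by (intro exI[of _ U'] conjI ballI)
  qed
  have spread': "spreads_within s' (5 * L) o'" if o': "o' \<in> M0" for o'
    unfolding spreads_within_def
  proof (intro allI impI)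
    fix c' F assume a: "solution c' (orb o') \<and> (\<forall>y\<in>orb o'. c' y \<in> options s' y) \<and> rooted F o'"
    then have F: "o' \<in> F" "F \<subseteq> orb o'" "\<And>y. y \<in> F \<Longrightarrow> (o', y) \<in> (steps_in F)\<^sup>*" unfolding rooted_def by auto
    \<comment> \<open>A copy has radius \<open>L\<close> and inference reaches \<open>L\<close>
      beyond \<open>F\<close>, so copies met by inference have centres within \<open>2 * L\<close>
      of \<open>F\<close>. Adding balls of radius \<open>2 * L\<close> around these centres gives a
      connected \<open>F'\<close> within \<open>4 * L\<close> of \<open>F\<close>; inference from
      \<open>F'\<close> adds another \<open>L\<close>.\<close>
    define Z where "Z = {z \<in> V \<inter> orb o'. near (2 * L) F z}"
    define F' where "F' = F \<union> {y. near (2 * L) Z y}"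
    have Zo: "Z \<subseteq> orb o'" unfolding Z_def by blast
    have F'o: "F' \<subseteq> orb o'" unfolding F'_def using F(2) near_orb[OF _ Zo] by blast
    have ball: "\<exists>z\<in>Z. near (2 * L) {z} y" if "near (2 * L) Z y" for y using that unfolding near_def by blast
    have ballF': "near (2 * L) {z} y \<Longrightarrow> z \<in> Z \<Longrightarrow> y \<in> F'" for z y unfolding F'_def near_def by blast
    have "(o', y) \<in> (steps_in F')\<^sup>*" if y: "y \<in> F'" for y
    proof -
      have mono: "(o', f) \<in> (steps_in F')\<^sup>*" if "f \<in> F" for f
      proof -
        have "steps_in F \<subseteq> steps_in F'" unfolding steps_in_def F'_def by blast
        then show ?thesis using F(3)[OF that] rtrancl_mono by blast
      qed
      show ?thesis
      proof (cases "y \<in> F")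
        case False
        then obtain z where z: "z \<in> Z" "near (2 * L) {z} y" using y ball unfolding F'_def by blast
        obtain w f where w: "walk w" "length w \<le> 2 * L" "f \<in> F" "z = ev w f" using z(1) unfolding Z_def near_def by auto
        have "(f, ev w f) \<in> (steps_in F')\<^sup>*"
        proof (rule steps_in_walk[OF w(1)])
          fix n
          have sub: "walk (take n w)" "walk (drop n w)" using w(1) by (auto simp: walk_def dest: in_set_takeD in_set_dropD)
          have "ev (drop n w) f = ev (rev_chain (take n w)) (ev (take n w) (ev (drop n w) f))"
            using sub by simp
          also have "ev (take n w) (ev (drop n w) f) = z" using w(4) by (simp flip: ev_append)
          finally have "near (2 * L) {z} (ev (drop n w) f)"
            using sub w(2) by (intro nearI[of "rev_chain (take n w)"]) auto
          then show "ev (drop n w) f \<in> F'" using ballF' z(1) by blast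
        qed
        moreover obtain u where u: "walk u" "length u \<le> 2 * L" "y = ev u z" using z(2) unfolding near_def by auto
        have "(z, ev u z) \<in> (steps_in F')\<^sup>*"
        proof (rule steps_in_walk[OF u(1)])
          fix n
          have "walk (drop n u)" using u(1) by (auto simp: walk_def dest: in_set_dropD)
          then have "near (2 * L) {z} (ev (drop n u) z)" using u(2) by (intro nearI[of "drop n u"]) auto
          then show "ev (drop n u) z \<in> F'" using ballF' z(1) by blast
        qed
        ultimately show ?thesis using mono[OF w(3)] w(4) u(3) by (metis rtrancl_trans)
      qed (use mono in blast)
    qed
    then have rooted': "rooted F' o'" unfolding rooted_def using F'o F(1) F'_def by blast
    have c'_s: "c' y \<in> options s y" if "y \<in> orb o'" for y
      using a that ext unfolding options_def extends_def by blast
    obtain K1 where iK1: "infers s L c' F' (orb o') K1"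
      using sp[OF o'] a c'_s rooted' unfolding spreads_within_def by blast
    note K1 = infersD(1)[OF iK1] and K1_dom = infersD(2)[OF iK1] and K1_near = infersD(3)[OF iK1]
    \<comment> \<open>At a point off \<open>F'\<close> the two parts of \<open>K2\<close> do not
      interact: either the state has changed there and no inference from \<open>F'\<close> arrives,
      or it has not changed and \<open>K2\<close> agrees with \<open>K1\<close>.\<close>
    define K2 where "K2 = K1 \<union> {(y, v). s' y v \<noteq> None}"
    have "infers s' (5 * L) c' F (orb o') K2"
      unfolding infers_def
    proof (intro conjI)
      show "closed_knowledge c' K2 (orb o')"
        unfolding closed_knowledge_def
      proof (intro ballI conjI allI impI)
        fix y l assume y: "y \<in> orb o'" and l: "valid l \<and> (y, src l) \<in> K2"
        show "(lk l y, tgt l) \<in> K2"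
        proof (cases "(y, src l) \<in> K1")
          case True
          then show ?thesis using K1 y l unfolding closed_knowledge_def K2_def by blast
        next
          case False
          then have "s' y (src l) \<noteq> None" using l unfolding K2_def by auto
          then show ?thesis using link[OF M0_orb[OF o' y], of l] l unfolding K2_def by auto
        qed
      next
        fix y u assume y: "y \<in> orb o'" and u: "u \<in> J" "(y, u) \<notin> K2"
        have yM: "y \<in> M0" using M0_orb[OF o' y] .
        have yF': "y \<notin> F'" using K1_dom[OF y u(1)] u(2) unfolding K2_def by blast
        show "\<exists>k\<in>Col. (\<forall>v\<in>J. (y, v) \<in> K2 \<longrightarrow> (k \<in> S v) = (c' y \<in> S v)) \<and> (k \<in> S u) \<noteq> (c' y \<in> S u)"
        proof (cases "\<exists>v\<in>J. s' y v \<noteq> None \<and> s y v = None")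
          case True
          then obtain z ls where z: "z \<in> V \<inter> M0" "red ls" "length ls \<le> L" "y = ev ls z" using visit by blast
          have w: "walk ls" using z red_walk by blast
          have zy: "near L {z} y" by (rule nearI[OF w z(3) _ z(4)]) simp
          have zo: "z \<in> orb o'" using near_orb[OF near_sym[OF zy]] y by blast
          have zZ: "z \<notin> Z"
          proof
            assume "z \<in> Z"
            moreover have "near (2 * L) {z} y" using zy unfolding near_def by fastforce
            ultimately show False using ballF' yF' by blast
          qed
          \<comment> \<open>Otherwise the centre \<open>z\<close> would lie within
            \<open>2 * L\<close> of \<open>F\<close>, hence in \<open>Z\<close>, or within
            \<open>4 * L\<close> of another centre, which the late returns of \<open>V\<close>
            exclude.\<close>
          have "\<not> near L F' y"
          proof
            assume "near L F' y"
            then obtain f where f: "f \<in> F'" "near L {f} y" unfolding near_def by blast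
            have zf: "near (2 * L) {f} z"
              by (rule near_trans[OF near_sym[OF zy], of L]) (use f(2) in auto)
            show False
            proof (cases "f \<in> F")
              case True
              then have "near (2 * L) F z" using zf unfolding near_def by blast
              then show False using zZ z(1) zo unfolding Z_def by blast
            next
              case False
              then obtain z1 where z1: "z1 \<in> Z" "near (2 * L) {z1} f" using f(1) ball unfolding F'_def by blast
              have "near (4 * L) {z1} z" by (rule near_trans[OF zf, of "2 * L"]) (use z1(2) in auto)
              then obtain v where v: "walk v" "length v \<le> 4 * L" "z = ev v z1" unfolding near_def by auto
              have "z = z1" by (rule recw[OF _ _ v(1) _ v(3)]) (use z1 z v(2) in \<open>auto simp: Z_def\<close>)
              then show False using zZ z1 by blast
            qed
          qed
          then have K2_y: "(y, v) \<in> K2 \<longleftrightarrow> s' y v \<noteq> None" if "v \<in> J" for v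
            using K1_near[OF y that] ext unfolding K2_def extends_def by auto
          then have "s' y u = None" using u by blast
          then obtain k' where k': "k' \<in> options s' y" "(k' \<in> S u) = (c' y \<notin> S u)"
            using closed_stateD(3)[OF closed' yM u(1)] by blast
          have "c' y \<in> options s' y" using a y by blast
          then have "\<forall>v\<in>J. (y, v) \<in> K2 \<longrightarrow> (k' \<in> S v) = (c' y \<in> S v)"
            using K2_y options_Some[of _ s' y] k'(1) by fastforce
          then show ?thesis using k' options_Col by blast
        next
          case False
          then have "(y, v) \<in> K2 \<longleftrightarrow> (y, v) \<in> K1" if "v \<in> J" for v
            using K1_dom[OF y that] that unfolding K2_def by auto
          then show ?thesis using K1 y u unfolding closed_knowledge_def by (metis (no_types, lifting))
        qed
      qed
    next
      show "\<forall>y\<in>orb o'. \<forall>v\<in>J. s' y v \<noteq> None \<or> y \<in> F \<longrightarrow> (y, v) \<in> K2"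
        using K1_dom unfolding K2_def F'_def by blast
    next
      show "\<forall>y\<in>orb o'. \<forall>v\<in>J. (y, v) \<in> K2 \<longrightarrow> s' y v \<noteq> None \<or> near (5 * L) F y"
      proof (intro ballI impI)
        fix y v assume y: "y \<in> orb o'" "v \<in> J" "(y, v) \<in> K2"
        show "s' y v \<noteq> None \<or> near (5 * L) F y"
        proof (cases "s' y v = None")
          case True
          then have "(y, v) \<in> K1" using y(3) unfolding K2_def by auto
          moreover have "s y v = None" using True ext unfolding extends_def by (cases "s y v") auto
          ultimately have "near L F' y" using K1_near y by blast
          moreover have "near (4 * L) F g" if "g \<in> F'" for g
          proof (cases "g \<in> F")
            case True
            then show ?thesis unfolding near_def by (intro exI[of _ "[]"]) auto
          next
            case False
            then have "near (2 * L) Z g" using that unfolding F'_def by blast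
            then show ?thesis by (rule near_trans[of _ _ _ "2 * L"]) (auto simp: Z_def)
          qed
          ultimately have "near (5 * L) F y" by (rule near_trans) auto
          then show ?thesis ..
        qed simp
      qed
    qed
    then show "\<exists>K. infers s' (5 * L) c' F (orb o') K" by blast
  qed
  have good: "good_state s'" unfolding good_state_def using closed' open' spread' by blast
  have Vk: "\<forall>y\<in>V \<inter> M0. \<forall>v\<in>J. s' y v = Some (k \<in> S v)"
  proof (intro ballI)
    fix y v assume y: "y \<in> V \<inter> M0" and v: "v \<in> J"
    have "(x, v) \<in> K" using K_dom[of x v] v by simp
    then show "s' y v = Some (k \<in> S v)" using local[OF y, of "[]" v] v c(3) by simp
  qed
  have "s' y = s y" if "\<forall>z\<in>V. \<forall>ls. red ls \<and> length ls \<le> L \<longrightarrow> y \<noteq> ev ls z" for y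
    using far[of y] that by (intro HOL.ext) blast
  then show ?thesis using good ext Vk by blast
qed


section \<open>Iterating the prescriptions\<close>

definition coloured :: "('x \<Rightarrow> 'j \<Rightarrow> bool option) \<Rightarrow> 'x set \<Rightarrow> 'c \<Rightarrow> bool" where
  "coloured s V k \<longleftrightarrow> openM V \<and> V \<noteq> {} \<and> (\<forall>y\<in>V \<inter> M0. \<forall>v\<in>J. s y v = Some (k \<in> S v))"

text \<open>\<open>W\<close> is a part of \<open>V\<close> that the new values do not reach, kept
  for the next colour. The wish \<open>k0\<close> can be granted if nothing is known on
  \<open>V\<close>; in general the colour has to be an option left by the state.\<close>

lemma grow:
  assumes good: "good_state s" and V: "openM V" "V \<noteq> {}" and k0: "k0 \<in> Col"
  shows "\<exists>s' V' W k. good_state s' \<and> extends s' s \<and> V' \<subseteq> V \<and> k \<in> Col \<and> coloured s' V' k \<and>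
    ((\<forall>y\<in>V \<inter> M0. \<forall>v\<in>J. s y v = None) \<longrightarrow> k = k0) \<and>
    openM W \<and> W \<noteq> {} \<and> W \<subseteq> V \<and> (\<forall>y\<in>W \<inter> M0. s' y = s y)"
proof -
  obtain L where cl: "closed_state s M0" and op: "open_state s"
    and sp: "\<And>x. x \<in> M0 \<Longrightarrow> spreads_within s L x" using good unfolding good_state_def by blast
  have "\<forall>v e. \<exists>U. v \<in> J \<longrightarrow> openM U \<and> (\<forall>y\<in>M0. s y v = Some e \<longleftrightarrow> y \<in> U)"
    using op unfolding open_state_def by blast
  then obtain U where U: "\<And>v e. v \<in> J \<Longrightarrow> openM (U v e)"
    "\<And>v e y. \<lbrakk>v \<in> J; y \<in> M0\<rbrakk> \<Longrightarrow> s y v = Some e \<longleftrightarrow> y \<in> U v e" by metis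
  \<comment> \<open>These finitely many sets encode the state at distance up to
    \<open>Suc L\<close>; once they are constant on \<open>V1\<close>, the state is the same around
    all its free points.\<close>
  define \<U> where "\<U> = (\<lambda>(ls, v, e). {y \<in> M. ev ls y \<in> U v e}) ` ({ls. red ls \<and> length ls \<le> Suc L} \<times> J \<times> UNIV)"
  have fin: "finite \<U>" unfolding \<U>_def using finite_red finite_J by simp
  have opU: "openM A" if "A \<in> \<U>" for A
    using that openM_vimage red_walk U(1) unfolding \<U>_def by auto
  obtain V1 where V1: "openM V1" "V1 \<noteq> {}" "V1 \<subseteq> V" "\<And>A. A \<in> \<U> \<Longrightarrow> V1 \<subseteq> A \<or> V1 \<inter> A = {}"
    by (rule shrink_to_constant[OF fin opU V]) blast+
  have V1M: "V1 \<subseteq> M" using openM_subset V1(1) by blast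
  have const: "s (ev ls y) v = s (ev ls z) v"
    if ls: "red ls" "length ls \<le> Suc L" and v: "v \<in> J" and y: "y \<in> V1 \<inter> M0" and z: "z \<in> V1 \<inter> M0" for ls v y z
  proof -
    have e: "ev ls y \<in> M0" "ev ls z \<in> M0" using M0_ev red_walk ls y z by auto
    have "s (ev ls y) v = Some e \<longleftrightarrow> s (ev ls z) v = Some e" for e
    proof -
      have "{y \<in> M. ev ls y \<in> U v e} \<in> \<U>" unfolding \<U>_def using ls v by force
      from V1(4)[OF this] have "ev ls y \<in> U v e \<longleftrightarrow> ev ls z \<in> U v e" using y z V1M by blast
      then show ?thesis using U(2)[OF v] e by simp
    qed
    then show ?thesis by (metis not_Some_eq)
  qed
  obtain x where x: "x \<in> V1" "free x" using free_dense[OF V1(1,2), of "{}"] by auto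
  have xM: "x \<in> M" "x \<in> M0" using x V1M unfolding M0_def by auto
  \<comment> \<open>\<open>z\<close> is chosen outside the ball of radius \<open>L\<close> around
    \<open>x\<close>, so that a neighbourhood of \<open>z\<close> is missed by all copies; it
    becomes \<open>W\<close>.\<close>
  have "finite ((\<lambda>ls. ev ls x) ` {ls. red ls \<and> length ls \<le> L})" using finite_red by simp
  then obtain z where z: "z \<in> V1" "z \<notin> (\<lambda>ls. ev ls x) ` {ls. red ls \<and> length ls \<le> L}"
    using free_dense[OF V1(1,2)] by blast
  have zM: "z \<in> M" using z V1M by blast
  have finA: "finite {ls. red ls \<and> ls \<noteq> [] \<and> length ls \<le> 4 * L + 2}"
    by (rule finite_subset[OF _ finite_red[of "4 * L + 2"]]) auto
  obtain V2 W2 where V2: "openM V2" "openM W2" "x \<in> V2" "x \<in> W2"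
    "\<And>w y. \<lbrakk>w \<in> {ls. red ls \<and> ls \<noteq> [] \<and> length ls \<le> 4 * L + 2}; y \<in> V2\<rbrakk> \<Longrightarrow> ev w y \<notin> W2"
  proof (rule separate_images[OF finA _ xM(1) xM(1)])
    show "walk w \<and> ev w x \<noteq> x" if "w \<in> {ls. red ls \<and> ls \<noteq> [] \<and> length ls \<le> 4 * L + 2}" for w
      using that x(2) red_walk unfolding free_def by blast
  qed blast
  obtain V3 W3 where V3: "openM V3" "openM W3" "x \<in> V3" "z \<in> W3"
    "\<And>w y. \<lbrakk>w \<in> {ls. red ls \<and> length ls \<le> L}; y \<in> V3\<rbrakk> \<Longrightarrow> ev w y \<notin> W3"
  proof (rule separate_images[OF finite_red[of L] _ xM(1) zM])
    show "walk w \<and> ev w x \<noteq> z" if "w \<in> {ls. red ls \<and> length ls \<le> L}" for w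
      using that z(2) red_walk by blast
  qed blast
  define V' where "V' = V1 \<inter> V2 \<inter> W2 \<inter> V3"
  have V': "openM V'" "x \<in> V'"
    unfolding V'_def using openin_Int[OF openin_Int[OF openin_Int[OF V1(1) V2(1)] V2(2)] V3(1)] V2(3,4) V3(3) x
    by simp_all
  obtain k where k: "k \<in> options s x" "(\<forall>y\<in>V \<inter> M0. \<forall>v\<in>J. s y v = None) \<longrightarrow> k = k0"
  proof (cases "\<forall>y\<in>V \<inter> M0. \<forall>v\<in>J. s y v = None")
    case True
    then have "s x v = None" if "v \<in> J" for v using x(1) xM(2) V1(3) that by blast
    then have "k0 \<in> options s x" using k0 unfolding options_def by auto
    then show ?thesis using that by blast
  next
    case False
    then show ?thesis using that closed_stateD(2)[OF cl xM(2)] by blast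
  qed
  have "\<exists>s'. good_state s' \<and> extends s' s \<and> (\<forall>y\<in>V' \<inter> M0. \<forall>v\<in>J. s' y v = Some (k \<in> S v)) \<and>
    (\<forall>y\<in>M0. (\<forall>z\<in>V'. \<forall>ls. red ls \<and> length ls \<le> L \<longrightarrow> y \<noteq> ev ls z) \<longrightarrow> s' y = s y)"
  proof (rule transport[OF cl op sp xM(2) V'(2,1) _ _ k(1)])
    show "s (ev ls y) v = s (ev ls x) v" if "red ls" "length ls \<le> Suc L" "v \<in> J" "y \<in> V' \<inter> M0" for ls v y
      by (rule const) (use that x xM in \<open>auto simp: V'_def\<close>)
    show "ev ls y \<notin> V'" if "red ls" "ls \<noteq> []" "length ls \<le> 4 * L + 2" "y \<in> V'" for ls y
      using V2(5)[of ls y] that unfolding V'_def by blast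
  qed
  then obtain s' where s': "good_state s'" "extends s' s" "\<forall>y\<in>V' \<inter> M0. \<forall>v\<in>J. s' y v = Some (k \<in> S v)"
    "\<forall>y\<in>M0. (\<forall>z\<in>V'. \<forall>ls. red ls \<and> length ls \<le> L \<longrightarrow> y \<noteq> ev ls z) \<longrightarrow> s' y = s y" by (elim exE conjE)
  have "openM (V1 \<inter> W3)" "V1 \<inter> W3 \<noteq> {}" using V1 V3 z by (auto intro: openin_Int)
  moreover have "s' y = s y" if y: "y \<in> (V1 \<inter> W3) \<inter> M0" for y
  proof -
    have "y \<noteq> ev ls a" if "a \<in> V'" "red ls" "length ls \<le> L" for a ls
      using V3(5)[of ls a] that y unfolding V'_def by blast
    then show ?thesis using s'(4) y by blast
  qed
  moreover have "coloured s' V' k" using V' s'(3) unfolding coloured_def by blast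
  moreover have "V' \<subseteq> V" using V1(3) unfolding V'_def by blast
  ultimately show ?thesis using s'(1,2) k options_Col V1(3)
    by (intro exI[of _ s'] exI[of _ V'] exI[of _ "V1 \<inter> W3"] exI[of _ k]) auto
qed

lemma extends_trans: "\<lbrakk>extends a b; extends b c\<rbrakk> \<Longrightarrow> extends a c"
  unfolding extends_def by blast

lemma coloured_extends: "\<lbrakk>coloured s V k; extends s' s\<rbrakk> \<Longrightarrow> coloured s' V k"
  unfolding coloured_def extends_def by blast

text \<open>Every colour receives an open set, which later makes its piece nonmeager. The blank set
  \<open>W\<close> is carried along because a colour can be chosen at will only where nothing is
  known.\<close>

lemma initial_state:
  assumes "M \<noteq> {}" "finite A" "A \<subseteq> Col"
  shows "\<exists>s W. good_state s \<and> openM W \<and> W \<noteq> {} \<and> (\<forall>y\<in>W \<inter> M0. \<forall>v\<in>J. s y v = None) \<and>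
    (\<forall>k\<in>A. \<exists>V. coloured s V k)"
  using assms(2,3)
proof (induction A)
  case empty
  show ?case using good_state_None assms(1)
    by (intro exI[of _ "\<lambda>_ _. None"] exI[of _ M]) auto
next
  case (insert a A)
  then obtain s W where s: "good_state s" "openM W" "W \<noteq> {}" "\<forall>y\<in>W \<inter> M0. \<forall>v\<in>J. s y v = None"
    "\<forall>k\<in>A. \<exists>V. coloured s V k" by auto
  have "a \<in> Col" using insert.prems by blast
  from grow[OF s(1-3) this] obtain s' V' W' k where g: "good_state s'" "extends s' s" "coloured s' V' k" "k = a"
    "openM W'" "W' \<noteq> {}" "W' \<subseteq> W" "\<forall>y\<in>W' \<inter> M0. s' y = s y"
    using s(4) by (elim exE conjE) blast
  have "\<forall>k\<in>insert a A. \<exists>V. coloured s' V k" using s(5) g(2-4) coloured_extends by blast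
  moreover have "\<forall>y\<in>W' \<inter> M0. \<forall>v\<in>J. s' y v = None" using g(7,8) s(4) by auto
  ultimately show ?case using g by blast
qed

text \<open>Closedness is local: each instance concerns finitely many half-edges at one or two
  points, and their values become stationary. The radii of spreading need not stay bounded.\<close>

lemma limit_state:
  assumes good: "\<And>n. good_state (s n)" and ext: "\<And>n. extends (s (Suc n)) (s n)"
  obtains t where "closed_state t M0" "\<And>n. extends t (s n)"
proof -
  have mono: "extends (s m) (s n)" if "n \<le> m" for n m
    using that
  proof (induction m)
    case 0
    then show ?case by (simp add: extends_def)
  next
    case (Suc m)
    then show ?case using ext[of m] extends_trans by (cases "n = Suc m") (auto simp: extends_def)
  qed
  define t where "t y v = (if \<exists>n. s n y v \<noteq> None then s (LEAST n. s n y v \<noteq> None) y v else None)" for y v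
  have t_ext: "extends t (s n)" for n
    unfolding extends_def
  proof (intro allI impI)
    fix y v e assume a: "s n y v = Some e"
    let ?m = "LEAST n. s n y v \<noteq> None"
    have "s ?m y v \<noteq> None" using a LeastI[where P = "\<lambda>n. s n y v \<noteq> None" and k = n] by simp
    moreover have "?m \<le> n" using a Least_le[where P = "\<lambda>n. s n y v \<noteq> None" and k = n] by simp
    ultimately have "s ?m y v = Some e" using mono[of ?m n] a unfolding extends_def by fastforce
    then show "t y v = Some e" unfolding t_def using a by auto
  qed
  have stable: "\<exists>n. \<forall>m\<ge>n. \<forall>v\<in>J. s m y v = t y v" for y
  proof -
    have "\<exists>n. \<forall>m\<ge>n. s m y v = t y v" for v
    proof (cases "t y v")
      case None
      then have "s m y v = t y v" for m using t_ext[of m] unfolding extends_def by (cases "s m y v") auto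
      then show ?thesis by blast
    next
      case (Some e)
      then obtain n where "s n y v = Some e" unfolding t_def by (metis option.distinct(1))
      then show ?thesis using mono Some unfolding extends_def by metis
    qed
    then obtain N where N: "\<And>v m. m \<ge> N v \<Longrightarrow> s m y v = t y v" by metis
    have "\<forall>m \<ge> Max (insert 0 (N ` J)). \<forall>v\<in>J. s m y v = t y v"
      using N finite_J by auto
    then show ?thesis by blast
  qed
  have "closed_state t M0"
    unfolding closed_state_def
  proof (intro ballI conjI allI impI)
    fix y l assume y: "y \<in> M0" and l: "valid l"
    obtain n n' where n: "\<forall>m\<ge>n. \<forall>v\<in>J. s m y v = t y v" "\<forall>m\<ge>n'. \<forall>v\<in>J. s m (lk l y) v = t (lk l y) v"
      using stable by metis
    have "closed_state (s (max n n')) M0" using good unfolding good_state_def by blast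
    from closed_stateD(1)[OF this y l]
    show "t (lk l y) (tgt l) = map_option (\<lambda>e. e \<noteq> od (amt l)) (t y (src l))"
      using n valid_J[OF l] by simp
  next
    fix y assume y: "y \<in> M0"
    obtain n where n: "\<And>v. v \<in> J \<Longrightarrow> s n y v = t y v" using stable by blast
    have opt: "options t y = options (s n) y" using n unfolding options_def by auto
    have cl: "closed_state (s n) M0" using good unfolding good_state_def by blast
    show "options t y \<noteq> {}" using closed_stateD(2)[OF cl y] opt by simp
    show "\<exists>k\<in>options t y. (k \<in> S u) = e" if "u \<in> J" "t y u = None" for u e
      using closed_stateD(3)[OF cl y that(1), of e] that opt n by simp
  qed
  then show ?thesis using that t_ext by blast
qed

text \<open>Orbits are coloured independently. The orbit of a non-free point does not meet
  \<open>M0\<close>, so there the state imposes no condition.\<close>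

lemma solution_extending:
  assumes "closed_state t M0"
  obtains c where "solution c M" "\<And>y. y \<in> M0 \<Longrightarrow> c y \<in> options t y"
proof -
  define good where "good Y c \<longleftrightarrow> solution c Y \<and> (\<forall>y\<in>Y \<inter> M0. c y \<in> options t y)" for Y c
  have ex: "\<exists>c. good (orb x) c" if x: "x \<in> M" for x
  proof (cases "free x")
    case True
    then have xM: "x \<in> M0" using x unfolding M0_def by blast
    have cl: "closed_state t (orb x)" using assms M0_orb[OF xM] unfolding closed_state_def by blast
    obtain k where "k \<in> options t x" using closed_stateD(2)[OF assms xM] by blast
    from extend_free[OF True cl this] show ?thesis unfolding good_def by (metis IntD1)
  next
    case False
    then have "y \<notin> M0" if "y \<in> orb x" for y
      using that orb_sym free_orb M0D(2) by blast
    then show ?thesis using solution_not_free[OF x False] unfolding good_def by blast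
  qed
  \<comment> \<open>The chosen solution depends on the orbit only, so all points of an orbit use the
    same one.\<close>
  define c where "c y = (SOME c. good (orb y) c) y" for y
  have g: "good (orb x) (SOME c. good (orb x) c)" if "x \<in> M" for x
    using someI_ex[OF ex[OF that]] .
  have c_eq: "c y = (SOME c. good (orb x) c) y" if "y \<in> orb x" for x y
    unfolding c_def using orb_eq[OF that] by simp
  have "solution c M"
    unfolding solution_def
  proof (intro ballI conjI allI impI)
    fix y assume y: "y \<in> M"
    show "c y \<in> Col" using g[OF y] c_eq[OF orb_self] orb_self unfolding good_def solution_def by auto
    fix l assume l: "valid l"
    have "obeys (SOME c. good (orb y) c) l y"
      using g[OF y] l orb_self unfolding good_def solution_def by blast
    then show "obeys c l y"
      unfolding obeys_def using c_eq[OF orb_self, of y] c_eq[OF orb_lk[OF orb_self l]] by simp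
  qed
  moreover have "c y \<in> options t y" if "y \<in> M0" for y
    using g[of y] c_eq[OF orb_self, of y] that M0D(1) unfolding good_def by auto
  ultimately show ?thesis using that by blast
qed

theorem generic_solution:
  fixes B :: "nat \<Rightarrow> 'x set"
  assumes M: "M \<noteq> {}" and fin: "finite Col"
    and B: "\<And>n. openM (B n) \<and> B n \<noteq> {}" "\<And>V. \<lbrakk>openM V; V \<noteq> {}\<rbrakk> \<Longrightarrow> \<exists>n. B n \<subseteq> V"
    and sep: "\<And>k k'. \<lbrakk>k \<in> Col; k' \<in> Col; \<And>v. v \<in> J \<Longrightarrow> (k \<in> S v) = (k' \<in> S v)\<rbrakk> \<Longrightarrow> k = k'"
  obtains c U where "solution c M" "\<And>k. k \<in> Col \<Longrightarrow> openM (U k) \<and> U k \<noteq> {}"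
    "\<And>k y. \<lbrakk>k \<in> Col; y \<in> U k; free y\<rbrakk> \<Longrightarrow> c y = k"
    "\<And>V. \<lbrakk>openM V; V \<noteq> {}\<rbrakk> \<Longrightarrow> V \<inter> (\<Union>k\<in>Col. U k) \<noteq> {}"
proof -
  obtain s0 where s0: "good_state s0" "\<forall>k\<in>Col. \<exists>V. coloured s0 V k"
    using initial_state[OF M fin] by blast
  obtain k0 where k0: "k0 \<in> Col" using Col_nonempty by blast
  \<comment> \<open>Step \<open>n\<close> colours an open part of \<open>B n\<close>, which makes
    the coloured set dense; beginning above \<open>s0\<close> makes every colour occur.\<close>
  have "\<exists>s. \<forall>n. (good_state (s n) \<and> extends (s n) s0) \<and>
      extends (s (Suc n)) (s n) \<and> (\<exists>V k. V \<subseteq> B n \<and> k \<in> Col \<and> coloured (s (Suc n)) V k)"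
  proof (rule dependent_nat_choice)
    show "\<exists>s. good_state s \<and> extends s s0" using s0 unfolding extends_def by blast
  next
    fix s n assume s: "good_state s \<and> extends s s0"
    from grow[of s "B n", OF _ _ _ k0] s B(1)[of n]
    obtain s' V' k where "good_state s'" "extends s' s" "V' \<subseteq> B n" "k \<in> Col" "coloured s' V' k" by blast
    then show "\<exists>s'. (good_state s' \<and> extends s' s0) \<and> extends s' s \<and>
        (\<exists>V k. V \<subseteq> B n \<and> k \<in> Col \<and> coloured s' V k)" using s extends_trans by blast
  qed
  then obtain s where s: "\<And>n. good_state (s n)" "\<And>n. extends (s n) s0" "\<And>n. extends (s (Suc n)) (s n)"
    "\<And>n. \<exists>V k. V \<subseteq> B n \<and> k \<in> Col \<and> coloured (s (Suc n)) V k" by blast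
  obtain t where t: "closed_state t M0" "\<And>n. extends t (s n)" using limit_state[of s] s(1,3) by blast
  obtain c where c: "solution c M" "\<And>y. y \<in> M0 \<Longrightarrow> c y \<in> options t y" using solution_extending[OF t(1)] by blast
  define U where "U k = \<Union>{V. coloured t V k}" for k
  have "openM (U k)" for k unfolding U_def coloured_def by (intro openin_Union) auto
  moreover have "U k \<noteq> {}" if "k \<in> Col" for k
  proof -
    obtain V where V: "coloured s0 V k" using s0(2) \<open>k \<in> Col\<close> by blast
    have "coloured t V k" using coloured_extends[OF V extends_trans[OF t(2) s(2)]] .
    then show ?thesis unfolding U_def coloured_def by auto
  qed
  moreover have "c y = k" if k: "k \<in> Col" "y \<in> U k" "free y" for k y
  proof -
    obtain V where V: "y \<in> V" "coloured t V k" using k unfolding U_def by blast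
    then have "y \<in> M0" using openM_subset k(3) unfolding coloured_def M0_def by blast
    then have "c y \<in> options t y" "\<forall>v\<in>J. t y v = Some (k \<in> S v)" using c V unfolding coloured_def by auto
    then show ?thesis using sep[OF options_Col k(1)] options_Some[of "c y" t y] by blast
  qed
  moreover have "V \<inter> (\<Union>k\<in>Col. U k) \<noteq> {}" if V: "openM V" "V \<noteq> {}" for V
  proof -
    obtain n where n: "B n \<subseteq> V" using B(2)[OF V] by blast
    obtain W k where W: "W \<subseteq> B n" "k \<in> Col" "coloured (s (Suc n)) W k" using s(4) by blast
    then have "coloured t W k" using coloured_extends t(2) by blast
    then have "W \<subseteq> U k" "W \<noteq> {}" unfolding U_def coloured_def by auto
    then show ?thesis using W n by blast
  qed
  ultimately show ?thesis using that[of c U] c(1) by blast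
qed

end

section \<open>Free families of rotations\<close>

lemma four_cases: "(j::4) = 0 \<or> j = 1 \<or> j = 2 \<or> j = 3"
  using exhaust_4[of j] by auto

lemma four_table:
  "(1::4) + 1 = 2" "(1::4) + 2 = 3" "(1::4) + 3 = 0" "(2::4) + 1 = 3" "(2::4) + 2 = 0" "(2::4) + 3 = 1"
  "(3::4) + 1 = 0" "(3::4) + 2 = 1" "(3::4) + 3 = 2"
  by simp_all

lemma four_distinct: "(0::4) \<noteq> 1" "(0::4) \<noteq> 2" "(0::4) \<noteq> 3" "(1::4) \<noteq> 2" "(1::4) \<noteq> 3" "(2::4) \<noteq> 3"
  by simp_all

definition od4 :: "4 \<Rightarrow> bool" where "od4 j \<longleftrightarrow> j = 1 \<or> j = 3"

lemma od4_add: "od4 (a + b) = (od4 a \<noteq> od4 b)"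
  using four_cases[of a] four_cases[of b] unfolding od4_def
  by (elim disjE) (simp_all add: four_table four_distinct four_distinct[symmetric])

section \<open>Matrices of the links\<close>

definition mat3 :: "'a \<Rightarrow> 'a \<Rightarrow> 'a \<Rightarrow> 'a \<Rightarrow> 'a \<Rightarrow> 'a \<Rightarrow> 'a \<Rightarrow> 'a \<Rightarrow> 'a \<Rightarrow> 'a::zero^3^3" where
  "mat3 a b c d e f g h i = vector [vector [a, b, c], vector [d, e, f], vector [g, h, i]]"

lemma mat3_mult: 
  "(mat3 a b c d e f g h i :: 'a::comm_semiring_1^3^3) ** mat3 a' b' c' d' e' f' g' h' i' =
   mat3 (a*a'+b*d'+c*g') (a*b'+b*e'+c*h') (a*c'+b*f'+c*i')
        (d*a'+e*d'+f*g') (d*b'+e*e'+f*h') (d*c'+e*f'+f*i')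
        (g*a'+h*d'+i*g') (g*b'+h*e'+i*h') (g*c'+h*f'+i*i')"
  by (simp add: vec_eq_iff forall_3 matrix_matrix_mult_def sum_3 vector_3 mat3_def)

lemma mat3_transpose: "transpose (mat3 a b c d e f g h i :: 'a::zero^3^3) = mat3 a d g b e h c f i"
  by (simp add: vec_eq_iff forall_3 transpose_def vector_3 mat3_def)

lemma mat3_one: "(mat 1 :: 'a::comm_semiring_1^3^3) = mat3 1 0 0 0 1 0 0 0 1"
  by (simp add: vec_eq_iff forall_3 mat_def vector_3 mat3_def)

lemma mat3_mult_vec: 
  "(mat3 a b c d e f g h i :: 'a::comm_semiring_1^3^3) *v x =
   vector [a * x$1 + b * x$2 + c * x$3, d * x$1 + e * x$2 + f * x$3, g * x$1 + h * x$2 + i * x$3]"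
  by (simp add: vec_eq_iff forall_3 matrix_vector_mult_def sum_3 vector_3 mat3_def)

lemma mat3_eq:
  "(mat3 a b c d e f g h i :: 'a::zero^3^3) = mat3 a' b' c' d' e' f' g' h' i' \<longleftrightarrow>
   a = a' \<and> b = b' \<and> c = c' \<and> d = d' \<and> e = e' \<and> f = f' \<and> g = g' \<and> h = h' \<and> i = i'"
  by (auto simp: vec_eq_iff forall_3 vector_3 mat3_def)

lemma det_mat3: "det (mat3 a b c d e f g h i :: 'a::comm_ring_1^3^3) =
    a * e * i + b * f * g + c * d * h - a * f * h - b * d * i - c * e * g"
  by (simp add: det_3 vector_3 mat3_def)

definition tilt :: "real \<Rightarrow> real^3^3" where
  "tilt \<phi> = mat3 (cos \<phi>) 0 (sin \<phi>) 0 1 0 (- sin \<phi>) 0 (cos \<phi>)"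

text \<open>The rotation about the third axis by the angle \<open>2 * arctan \<tau>\<close>, written
  rationally in \<open>\<tau>\<close>.\<close>

definition spin :: "real \<Rightarrow> real^3^3" where
  "spin \<tau> = mat3 ((1 - \<tau>\<^sup>2) / (1 + \<tau>\<^sup>2)) (- (2 * \<tau>) / (1 + \<tau>\<^sup>2)) 0
                 (2 * \<tau> / (1 + \<tau>\<^sup>2)) ((1 - \<tau>\<^sup>2) / (1 + \<tau>\<^sup>2)) 0 0 0 1"

text \<open>The powers of a quarter turn about the third axis combined with the reflection in the
  plane of the other two.\<close>

definition flip :: "4 \<Rightarrow> real^3^3" where
  "flip j = (if j = 0 then mat 1 else if j = 1 then mat3 0 (-1) 0 1 0 0 0 0 (-1)
     else if j = 2 then mat3 (-1) 0 0 0 (-1) 0 0 0 1 else mat3 0 1 0 (-1) 0 0 0 0 (-1))"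

lemma flip_simps:
  "flip 0 = mat3 1 0 0 0 1 0 0 0 1" "flip 1 = mat3 0 (-1) 0 1 0 0 0 0 (-1)"
  "flip 2 = mat3 (-1) 0 0 0 (-1) 0 0 0 1" "flip 3 = mat3 0 1 0 (-1) 0 0 0 0 (-1)"
  by (simp_all add: flip_def mat3_one)

lemma four_wrap: "(4::4) = 0" "(5::4) = 1" "(6::4) = 2"
  by simp_all

lemma flip_add: "flip (j + k) = flip k ** flip j"
  using four_cases[of j] four_cases[of k]
  by (elim disjE) (simp_all add: four_table four_wrap flip_simps mat3_mult)

lemma orthogonal_flip: "orthogonal_matrix (flip j)"
  using four_cases[of j] unfolding orthogonal_matrix
  by (elim disjE) (simp_all add: flip_simps mat3_mult mat3_transpose mat3_one)

lemma det_flip: "det (flip j) = (if od4 j then -1 else 1)"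
  using four_cases[of j] unfolding od4_def
  by (elim disjE) (simp_all add: flip_simps det_mat3 four_distinct four_distinct[symmetric])

lemma orthogonal_tilt: "orthogonal_matrix (tilt \<phi>)" "det (tilt \<phi>) = 1"
  using sin_cos_squared_add[of \<phi>] sin_cos_squared_add2[of \<phi>]
  by (simp_all add: orthogonal_matrix tilt_def mat3_mult mat3_transpose mat3_one mat3_eq det_mat3
      power2_eq_square algebra_simps)

lemma orthogonal_spin: "orthogonal_matrix (spin \<tau>)" "det (spin \<tau>) = 1"
proof -
  define C D where "C = (1 - \<tau>\<^sup>2) / (1 + \<tau>\<^sup>2)" and "D = 2 * \<tau> / (1 + \<tau>\<^sup>2)"
  have "1 + \<tau>\<^sup>2 > 0" by (simp add: add_pos_nonneg)
  then have CD: "C * C + D * D = 1"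
    unfolding C_def D_def by (simp add: divide_simps) (simp add: power2_eq_square algebra_simps)
  have s: "spin \<tau> = mat3 C (- D) 0 D C 0 0 0 1" unfolding spin_def C_def D_def by simp
  show "orthogonal_matrix (spin \<tau>)" "det (spin \<tau>) = 1"
    using CD unfolding s
    by (simp_all add: orthogonal_matrix mat3_mult mat3_transpose mat3_one mat3_eq det_mat3 algebra_simps)
qed

lemma transpose_spin: "transpose (spin \<tau>) = spin (- \<tau>)"
  by (simp add: spin_def mat3_transpose)

text \<open>The rotation with parameter \<open>\<tau>\<close> about the axis
  \<open>(- sin \<phi>, 0, cos \<phi>)\<close>.\<close>

definition turn :: "real \<Rightarrow> real \<Rightarrow> real^3^3" where
  "turn \<phi> \<tau> = transpose (tilt \<phi>) ** spin \<tau> ** tilt \<phi>"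

lemma orthogonal_turn: "orthogonal_matrix (turn \<phi> \<tau>)" "det (turn \<phi> \<tau>) = 1"
  unfolding turn_def
  by (auto intro!: orthogonal_matrix_mul simp: orthogonal_matrix_transpose orthogonal_tilt orthogonal_spin det_mul det_transpose)

lemma transpose_turn: "transpose (turn \<phi> \<tau>) = turn \<phi> (- \<tau>)"
  unfolding turn_def by (simp add: matrix_transpose_mul transpose_transpose transpose_spin matrix_mul_assoc)

fun link_matrix :: "('j \<Rightarrow> real) \<Rightarrow> real \<Rightarrow> ('j, 4) link \<Rightarrow> real^3^3" where
  "link_matrix \<phi> \<tau> (v, j, w) = turn (\<phi> w) \<tau> ** flip j ** turn (\<phi> v) (- \<tau>)"

definition link_map :: "('j \<Rightarrow> real) \<Rightarrow> real \<Rightarrow> ('j, 4) link \<Rightarrow> real^3 \<Rightarrow> real^3" where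
  "link_map \<phi> \<tau> l x = link_matrix \<phi> \<tau> l *v x"

lemma turn_inverse: "turn \<phi> (- \<tau>) ** turn \<phi> \<tau> = mat 1" "turn \<phi> \<tau> ** turn \<phi> (- \<tau>) = mat 1"
  using orthogonal_turn(1)[of \<phi> \<tau>] unfolding orthogonal_matrix_def transpose_turn by auto

lemma link_matrix_comp: "link_matrix \<phi> \<tau> (w, k, u) ** link_matrix \<phi> \<tau> (v, j, w) = link_matrix \<phi> \<tau> (v, j + k, u)"
proof -
  have "link_matrix \<phi> \<tau> (w, k, u) ** link_matrix \<phi> \<tau> (v, j, w) =
      turn (\<phi> u) \<tau> ** flip k ** (turn (\<phi> w) (- \<tau>) ** turn (\<phi> w) \<tau>) ** flip j ** turn (\<phi> v) (- \<tau>)"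
    by (simp add: matrix_mul_assoc)
  then show ?thesis unfolding turn_inverse by (simp add: flip_add matrix_mul_assoc)
qed

lemma chain_system_link_map:
  assumes "finite J" "\<And>v w. \<lbrakk>cls v = cls w; v \<in> J; w \<in> J\<rbrakk> \<Longrightarrow> sy v = sy w"
  shows "chain_system J cls sy od4 (link_map \<phi> \<tau>)"
proof
  show "link_map \<phi> \<tau> (v, 0, v) x = x" for v x
    by (simp add: link_map_def flip_def turn_inverse)
  show "link_map \<phi> \<tau> (w, k, u) (link_map \<phi> \<tau> (v, j, w) x) = link_map \<phi> \<tau> (v, j + k, u) x" for v w u j k x
    unfolding link_map_def by (simp add: matrix_vector_mul_assoc link_matrix_comp del: link_matrix.simps)
  show "sy v = sy w" if "cls v = cls w" "v \<in> J" "w \<in> J" for v w using assms(2) that by blast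
qed (rule assms od4_add)+

lemma link_matrix_orthogonal: "orthogonal_matrix (link_matrix \<phi> \<tau> l)"
  by (cases l) (simp add: orthogonal_matrix_mul orthogonal_turn orthogonal_flip)

lemma link_matrix_det: "det (link_matrix \<phi> \<tau> l) = (if od4 (amt l) then -1 else 1)"
  by (cases l) (simp add: det_mul orthogonal_turn det_flip)

section \<open>Complexified chains and their value at \<open>\<i>\<close>\<close>

definition cvec :: "real^3 \<Rightarrow> complex^3" where "cvec x = (\<chi> i. complex_of_real (x $ i))"
definition cmat :: "real^3^3 \<Rightarrow> complex^3^3" where "cmat A = (\<chi> i j. complex_of_real (A $ i $ j))"

lemma cvec_nth [simp]: "cvec x $ i = complex_of_real (x $ i)" by (simp add: cvec_def)

lemma cmat_mult_vec: "cvec (A *v x) = cmat A *v cvec x"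
  by (simp add: vec_eq_iff cmat_def matrix_vector_mult_def)

lemma cmat_mult: "cmat (A ** B) = cmat A ** cmat B"
  by (simp add: vec_eq_iff cmat_def matrix_matrix_mult_def)

lemma cmat_mat3: "cmat (mat3 a b c d e f g h i) =
    mat3 (complex_of_real a) (complex_of_real b) (complex_of_real c) (complex_of_real d) (complex_of_real e)
      (complex_of_real f) (complex_of_real g) (complex_of_real h) (complex_of_real i)"
  by (simp add: vec_eq_iff forall_3 cmat_def mat3_def vector_3)

text \<open>
  Multiplying \<open>spin \<tau>\<close> by \<open>1 + \<tau>\<^sup>2\<close> makes its entries polynomials; at \<open>\<tau> = \<i>\<close> the resulting matrix
  has rank one.
\<close>
definition cspin :: "complex \<Rightarrow> complex^3^3" where
  "cspin z = mat3 (1 - z\<^sup>2) (- (2 * z)) 0 (2 * z) (1 - z\<^sup>2) 0 0 0 (1 + z\<^sup>2)"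

definition cturn :: "real \<Rightarrow> complex \<Rightarrow> complex^3^3" where
  "cturn \<phi> z = cmat (transpose (tilt \<phi>)) ** cspin z ** cmat (tilt \<phi>)"

fun clink :: "('j \<Rightarrow> real) \<Rightarrow> complex \<Rightarrow> ('j, 4) link \<Rightarrow> complex^3^3" where
  "clink \<phi> z (v, j, w) = cturn (\<phi> w) z ** cmat (flip j) ** cturn (\<phi> v) (- z)"

primrec cchain :: "('j \<Rightarrow> real) \<Rightarrow> complex \<Rightarrow> ('j, 4) link list \<Rightarrow> complex^3 \<Rightarrow> complex^3" where
  "cchain \<phi> z [] x = x"
| "cchain \<phi> z (l # ls) x = clink \<phi> z l *v cchain \<phi> z ls x"

definition nrm :: "real \<Rightarrow> complex" where "nrm \<tau> = complex_of_real (1 + \<tau>\<^sup>2)"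

lemma cmat_spin: "cspin (complex_of_real \<tau>) *v x = nrm \<tau> *s (cmat (spin \<tau>) *v x)"
proof -
  have p: "1 + \<tau>\<^sup>2 \<noteq> 0" using add_pos_nonneg[of 1 "\<tau>\<^sup>2"] by simp
  define C D where "C = (1 - \<tau>\<^sup>2) / (1 + \<tau>\<^sup>2)" and "D = 2 * \<tau> / (1 + \<tau>\<^sup>2)"
  have s: "spin \<tau> = mat3 C (- D) 0 D C 0 0 0 1" unfolding spin_def C_def D_def by simp
  have "complex_of_real ((1 + \<tau>\<^sup>2) * C) = complex_of_real (1 - \<tau>\<^sup>2)"
    "complex_of_real ((1 + \<tau>\<^sup>2) * D) = complex_of_real (2 * \<tau>)"
    using p by (simp_all only: C_def D_def) simp_all
  then have CD: "1 - (complex_of_real \<tau>)\<^sup>2 = nrm \<tau> * complex_of_real C"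
    "2 * complex_of_real \<tau> = nrm \<tau> * complex_of_real D"
    unfolding nrm_def of_real_mult by simp_all
  have c: "cspin (complex_of_real \<tau>) = mat3 (nrm \<tau> * complex_of_real C) (- (nrm \<tau> * complex_of_real D)) 0
      (nrm \<tau> * complex_of_real D) (nrm \<tau> * complex_of_real C) 0 0 0 (nrm \<tau>)"
    unfolding cspin_def CD by (simp add: nrm_def)
  show ?thesis
    unfolding c s cmat_mat3 by (simp add: mat3_mult_vec vec_eq_iff forall_3 vector_3 algebra_simps)
qed

lemma cturn_real: "cturn \<phi> (complex_of_real \<tau>) *v x = nrm \<tau> *s (cmat (turn \<phi> \<tau>) *v x)"
  unfolding cturn_def turn_def cmat_mult
  by (simp add: matrix_vector_mul_assoc[symmetric] cmat_spin vector_scalar_commute)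

lemma clink_real:
  "clink \<phi> (complex_of_real \<tau>) l *v x = (nrm \<tau>)\<^sup>2 *s (cmat (link_matrix \<phi> \<tau> l) *v x)"
proof (cases l)
  case (fields v j w)
  have "cturn (\<phi> v) (- complex_of_real \<tau>) *v x = nrm \<tau> *s (cmat (turn (\<phi> v) (- \<tau>)) *v x)" for x
    using cturn_real[of "\<phi> v" "- \<tau>"] by (simp add: nrm_def)
  then show ?thesis
    using fields
    by (simp add: matrix_vector_mul_assoc[symmetric] cmat_mult cturn_real vector_scalar_commute
        vector_smult_assoc power2_eq_square)
qed

text \<open>Bilinear and not Hermitian, so that nonzero vectors can be orthogonal to
  themselves.\<close>

definition bil :: "complex^3 \<Rightarrow> complex^3 \<Rightarrow> complex" where
  "bil x y = x$1 * y$1 + x$2 * y$2 + x$3 * y$3"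

text \<open>With \<open>isotropic'\<close> this gives the complex eigenvectors, common to all
  \<open>\<tau>\<close>, of the rotations \<open>turn \<phi> \<tau>\<close> in the plane orthogonal
  to the axis; both are self-orthogonal for \<open>bil\<close>.\<close>

definition isotropic :: "real \<Rightarrow> complex^3" where
  "isotropic \<phi> = vector [complex_of_real (cos \<phi>), \<i>, complex_of_real (sin \<phi>)]"

definition isotropic' :: "real \<Rightarrow> complex^3" where
  "isotropic' \<phi> = vector [complex_of_real (cos \<phi>), - \<i>, complex_of_real (sin \<phi>)]"

lemma bil_scale: "bil x (c *s y) = c * bil x y"
  by (simp add: bil_def algebra_simps)

lemma cturn_i: "cturn \<phi> \<i> *v x = (2 * bil (isotropic' \<phi>) x) *s isotropic \<phi>"
  unfolding cturn_def tilt_def cspin_def cmat_mat3 mat3_transpose mat3_mult mat3_mult_vec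
  by (simp add: vec_eq_iff forall_3 vector_3 bil_def isotropic_def isotropic'_def algebra_simps)

lemma cturn_minus_i: "cturn \<phi> (- \<i>) *v x = (2 * bil (isotropic \<phi>) x) *s isotropic' \<phi>"
  unfolding cturn_def tilt_def cspin_def cmat_mat3 mat3_transpose mat3_mult mat3_mult_vec
  by (simp add: vec_eq_iff forall_3 vector_3 bil_def isotropic_def isotropic'_def algebra_simps)

text \<open>The two scalars mirror the two conditions in \<open>red\<close>: the first will be
  nonzero because the link is nontrivial, the second because the preceding link arrived at another
  half-edge.\<close>

lemma clink_i:
  "clink \<phi> \<i> (v, j, w) *v x =
    (4 * bil (isotropic' (\<phi> w)) (cmat (flip j) *v isotropic' (\<phi> v)) * bil (isotropic (\<phi> v)) x) *s isotropic (\<phi> w)"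
  by (simp add: matrix_vector_mul_assoc[symmetric] cturn_i cturn_minus_i vector_scalar_commute
      bil_scale mult_ac)

lemma cos_diff_less_1:
  assumes "0 < a" "a < pi" "0 < b" "b < pi" "a \<noteq> b"
  shows "cos a * cos b + sin a * sin b < 1"
proof -
  have "cos (a - b) = cos \<bar>a - b\<bar>" by (simp add: abs_if cos_diff mult.commute)
  also have "\<dots> < cos 0" by (rule cos_monotone_0_pi) (use assms in auto)
  finally show ?thesis by (simp add: cos_diff)
qed

lemma bil_isotropic_nonzero:
  assumes "0 < a" "a < pi" "0 < b" "b < pi" "a \<noteq> b"
  shows "bil (isotropic a) (isotropic b) \<noteq> 0"
proof -
  have "Re (bil (isotropic a) (isotropic b)) = cos a * cos b + sin a * sin b - 1"
    by (simp add: bil_def isotropic_def vector_3)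
  then show ?thesis using cos_diff_less_1[OF assms] by auto
qed

text \<open>The real part is \<open>- sin a * sin b\<close> for odd \<open>j\<close> and
  \<open>1 - cos a * cos b + sin a * sin b\<close> for \<open>j = 2\<close>; angles strictly between
  \<open>0\<close> and \<open>pi\<close> keep both away from zero.\<close>

lemma bil_flip_nonzero:
  assumes a: "0 < a" "a < pi" and b: "0 < b" "b < pi" and ne: "a \<noteq> b \<or> j \<noteq> 0"
  shows "bil (isotropic' a) (cmat (flip j) *v isotropic' b) \<noteq> 0"
proof -
  have sin: "sin a * sin b > 0" "sin a \<noteq> 0" "sin b \<noteq> 0"
    using sin_gt_zero[OF a] sin_gt_zero[OF b] by simp_all
  have "cos a * cos b \<le> \<bar>cos a\<bar> * \<bar>cos b\<bar>" by (simp flip: abs_mult)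
  also have "\<dots> \<le> 1 * 1" by (intro mult_mono) auto
  finally have cos: "cos a * cos b \<le> 1" by simp
  consider "j = 0" "a \<noteq> b" | "j = 1" | "j = 2" | "j = 3" using four_cases[of j] ne by auto
  then have "Re (bil (isotropic' a) (cmat (flip j) *v isotropic' b)) \<noteq> 0"
  proof cases
    case 1
    then show ?thesis using cos_diff_less_1[OF a b]
      by (simp add: flip_simps cmat_mat3 mat3_mult_vec bil_def isotropic'_def vector_3)
  next
    case 3
    then show ?thesis using sin cos
      by (simp add: flip_simps cmat_mat3 mat3_mult_vec bil_def isotropic'_def vector_3)
  qed (use sin in \<open>simp_all add: flip_simps cmat_mat3 mat3_mult_vec bil_def isotropic'_def vector_3\<close>)
  then show ?thesis by auto
qed

section \<open>Polynomial dependence on the parameter\<close>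

definition polyf :: "(complex \<Rightarrow> complex) \<Rightarrow> bool" where
  "polyf f \<longleftrightarrow> (\<exists>p. \<forall>z. f z = poly p z)"

lemma polyf_const [intro]: "polyf (\<lambda>_. c)"
  unfolding polyf_def by (intro exI[of _ "[:c:]"]) simp

lemma polyf_id [intro]: "polyf (\<lambda>z. z)"
  unfolding polyf_def by (intro exI[of _ "[:0, 1:]"]) simp

lemma polyf_add [intro]: "\<lbrakk>polyf f; polyf g\<rbrakk> \<Longrightarrow> polyf (\<lambda>z. f z + g z)"
  unfolding polyf_def by (metis poly_add)

lemma polyf_mult [intro]: "\<lbrakk>polyf f; polyf g\<rbrakk> \<Longrightarrow> polyf (\<lambda>z. f z * g z)"
  unfolding polyf_def by (metis poly_mult)

lemma polyf_minus [intro]: "polyf f \<Longrightarrow> polyf (\<lambda>z. - f z)"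
  using polyf_mult[OF polyf_const[of "-1"], of f] by simp

lemma polyf_diff [intro]: "\<lbrakk>polyf f; polyf g\<rbrakk> \<Longrightarrow> polyf (\<lambda>z. f z - g z)"
  using polyf_add[OF _ polyf_minus, of f g] by simp

lemma polyf_power [intro]: "polyf f \<Longrightarrow> polyf (\<lambda>z. f z ^ n)"
  by (induction n) auto

lemma polyf_compose_minus: "polyf f \<Longrightarrow> polyf (\<lambda>z. f (- z))"
proof -
  assume "polyf f"
  then obtain p where "\<forall>z. f z = poly p z" unfolding polyf_def by blast
  then have "\<forall>z. f (- z) = poly (pcompose p [:0, -1:]) z" by (simp add: poly_pcompose)
  then show ?thesis unfolding polyf_def by blast
qed

lemma polyf_matrix_mult:
  assumes "\<And>i k. polyf (\<lambda>z. A z $ i $ k)" "\<And>i k. polyf (\<lambda>z. B z $ i $ k)"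
  shows "polyf (\<lambda>z. ((A z :: complex^3^3) ** B z) $ i $ k)"
  unfolding matrix_matrix_mult_def using assms by (simp add: sum_3) (intro polyf_add polyf_mult; simp)

lemma polyf_matrix_vec:
  assumes "\<And>i k. polyf (\<lambda>z. A z $ i $ k)" "\<And>i. polyf (\<lambda>z. x z $ i)"
  shows "polyf (\<lambda>z. ((A z :: complex^3^3) *v x z) $ i)"
  unfolding matrix_vector_mult_def using assms by (simp add: sum_3) (intro polyf_add polyf_mult; simp)

lemma polyf_cturn: "polyf (\<lambda>z. cturn \<phi> z $ i $ k)"
proof -
  have "polyf (\<lambda>z. cspin z $ i $ k)" for i k
    using exhaust_3[of i] exhaust_3[of k] unfolding cspin_def mat3_def
    by (elim disjE) (auto simp: vector_3 intro!: polyf_diff polyf_power polyf_minus polyf_mult)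
  then show ?thesis unfolding cturn_def by (intro polyf_matrix_mult) auto
qed

lemma polyf_clink: "polyf (\<lambda>z. clink \<phi> z l $ i $ k)"
proof (cases l)
  case (fields v j w)
  show ?thesis unfolding fields clink.simps
    by (intro polyf_matrix_mult) (auto intro: polyf_cturn polyf_compose_minus[OF polyf_cturn])
qed

lemma polyf_cchain: "polyf (\<lambda>z. cchain \<phi> z ls x $ i)"
proof (induction ls arbitrary: i)
  case (Cons l ls)
  then show ?case by (simp add: polyf_matrix_vec polyf_clink)
qed auto

locale rotation_links =
  fixes J :: "'j set" and cls :: "'j \<Rightarrow> 'k" and sy :: "'j \<Rightarrow> bool" and \<phi> :: "'j \<Rightarrow> real"
  assumes finite_J': "finite J"
    and sy_cls': "\<And>v w. \<lbrakk>cls v = cls w; v \<in> J; w \<in> J\<rbrakk> \<Longrightarrow> sy v = sy w"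
    and \<phi>: "\<And>v. v \<in> J \<Longrightarrow> 0 < \<phi> v \<and> \<phi> v < pi" "inj_on \<phi> J"
begin

lemma is_chain_system: "chain_system J cls sy od4 (link_map \<phi> \<tau>)"
  by (rule chain_system_link_map[OF finite_J' sy_cls'])

abbreviation "chain_red \<equiv> chain_system.red J cls sy :: ('j, 4) link list \<Rightarrow> bool"
abbreviation "chain_ev \<tau> \<equiv> chain_system.ev (link_map \<phi> \<tau>)"

text \<open>Each link contains two turns, and clearing the denominator of a turn costs one factor
  \<open>nrm \<tau>\<close>; hence the exponent.\<close>

lemma cchain_real:
  "cchain \<phi> (complex_of_real \<tau>) ls (cvec x) = nrm \<tau> ^ (2 * length ls) *s cvec (chain_ev \<tau> ls x)"
proof -
  interpret chain_system J cls sy od4 "link_map \<phi> \<tau>" by (rule is_chain_system)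
  have "cvec (link_map \<phi> \<tau> l y) = cmat (link_matrix \<phi> \<tau> l) *v cvec y" for l y
    by (simp add: link_map_def cmat_mult_vec)
  then show ?thesis
    by (induction ls) (simp_all add: vector_scalar_commute clink_real vector_smult_assoc
        power2_eq_square mult_ac)
qed

text \<open>Reducedness keeps all scalars of \<open>clink_i\<close> nonzero. The start
  \<open>axis 2 1\<close> survives the first link because it pairs to \<open>\<i>\<close> with every
  \<open>isotropic\<close> vector.\<close>

lemma cchain_i:
  assumes "chain_red ls" "ls \<noteq> []"
  shows "\<exists>\<kappa>. \<kappa> \<noteq> 0 \<and> cchain \<phi> \<i> ls (axis 2 1) = \<kappa> *s isotropic (\<phi> (tgt (hd ls)))"
proof -
  interpret chain_system J cls sy od4 "link_map \<phi> \<tau>" for \<tau> by (rule is_chain_system)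
  show ?thesis
    using assms
  proof (induction ls)
    case (Cons l ls)
    obtain v j w where l: "l = (v, j, w)" by (cases l)
    have vw: "v \<in> J" "w \<in> J" "v \<noteq> w \<or> j \<noteq> 0" using Cons.prems(1) l by auto
    have "\<phi> v \<noteq> \<phi> w \<or> j \<noteq> 0" using vw \<phi>(2) by (auto dest: inj_onD)
    then have c: "bil (isotropic' (\<phi> w)) (cmat (flip j) *v isotropic' (\<phi> v)) \<noteq> 0"
      using bil_flip_nonzero[of "\<phi> w" "\<phi> v" j] \<phi>(1) vw by auto
    obtain y where y: "cchain \<phi> \<i> ls (axis 2 1) = y" "bil (isotropic (\<phi> v)) y \<noteq> 0"
    proof (cases "ls = []")
      case True
      have "bil (isotropic (\<phi> v)) (axis 2 1) \<noteq> 0" by (simp add: bil_def isotropic_def vector_3 axis_def)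
      then show ?thesis using that True by simp
    next
      case False
      then obtain \<kappa> where \<kappa>: "\<kappa> \<noteq> 0" "cchain \<phi> \<i> ls (axis 2 1) = \<kappa> *s isotropic (\<phi> (tgt (hd ls)))"
        using Cons by auto
      have u: "tgt (hd ls) \<in> J" "tgt (hd ls) \<noteq> v" using Cons.prems(1) False l valid_J by (cases ls; auto)+
      then have "\<phi> v \<noteq> \<phi> (tgt (hd ls))" using vw \<phi>(2) by (auto dest: inj_onD)
      then have "bil (isotropic (\<phi> v)) (isotropic (\<phi> (tgt (hd ls)))) \<noteq> 0"
        using bil_isotropic_nonzero \<phi>(1) vw(1) u(1) by auto
      then show ?thesis using that \<kappa> by (simp add: bil_scale)
    qed
    have "cchain \<phi> \<i> (l # ls) (axis 2 1) =
        (4 * bil (isotropic' (\<phi> w)) (cmat (flip j) *v isotropic' (\<phi> v)) * bil (isotropic (\<phi> v)) y) *s isotropic (\<phi> w)"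
      using y(1) clink_i[of \<phi> v j w y] l by simp
    moreover have "4 * bil (isotropic' (\<phi> w)) (cmat (flip j) *v isotropic' (\<phi> v)) * bil (isotropic (\<phi> v)) y \<noteq> 0"
      using c y(2) by simp
    moreover have "tgt (hd (l # ls)) = w" using l by simp
    ultimately show ?case by blast
  qed simp
qed

lemma finite_bad_parameters:
  assumes "chain_red ls" "ls \<noteq> []"
  shows "finite {\<tau>. \<forall>x. chain_ev \<tau> ls x = x}"
proof -
  \<comment> \<open>The parameters at which the chain fixes \<open>axis 2 1\<close> are zeros of
    \<open>f\<close>. The second coordinate is taken because that of \<open>isotropic\<close> is
    \<open>\<i>\<close> for every angle; as the subtracted power vanishes at \<open>\<i>\<close>,
    this gives \<open>f \<i> \<noteq> 0\<close>.\<close>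
  define f where "f z = cchain \<phi> z ls (axis 2 1) $ 2 - (1 + z\<^sup>2) ^ (2 * length ls)" for z
  have "polyf f" unfolding f_def by (intro polyf_diff polyf_cchain polyf_power polyf_add polyf_const polyf_id)
  then obtain p where p: "\<And>z. f z = poly p z" unfolding polyf_def by blast
  obtain \<kappa> where "\<kappa> \<noteq> 0" "cchain \<phi> \<i> ls (axis 2 1) = \<kappa> *s isotropic (\<phi> (tgt (hd ls)))"
    using cchain_i[OF assms] by blast
  then have "f \<i> \<noteq> 0" using assms(2) by (simp add: f_def isotropic_def vector_3 power_0_left)
  then have "p \<noteq> 0" using p[of \<i>] by auto
  then have "finite {z. poly p z = 0}" by (rule poly_roots_finite)
  then have fin: "finite (complex_of_real -` {z. poly p z = 0})"
    by (rule finite_vimageI) (simp add: inj_def)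
  have "{\<tau>. \<forall>x. chain_ev \<tau> ls x = x} \<subseteq> complex_of_real -` {z. poly p z = 0}"
  proof
    fix \<tau> assume "\<tau> \<in> {\<tau>. \<forall>x. chain_ev \<tau> ls x = x}"
    then have e: "chain_ev \<tau> ls (axis 2 1) = axis 2 1" by simp
    have "cvec (axis 2 1) = axis 2 1" by (simp add: vec_eq_iff axis_def)
    then have "f (complex_of_real \<tau>) = 0"
      using cchain_real[of \<tau> ls "axis 2 1"] e by (simp add: f_def axis_def nrm_def)
    then show "\<tau> \<in> complex_of_real -` {z. poly p z = 0}" using p by simp
  qed
  then show ?thesis using fin finite_subset by blast
qed

text \<open>There are countably many reduced chains, each excluding finitely many real
  parameters.\<close>

lemma free_parameter: "\<exists>\<tau>. free_chain_system J cls sy od4 (link_map \<phi> \<tau>)"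
proof -
  let ?R = "{ls. chain_red ls \<and> ls \<noteq> []}"
  interpret chain_system J cls sy od4 "link_map \<phi> \<tau>" for \<tau> by (rule is_chain_system)
  have "?R \<subseteq> lists {l. valid l}" using red_walk unfolding walk_def by auto
  then have "countable ?R"
    using countable_lists[OF countable_finite[OF finite_valid]] countable_subset by blast
  then have "countable (\<Union>ls\<in>?R. {\<tau>. \<forall>x. chain_ev \<tau> ls x = x})"
    using finite_bad_parameters by (intro countable_UN) (auto intro: countable_finite)
  then have "(\<Union>ls\<in>?R. {\<tau>. \<forall>x. chain_ev \<tau> ls x = x}) \<noteq> UNIV"
    using uncountable_UNIV_real by metis
  then obtain \<tau> where "\<tau> \<notin> (\<Union>ls\<in>?R. {\<tau>. \<forall>x. chain_ev \<tau> ls x = x})" by blast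
  then have "free_chain_system J cls sy od4 (link_map \<phi> \<tau>)"
    by unfold_locales blast
  then show ?thesis ..
qed

end

section \<open>The sphere\<close>

lemma orthogonal_matrix_transformation:
  "orthogonal_matrix A \<Longrightarrow> orthogonal_transformation ((*v) (A :: real^'n^'n))"
  by (simp add: orthogonal_transformation_matrix)

lemma orthogonal_matrix_norm: "orthogonal_matrix A \<Longrightarrow> norm (A *v x) = norm (x :: real^'n)"
  using orthogonal_matrix_transformation orthogonal_transformation_norm by blast

lemma orthogonal_matrix_dist: "orthogonal_matrix A \<Longrightarrow> dist (A *v x) (A *v y) = dist x (y :: real^'n)"
  using orthogonal_matrix_norm[of A "x - y"] by (simp add: dist_norm matrix_vector_mult_diff_distrib)

lemma mat3_eta: "A = mat3 (A$1$1) (A$1$2) (A$1$3) (A$2$1) (A$2$2) (A$2$3) (A$3$1) (A$3$2) (A$3$3)"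
  by (simp add: vec_eq_iff forall_3 mat3_def vector_3)

lemma orthogonal_fix_axis:
  assumes A: "orthogonal_matrix (A :: real^3^3)" "A *v axis 3 1 = axis 3 1"
  obtains a b where "det A = 1 \<longrightarrow> A = mat3 a b 0 (- b) a 0 0 0 1"
    "det A = -1 \<longrightarrow> A = mat3 a b 0 b (- a) 0 0 0 1" "a * a + b * b = 1"
proof -
  obtain a b c d e f g h i where eq: "A = mat3 a b c d e f g h i" by (rule that[OF mat3_eta])
  have col: "c = 0" "f = 0" "i = 1"
    using A(2) unfolding eq mat3_mult_vec by (simp_all add: vec_eq_iff forall_3 vector_3 axis_def)
  have "A ** transpose A = mat 1" "transpose A ** A = mat 1"
    using A(1) unfolding orthogonal_matrix_def by auto
  then have o: "a * a + b * b = 1" "d * d + e * e = 1" "a * d + b * e = 0" "g * g + h * h = 0"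
    unfolding eq mat3_transpose mat3_mult mat3_one mat3_eq col by auto
  have "g = 0" "h = 0" using o(4) by (auto simp: sum_squares_eq_zero_iff)
  have det: "det A = a * e - b * d" unfolding eq det_mat3 col \<open>g = 0\<close> \<open>h = 0\<close> by simp
  have A': "A = mat3 a b 0 d e 0 0 0 1" unfolding eq col \<open>g = 0\<close> \<open>h = 0\<close> ..
  have r1: "e = a \<and> d = - b" if "det A = 1"
  proof -
    have "e = e * (a * a + b * b)" "d = d * (a * a + b * b)" using o(1) by simp_all
    moreover have "e * (a * a + b * b) = a * (a * e - b * d) + b * (a * d + b * e)"
      "d * (a * a + b * b) = - b * (a * e - b * d) + a * (a * d + b * e)" by (simp_all add: algebra_simps)
    ultimately show ?thesis using that det o(3) by simp
  qed
  have r2: "e = - a \<and> d = b" if "det A = -1"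
  proof -
    have "e = e * (a * a + b * b)" "d = d * (a * a + b * b)" using o(1) by simp_all
    moreover have "e * (a * a + b * b) = a * (a * e - b * d) + b * (a * d + b * e)"
      "d * (a * a + b * b) = - b * (a * e - b * d) + a * (a * d + b * e)" by (simp_all add: algebra_simps)
    ultimately show ?thesis using that det o(3) by simp
  qed
  show ?thesis
  proof (rule that)
    show "det A = 1 \<longrightarrow> A = mat3 a b 0 (- b) a 0 0 0 1" by (intro impI, subst A') (simp add: r1)
    show "det A = -1 \<longrightarrow> A = mat3 a b 0 b (- a) 0 0 0 1" by (intro impI, subst A') (simp add: r2)
  qed (rule o(1))
qed

text \<open>\<open>Q\<close> depends on \<open>y\<close> only, so that several isometries fixing
  \<open>y\<close> take their normal forms in the same basis and can be compared.\<close>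

lemma orthogonal_fix_unit_vector:
  assumes "norm (y :: real^3) = 1"
  shows "\<exists>Q. transpose Q ** Q = mat 1 \<and> Q ** transpose Q = mat 1 \<and>
    (\<forall>A. orthogonal_matrix A \<and> A *v y = y \<longrightarrow> (\<exists>a b. a * a + b * b = 1 \<and>
      (det A = 1 \<longrightarrow> A = Q ** mat3 a b 0 (- b) a 0 0 0 1 ** transpose Q) \<and>
      (det A = -1 \<longrightarrow> A = Q ** mat3 a b 0 b (- a) 0 0 0 1 ** transpose Q)))"
proof -
  obtain Q :: "real^3^3" where Q: "orthogonal_matrix Q" "Q *v axis 3 1 = y"
    using orthogonal_matrix_exists_basis[OF assms] by blast
  have QQ: "transpose Q ** Q = mat 1" "Q ** transpose Q = mat 1" using Q(1) unfolding orthogonal_matrix_def by auto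
  have "\<exists>a b. a * a + b * b = 1 \<and> (det A = 1 \<longrightarrow> A = Q ** mat3 a b 0 (- b) a 0 0 0 1 ** transpose Q) \<and>
      (det A = -1 \<longrightarrow> A = Q ** mat3 a b 0 b (- a) 0 0 0 1 ** transpose Q)"
    if A: "orthogonal_matrix A" "A *v y = y" for A
  proof -
    let ?A = "transpose Q ** A ** Q"
    have "orthogonal_matrix ?A"
      using Q(1) A(1) by (intro orthogonal_matrix_mul) (simp_all add: orthogonal_matrix_transpose)
    moreover have "?A *v axis 3 1 = axis 3 1"
    proof -
      have "?A *v axis 3 1 = transpose Q *v (A *v (Q *v axis 3 1))"
        by (simp only: matrix_vector_mul_assoc matrix_mul_assoc)
      also have "\<dots> = transpose Q *v (Q *v axis 3 1)" using Q(2) A(2) by simp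
      finally show ?thesis by (simp only: matrix_vector_mul_assoc QQ matrix_vector_mul_lid)
    qed
    moreover have "det ?A = det A"
      using QQ(1) det_mul[of "transpose Q" Q] by (simp add: det_mul mult.assoc mult.left_commute)
    ultimately obtain a b where ab: "det A = 1 \<longrightarrow> ?A = mat3 a b 0 (- b) a 0 0 0 1"
      "det A = -1 \<longrightarrow> ?A = mat3 a b 0 b (- a) 0 0 0 1" "a * a + b * b = 1"
      using orthogonal_fix_axis[of ?A] by metis
    have "Q ** ?A ** transpose Q = (Q ** transpose Q) ** A ** (Q ** transpose Q)"
      by (simp only: matrix_mul_assoc)
    then have "A = Q ** ?A ** transpose Q" unfolding QQ by simp
    then show ?thesis using ab by (intro exI[of _ a] exI[of _ b]) auto
  qed
  then show ?thesis using QQ by (intro exI[of _ Q]) blast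
qed

lemma conjugate_mult:
  assumes "transpose Q ** Q = mat 1"
  shows "(Q ** X ** transpose Q) ** (Q ** Y ** transpose Q) = (Q :: real^3^3) ** (X ** Y) ** transpose Q"
proof -
  have "(Q ** X ** transpose Q) ** (Q ** Y ** transpose Q) = Q ** X ** (transpose Q ** Q) ** Y ** transpose Q"
    by (simp only: matrix_mul_assoc)
  then show ?thesis unfolding assms by (simp add: matrix_mul_assoc)
qed

lemma rotations_about_axis_commute:
  assumes y: "norm (y :: real^3) = 1" and A: "orthogonal_matrix A" "A *v y = y" "det A = 1"
    and B: "orthogonal_matrix B" "B *v y = y" "det B = 1"
  shows "A ** B = B ** A"
proof -
  from orthogonal_fix_unit_vector[OF y] A B obtain Q a b a' b' where Q: "transpose Q ** Q = mat 1"
    and AB: "A = Q ** mat3 a b 0 (- b) a 0 0 0 1 ** transpose Q"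
      "B = Q ** mat3 a' b' 0 (- b') a' 0 0 0 1 ** transpose Q" by metis
  show ?thesis unfolding AB conjugate_mult[OF Q] by (simp add: mat3_mult algebra_simps)
qed

lemma reflection_involution:
  assumes y: "norm (y :: real^3) = 1" and A: "orthogonal_matrix A" "A *v y = y" "det A = -1"
  shows "A ** A = mat 1"
proof -
  from orthogonal_fix_unit_vector[OF y] A obtain Q a b where Q: "transpose Q ** Q = mat 1" "Q ** transpose Q = mat 1"
    and ab: "a * a + b * b = 1" and eq: "A = Q ** mat3 a b 0 b (- a) 0 0 0 1 ** transpose Q" by metis
  have "mat3 a b 0 b (- a) 0 0 0 1 ** mat3 a b 0 b (- a) 0 0 0 1 = mat 1"
    using ab by (simp add: mat3_mult mat3_eq mat3_one algebra_simps)
  then show ?thesis unfolding eq conjugate_mult[OF Q(1)] by (simp add: Q(2))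
qed

lemma odd_flip_no_fixpoint: "od4 j \<Longrightarrow> flip j *v x = x \<Longrightarrow> x = 0"
  using four_cases[of j] unfolding od4_def
  by (auto simp: flip_simps mat3_mult_vec vec_eq_iff forall_3 vector_3)

text \<open>For \<open>a\<close> in \<open>V\<close> and small \<open>t\<close> the direction of
  \<open>a + t *\<^sub>R y\<close> still lies in \<open>V\<close>; by linearity \<open>f y\<close>
  is recovered from the values at \<open>a\<close> and at \<open>a + t *\<^sub>R y\<close>.\<close>

lemma linear_fixing_open_of_sphere:
  fixes f :: "'a::euclidean_space \<Rightarrow> 'a"
  assumes f: "linear f" and V: "openin (top_of_set (sphere 0 1)) V" "V \<noteq> {}" and fixV: "\<And>x. x \<in> V \<Longrightarrow> f x = x"
  shows "f y = y"
proof -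
  obtain a where a: "a \<in> V" using V(2) by blast
  obtain T where T: "open T" "V = sphere 0 1 \<inter> T" using V(1) unfolding openin_open by blast
  have na: "norm a = 1" "a \<in> T" using a T(2) by auto
  have "((\<lambda>t. (1 / norm (a + t *\<^sub>R y)) *\<^sub>R (a + t *\<^sub>R y)) \<longlongrightarrow> (1 / norm (a + 0 *\<^sub>R y)) *\<^sub>R (a + 0 *\<^sub>R y)) (at 0)"
    using na by (intro tendsto_intros) auto
  then have "\<forall>\<^sub>F t in at 0. (1 / norm (a + t *\<^sub>R y)) *\<^sub>R (a + t *\<^sub>R y) \<in> T"
    using topological_tendstoD[OF _ T(1)] na by simp
  moreover have "\<forall>\<^sub>F t in at 0. 0 < norm (a + t *\<^sub>R y)"
  proof (rule order_tendstoD(1))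
    show "((\<lambda>t. norm (a + t *\<^sub>R y)) \<longlongrightarrow> norm (a + 0 *\<^sub>R y)) (at 0)"
      by (intro tendsto_intros)
    show "0 < norm (a + 0 *\<^sub>R y)" using na by simp
  qed
  moreover have "\<forall>\<^sub>F t in at (0::real). t \<noteq> 0" by (simp add: eventually_at_filter)
  ultimately have "\<forall>\<^sub>F t in at (0::real). (1 / norm (a + t *\<^sub>R y)) *\<^sub>R (a + t *\<^sub>R y) \<in> T \<and> norm (a + t *\<^sub>R y) > 0 \<and> t \<noteq> 0"
    by eventually_elim simp
  then obtain t :: real where t: "(1 / norm (a + t *\<^sub>R y)) *\<^sub>R (a + t *\<^sub>R y) \<in> T" "norm (a + t *\<^sub>R y) > 0" "t \<noteq> 0"
    using eventually_happens[of _ "at (0::real)"] by auto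
  define n where "n = norm (a + t *\<^sub>R y)"
  have "(1 / n) *\<^sub>R (a + t *\<^sub>R y) \<in> V" using t T(2) unfolding n_def by simp
  then have "f ((1 / n) *\<^sub>R (a + t *\<^sub>R y)) = (1 / n) *\<^sub>R (a + t *\<^sub>R y)" by (rule fixV)
  then have "(1 / n) *\<^sub>R f (a + t *\<^sub>R y) = (1 / n) *\<^sub>R (a + t *\<^sub>R y)" using f by (simp add: linear_scale)
  then have "f (a + t *\<^sub>R y) = a + t *\<^sub>R y" using t(2) unfolding n_def by simp
  then have "f a + t *\<^sub>R f y = a + t *\<^sub>R y" using f by (simp add: linear_add linear_scale)
  then show ?thesis using fixV[OF a] t(3) by simp
qed

section \<open>Meager sets\<close>

lemma meager_subset:
  assumes "meager_in X T" "S \<subseteq> T"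
  shows "meager_in X S"
proof -
  obtain \<U> where U: "countable \<U>" "\<And>A. A \<in> \<U> \<Longrightarrow> nowhere_dense_in X A" "\<Union>\<U> = T"
    using assms(1) unfolding meager_in_def union_of_def by auto
  have "nowhere_dense_in X (A \<inter> S)" if "A \<in> \<U>" for A
  proof -
    have "X closure_of (A \<inter> S) \<subseteq> X closure_of A" by (intro closure_of_mono) auto
    then have "X interior_of (X closure_of (A \<inter> S)) \<subseteq> X interior_of (X closure_of A)" by (rule interior_of_mono)
    then show ?thesis using U(2)[OF that] unfolding nowhere_dense_in_def by blast
  qed
  then show ?thesis
    unfolding meager_in_def union_of_def using U(1,3) assms(2)
    by (intro exI[of _ "(\<lambda>A. A \<inter> S) ` \<U>"]) auto
qed

lemma meager_Un: 
  assumes "meager_in X S" "meager_in X T"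
  shows "meager_in X (S \<union> T)"
proof -
  obtain \<U> \<V> where "countable \<U>" "\<U> \<subseteq> Collect (nowhere_dense_in X)" "\<Union>\<U> = S"
    "countable \<V>" "\<V> \<subseteq> Collect (nowhere_dense_in X)" "\<Union>\<V> = T"
    using assms unfolding meager_in_def union_of_def by auto
  then show ?thesis unfolding meager_in_def union_of_def
    by (intro exI[of _ "\<U> \<union> \<V>"]) auto
qed

lemma nowhere_dense_imp_meager: "nowhere_dense_in X S \<Longrightarrow> meager_in X S"
  unfolding meager_in_def union_of_def by (intro exI[of _ "{S}"]) auto

lemma meager_UN:
  assumes "countable I" "\<And>i. i \<in> I \<Longrightarrow> nowhere_dense_in X (F i)"
  shows "meager_in X (\<Union>i\<in>I. F i)"
  unfolding meager_in_def union_of_def using assms by (intro exI[of _ "F ` I"]) auto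

lemma closed_nowhere_dense:
  assumes "closedin X S" "\<And>V. \<lbrakk>openin X V; V \<subseteq> S\<rbrakk> \<Longrightarrow> V = {}"
  shows "nowhere_dense_in X S"
  unfolding nowhere_dense_in_def
  using assms closedin_subset[OF assms(1)] by (simp add: closure_of_closedin interior_of_subset)

lemma nonmeager_open:
  assumes X: "completely_metrizable_space X" and V: "openin X V" "V \<noteq> {}"
  shows "\<not> meager_in X V"
proof
  assume "meager_in X V"
  then obtain \<U> where U: "countable \<U>" "\<And>A. A \<in> \<U> \<Longrightarrow> nowhere_dense_in X A" "\<Union>\<U> = V"
    unfolding meager_in_def union_of_def by auto
  have "X interior_of \<Union>((\<lambda>A. X closure_of A) ` \<U>) = {}"
    by (rule Baire_category_alt) (use X U(1,2) in \<open>auto simp: nowhere_dense_in_def\<close>)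
  moreover have "V \<subseteq> \<Union>((\<lambda>A. X closure_of A) ` \<U>)"
    using U(2,3) closure_of_subset unfolding nowhere_dense_in_def by fastforce
  ultimately show False using V interior_of_maximal by blast
qed

lemma completely_metrizable_S2: "completely_metrizable_space (top_of_set S2)"
  by (intro completely_metrizable_space_closedin completely_metrizable_space_euclidean)
    (simp flip: closed_closedin)

lemma nowhere_dense_fixpoints:
  assumes f: "linear (f :: real^3 \<Rightarrow> real^3)" "f y \<noteq> y"
  shows "nowhere_dense_in (top_of_set S2) {x \<in> S2. f x = x}"
proof (rule closed_nowhere_dense)
  have "continuous_on S2 (\<lambda>x. f x - x)"
    using f(1) by (intro continuous_intros linear_continuous_on) (simp add: linear_conv_bounded_linear)
  then have "closedin (top_of_set S2) {x \<in> S2. f x - x = 0}"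
    using continuous_closedin_preimage_constant[of S2 "\<lambda>x. f x - x" 0] by simp
  then show "closedin (top_of_set S2) {x \<in> S2. f x = x}" by simp
  show "V = {}" if "openin (top_of_set S2) V" "V \<subseteq> {x \<in> S2. f x = x}" for V
    using linear_fixing_open_of_sphere[OF f(1) that(1)] that(2) f(2) by blast
qed

text \<open>The point is fixed by the projection onto the line through it, which is linear and not
  the identity.\<close>

lemma nowhere_dense_point: 
  assumes "a \<in> S2"
  shows "nowhere_dense_in (top_of_set S2) {a}"
proof -
  let ?f = "\<lambda>x. (a \<bullet> x) *\<^sub>R a"
  have lin: "linear ?f" by (intro linearI) (simp_all add: inner_add_right scaleR_add_left)
  obtain y where y: "?f y \<noteq> y"
  proof -
    obtain z where z: "z \<noteq> 0" "orthogonal a z" 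
      by (rule orthogonal_to_vector_exists[of a]) auto
    then have "?f z \<noteq> z" by (simp add: orthogonal_def)
    then show ?thesis by (rule that)
  qed
  have "{a} \<subseteq> {x \<in> S2. ?f x = x}" using assms by (auto simp: norm_eq_1)
  then have "V = {}" if "openin (top_of_set S2) V" "V \<subseteq> {a}" for V
    using linear_fixing_open_of_sphere[OF lin that(1)] that(2) y by blast
  then show ?thesis using assms by (intro closed_nowhere_dense) (auto simp: closedin_closed)
qed

context rotation_links
begin

text \<open>The parity of a chain is the sign of the determinant of its matrix \<open>E ls\<close>,
  so the axial assumptions become facts about orthogonal matrices with a fixed unit vector.\<close>

lemma generic_csp_sphere:
  assumes "congruence_csp J cls sy od4 (link_map \<phi> \<tau>) Col S H"
  shows "generic_csp J cls sy od4 (link_map \<phi> \<tau>) Col S H S2"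
    and "meager_in (top_of_set S2) {x \<in> S2. \<not> chain_system.free J cls sy (link_map \<phi> \<tau>) x}"
proof -
  interpret congruence_csp J cls sy od4 "link_map \<phi> \<tau>" Col S H by (rule assms)
  define E where "E ls = foldr (\<lambda>l A. link_matrix \<phi> \<tau> l ** A) ls (mat 1)" for ls
  have E_simps: "E [] = mat 1" "E (l # ls) = link_matrix \<phi> \<tau> l ** E ls" for l ls
    unfolding E_def by simp_all
  have ev_E: "ev ls x = E ls *v x" for ls x
  proof (induction ls)
    case (Cons l ls)
    then have "ev (l # ls) x = link_map \<phi> \<tau> l (E ls *v x)" by simp
    also have "\<dots> = E (l # ls) *v x" by (simp add: link_map_def E_simps matrix_vector_mul_assoc)
    finally show ?case .
  qed (simp add: E_simps)
  have E_orth: "orthogonal_matrix (E ls)" for ls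
    by (induction ls) (simp_all add: E_simps orthogonal_matrix_mul link_matrix_orthogonal orthogonal_matrix_id)
  have E_det: "det (E ls) = (if odd_chain ls then -1 else 1)" for ls
    by (induction ls) (simp_all add: E_simps det_mul link_matrix_det)
  have lk_lin: "linear (link_map \<phi> \<tau> l)" for l
    unfolding link_map_def by (rule matrix_vector_mul_linear)
  have ev_lin: "linear (ev ls)" for ls
    unfolding ev_E[abs_def] by (rule matrix_vector_mul_linear)
  have ax: "axial_csp J cls sy od4 (link_map \<phi> \<tau>) Col S H S2"
  proof unfold_locales
    fix l and x :: "real^3" assume "valid l" "x \<in> S2"
    then show "link_map \<phi> \<tau> l x \<in> S2"
      by (simp add: link_map_def orthogonal_matrix_norm link_matrix_orthogonal)
  next
    fix c and x z :: "real^3" assume c: "x \<in> S2" "ev c x = x" "odd_chain c"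
    then have "E c ** E c = mat 1"
      using reflection_involution[of x "E c"] E_orth E_det ev_E by simp
    then show "ev c (ev c z) = z" by (simp add: ev_E matrix_vector_mul_assoc)
  next
    fix a b and x z :: "real^3" assume "x \<in> S2" "ev a x = x" "ev b x = x" "\<not> odd_chain a" "\<not> odd_chain b"
    then have "E a ** E b = E b ** E a"
      using rotations_about_axis_commute[of x "E a" "E b"] E_orth E_det ev_E by simp
    then show "ev a (ev b z) = ev b (ev a z)" by (simp add: ev_E matrix_vector_mul_assoc)
  next
    fix l and x :: "real^3" assume l: "valid l" "src l = tgt l" "od4 (amt l)" and x: "x \<in> S2"
    obtain v j where vj: "l = (v, j, v)" using l(2) by (cases l) auto
    show "link_map \<phi> \<tau> l x \<noteq> x"
    proof
      assume e: "link_map \<phi> \<tau> l x = x"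
      let ?z = "turn (\<phi> v) (- \<tau>) *v x"
      have "turn (\<phi> v) (- \<tau>) *v link_map \<phi> \<tau> l x = (turn (\<phi> v) (- \<tau>) ** turn (\<phi> v) \<tau>) *v (flip j *v ?z)"
        unfolding vj link_map_def by (simp add: matrix_vector_mul_assoc matrix_mul_assoc)
      then have "flip j *v ?z = ?z" using e by (simp add: turn_inverse)
      then have "?z = 0" using odd_flip_no_fixpoint l(3) vj by simp
      then have "norm x = 0" using orthogonal_matrix_norm[OF orthogonal_turn(1), of "\<phi> v" "- \<tau>" x] by simp
      then show False using x by simp
    qed
  qed
  let ?R = "{ls. red ls \<and> ls \<noteq> []}"
  have "?R \<subseteq> lists {l. valid l}" using red_walk unfolding walk_def by auto
  then have cR: "countable ?R"
    using countable_lists[OF countable_finite[OF finite_valid]] countable_subset by blast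
  have nd: "nowhere_dense_in (top_of_set S2) {x \<in> S2. ev ls x = x}" if "ls \<in> ?R" for ls
  proof -
    have "\<not> (\<forall>y. ev ls y = y)" using faithful[of ls] that by blast
    then show ?thesis using nowhere_dense_fixpoints[OF ev_lin] by blast
  qed
  have "{x \<in> S2. \<not> free x} = (\<Union>ls\<in>?R. {x \<in> S2. ev ls x = x})" unfolding free_def by auto
  then show mD: "meager_in (top_of_set S2) {x \<in> S2. \<not> free x}"
    using meager_UN[OF cR nd] by simp
  interpret axial_csp J cls sy od4 "link_map \<phi> \<tau>" Col S H S2 by (rule ax)
  show "generic_csp J cls sy od4 (link_map \<phi> \<tau>) Col S H S2"
  proof unfold_locales
    fix l assume "valid l"
    show "continuous_on S2 (link_map \<phi> \<tau> l)"
      using lk_lin[of l] linear_continuous_on linear_conv_bounded_linear by blast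
  next
    fix V A :: "(real^3) set" assume V: "openin (top_of_set S2) V" "V \<noteq> {}" and A: "finite A"
    \<comment> \<open>Otherwise the open set \<open>V\<close> would be covered by the meager set of
      non-free points together with finitely many points.\<close>
    show "\<exists>x\<in>V - A. free x"
    proof (rule ccontr)
      assume n: "\<not> (\<exists>x\<in>V - A. free x)"
      have VS: "V \<subseteq> S2" using openin_imp_subset V(1) by blast
      have "meager_in (top_of_set S2) (\<Union>a\<in>A \<inter> S2. {a})"
        using A by (intro meager_UN) (auto intro: countable_finite nowhere_dense_point)
      then have "meager_in (top_of_set S2) ({x \<in> S2. \<not> free x} \<union> (\<Union>a\<in>A \<inter> S2. {a}))"
        using meager_Un mD by blast
      moreover have "V \<subseteq> {x \<in> S2. \<not> free x} \<union> (\<Union>a\<in>A \<inter> S2. {a})" using n VS by blast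
      ultimately have "meager_in (top_of_set S2) V" using meager_subset by blast
      then show False using nonmeager_open[OF completely_metrizable_S2 V] by blast
    qed
  qed
qed

end

section \<open>Systems of congruences\<close>

locale consistent_congruences =
  fixes r :: nat and C :: "congruence list"
  assumes r: "r \<ge> 1" and proper: "\<forall>c \<in> set C. proper_congruence r c"
    and consistent: "consistent_system r C"
begin

definition N :: "nat set" where "N = {1..r}"

definition Vx :: "nat set set" where "Vx = {X. X \<subseteq> N \<and> X \<noteq> {} \<and> X \<noteq> N}"

definition Edge :: "(nat set \<times> nat set) set" where
  "Edge = (\<Union>(L, R)\<in>set C. {(L, R), (R, L), (N - L, N - R), (N - R, N - L)})"

definition equiv_class :: "nat set \<Rightarrow> nat set set" where "equiv_class X = {Y. (X, Y) \<in> Edge\<^sup>*}"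

definition self_dual :: "nat set \<Rightarrow> bool" where "self_dual X \<longleftrightarrow> (X, N - X) \<in> Edge\<^sup>*"

text \<open>
  One set of each complementary pair, such that a class that is not closed under complements lies
  inside or outside of \<open>half\<close> as a whole.
\<close>
definition half :: "nat set set" where
  "half = {X \<in> Vx. if self_dual X then 1 \<in> X
     else (SOME Z. Z \<in> {equiv_class X, equiv_class (N - X)}) = equiv_class X}"

fun lit :: "nat set \<Rightarrow> bool \<Rightarrow> nat set" where
  "lit v True = v" | "lit v False = N - v"

text \<open>Counting the sets above \<open>X\<close> turns the preorder into a number: equivalent
  sets have the same rank, and under consistency a proper superset has a smaller one.\<close>

definition rank :: "nat set \<Rightarrow> nat" where
  "rank X = card {Y \<in> Pow N. subcongruence r C X Y}"

lemma C_Vx: "(L, R) \<in> set C \<Longrightarrow> L \<in> Vx \<and> R \<in> Vx"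
  using proper unfolding proper_congruence_def Vx_def N_def by fastforce

lemma Vx_compl: "X \<in> Vx \<Longrightarrow> N - X \<in> Vx" "X \<in> Vx \<Longrightarrow> N - (N - X) = X" "X \<in> Vx \<Longrightarrow> X \<subseteq> N"
  unfolding Vx_def by auto

lemma EdgeI:
  assumes "(L, R) \<in> set C"
  shows "(L, R) \<in> Edge" "(R, L) \<in> Edge" "(N - L, N - R) \<in> Edge" "(N - R, N - L) \<in> Edge"
  using assms unfolding Edge_def by auto

lemma Edge_Vx: "(X, Y) \<in> Edge \<Longrightarrow> X \<in> Vx \<and> Y \<in> Vx"
  unfolding Edge_def using C_Vx Vx_compl(1) by auto

lemma Edge_compl: "(X, Y) \<in> Edge \<Longrightarrow> (N - X, N - Y) \<in> Edge"
proof -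
  assume "(X, Y) \<in> Edge"
  then obtain L R where "(L, R) \<in> set C"
    "(X, Y) = (L, R) \<or> (X, Y) = (R, L) \<or> (X, Y) = (N - L, N - R) \<or> (X, Y) = (N - R, N - L)"
    unfolding Edge_def by blast
  moreover from this(1) have "N - (N - L) = L" "N - (N - R) = R" using C_Vx Vx_compl(2) by auto
  ultimately show ?thesis using EdgeI[of L R] by (elim disjE) simp_all
qed

lemma sym_Edge: "sym Edge"
  unfolding Edge_def sym_def by auto

lemma Edge_star_sym: "(X, Y) \<in> Edge\<^sup>* \<Longrightarrow> (Y, X) \<in> Edge\<^sup>*"
  using sym_rtrancl[OF sym_Edge] unfolding sym_def by blast

lemma Edge_star_compl: "(X, Y) \<in> Edge\<^sup>* \<Longrightarrow> (N - X, N - Y) \<in> Edge\<^sup>*"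
  by (induction rule: rtrancl_induct) (auto intro: rtrancl_into_rtrancl Edge_compl)

lemma Edge_star_Vx: "\<lbrakk>(X, Y) \<in> Edge\<^sup>*; X \<in> Vx\<rbrakk> \<Longrightarrow> Y \<in> Vx"
  by (induction rule: rtrancl_induct) (auto dest: Edge_Vx)

lemma equiv_class_eq_iff: "equiv_class X = equiv_class Y \<longleftrightarrow> (X, Y) \<in> Edge\<^sup>*"
proof
  assume "equiv_class X = equiv_class Y"
  then have "Y \<in> equiv_class X" unfolding equiv_class_def by auto
  then show "(X, Y) \<in> Edge\<^sup>*" unfolding equiv_class_def by simp
next
  assume a: "(X, Y) \<in> Edge\<^sup>*"
  then show "equiv_class X = equiv_class Y"
    unfolding equiv_class_def by (auto intro: rtrancl_trans[OF a] rtrancl_trans[OF Edge_star_sym[OF a]])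
qed

lemma self_dual_iff: "(X, Y) \<in> Edge\<^sup>* \<Longrightarrow> self_dual X \<longleftrightarrow> self_dual Y"
  unfolding self_dual_def using Edge_star_sym Edge_star_compl rtrancl_trans by meson

lemma self_dual_compl: "X \<in> Vx \<Longrightarrow> self_dual (N - X) \<longleftrightarrow> self_dual X"
  unfolding self_dual_def using Edge_star_sym Vx_compl(2) by metis

lemma half_Vx: "X \<in> half \<Longrightarrow> X \<in> Vx" unfolding half_def by simp

text \<open>In the self-dual case \<open>1\<close> lies in exactly one of the two sets. Otherwise
  \<open>X\<close> and \<open>N - X\<close> choose from the same unordered pair of different
  classes, so one choice favours exactly one of them.\<close>

lemma half_compl: assumes "X \<in> Vx" shows "N - X \<in> half \<longleftrightarrow> X \<notin> half"
proof (cases "self_dual X")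
  case True
  have "1 \<in> N" using r unfolding N_def by simp
  then show ?thesis using True assms self_dual_compl[OF assms] Vx_compl(1)[OF assms] unfolding half_def by auto
next
  case False
  define Z where "Z = (SOME Z. Z \<in> {equiv_class X, equiv_class (N - X)})"
  have "Z \<in> {equiv_class X, equiv_class (N - X)}" unfolding Z_def by (rule someI_ex) blast
  moreover have "equiv_class X \<noteq> equiv_class (N - X)"
    using False equiv_class_eq_iff unfolding self_dual_def by simp
  moreover have "(SOME Z. Z \<in> {equiv_class (N - X), equiv_class (N - (N - X))}) = Z"
    unfolding Z_def using Vx_compl(2)[OF assms] by (simp add: insert_commute)
  ultimately show ?thesis
    using False assms self_dual_compl[OF assms] Vx_compl(1)[OF assms] unfolding half_def Z_def by auto
qed

lemma half_class: 
  assumes "(X, Y) \<in> Edge\<^sup>*" "\<not> self_dual X" "X \<in> half"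
  shows "Y \<in> half"
proof -
  have "equiv_class X = equiv_class Y" "equiv_class (N - X) = equiv_class (N - Y)"
    using assms(1) Edge_star_compl equiv_class_eq_iff by auto
  moreover have "\<not> self_dual Y" "Y \<in> Vx"
    using assms self_dual_iff[OF assms(1)] Edge_star_Vx half_Vx by auto
  ultimately show ?thesis using assms(2,3) unfolding half_def by simp
qed

lemma subset_subcongruence: "\<lbrakk>X \<subseteq> Y; Y \<subseteq> N\<rbrakk> \<Longrightarrow> subcongruence r C X Y"
  unfolding N_def by (rule subcongruence.subset)

lemma Edge_subcongruence: "(X, Y) \<in> Edge \<Longrightarrow> subcongruence r C X Y"
  using subcongruence.left[of _ _ C r] subcongruence.right[of _ _ C r]
    subcongruence.compl_left[of _ _ C r, folded N_def] subcongruence.compl_right[of _ _ C r, folded N_def]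
  unfolding Edge_def by auto

lemma Edge_star_subcongruence:
  assumes "(X, Y) \<in> Edge\<^sup>*" "X \<in> Vx"
  shows "subcongruence r C X Y"
  using assms
proof (induction rule: rtrancl_induct)
  case base
  then show ?case using Vx_compl(3) subset_subcongruence by blast
next
  case (step Y Z)
  then show ?case using Edge_subcongruence subcongruence.trans by blast
qed

lemma rank_cong:
  assumes "(X, Y) \<in> Edge\<^sup>*" "X \<in> Vx"
  shows "rank X = rank Y"
proof -
  have "subcongruence r C X Z \<longleftrightarrow> subcongruence r C Y Z" for Z
    using Edge_star_subcongruence[OF assms] Edge_star_subcongruence[OF Edge_star_sym[OF assms(1)]]
      Edge_star_Vx[OF assms] subcongruence.trans by blast
  then show ?thesis unfolding rank_def by simp
qed

text \<open>All sets above \<open>Y\<close> are above \<open>X\<close>; and \<open>X\<close> is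
  above itself but, by consistency, not above \<open>Y\<close>.\<close>

lemma rank_less:
  assumes "X \<subset> Y" "Y \<in> Vx"
  shows "rank Y < rank X"
  unfolding rank_def
proof (rule psubset_card_mono)
  have XY: "subcongruence r C X Y" using assms Vx_compl(3) subset_subcongruence by blast
  have "\<not> subcongruence r C Y X" using consistent assms(1) unfolding consistent_system_def by blast
  moreover have "X \<subseteq> N" using assms Vx_compl(3) by blast
  moreover have "subcongruence r C X X" using \<open>X \<subseteq> N\<close> subset_subcongruence by blast
  ultimately show "{Z \<in> Pow N. subcongruence r C Y Z} \<subset> {Z \<in> Pow N. subcongruence r C X Z}"
    using XY subcongruence.trans by blast
qed (simp add: N_def)

lemma lit_Vx: "v \<in> Vx \<Longrightarrow> lit v e \<in> Vx"
  using Vx_compl(1) by (cases e) auto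

lemma mem_lit: "k \<in> N \<Longrightarrow> k \<in> lit v e \<longleftrightarrow> (k \<in> v) = e"
  by (cases e) auto

lemma finite_half: "finite half"
  by (rule finite_subset[of _ "Pow N"]) (auto simp: half_def Vx_def N_def)

lemma lit_class:
  assumes "equiv_class v = equiv_class w"
  shows "(lit v e, lit w e) \<in> Edge\<^sup>*"
  using assms Edge_star_compl unfolding equiv_class_eq_iff by (cases e) auto

lemma lit_self_dual:
  assumes "self_dual v" "v \<in> Vx"
  shows "(lit v e, lit v d) \<in> Edge\<^sup>*"
  using assms Edge_star_sym unfolding self_dual_def by (cases e; cases d) auto

lemma angles: "\<exists>\<phi>. rotation_links half equiv_class self_dual \<phi>"
proof -
  obtain f :: "nat set \<Rightarrow> nat" where f: "inj_on f half" using finite_imp_inj_to_nat_seg[OF finite_half] by blast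
  \<comment> \<open>Distinct values in the interval from \<open>0\<close> to \<open>1\<close>, with
    \<open>0\<close> excluded, hence strictly between \<open>0\<close> and
    \<open>pi\<close>.\<close>
  define \<phi> where "\<phi> v = 1 / (1 + real (f v))" for v
  have "rotation_links half equiv_class self_dual \<phi>"
  proof
    show "finite half" by (rule finite_half)
    show "self_dual v = self_dual w" if "equiv_class v = equiv_class w" for v w
      using that self_dual_iff equiv_class_eq_iff by blast
    show "0 < \<phi> v \<and> \<phi> v < pi" for v
    proof -
      have "\<phi> v \<le> 1" unfolding \<phi>_def by simp
      moreover have "0 < \<phi> v" unfolding \<phi>_def by simp
      ultimately show ?thesis using pi_gt3 by linarith
    qed
    show "inj_on \<phi> half"
      using f unfolding inj_on_def \<phi>_def by simp
  qed
  then show ?thesis by (intro exI[of _ \<phi>])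
qed

text \<open>As \<open>half\<close> contains no complementary pair, literals of different members of
  \<open>half\<close> are different sets; an implication between them is a proper inclusion and
  lowers the rank.\<close>

lemma congruence_csp_half:
  fixes lk :: "(nat set, 4) link \<Rightarrow> real^3 \<Rightarrow> real^3"
  assumes "free_chain_system half equiv_class self_dual od4 lk"
  shows "congruence_csp half equiv_class self_dual od4 lk N (\<lambda>v. v) (\<lambda>v e. rank (lit v e))"
proof -
  interpret free_chain_system half equiv_class self_dual od4 lk by (rule assms)
  show ?thesis
  proof unfold_locales
    show "N \<noteq> {}" using r unfolding N_def by simp
    show "\<exists>k\<in>N. (k \<in> v) = e" if "v \<in> half" for v e
      using half_Vx[OF that] unfolding Vx_def by (cases e) auto
  next
    fix l e assume l: "valid l"
    obtain v j w where vjw: "l = (v, j, w)" by (cases l)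
    have v: "v \<in> Vx" "w \<in> Vx" "equiv_class v = equiv_class w" "j = 0 \<or> self_dual v" using l half_Vx vjw by auto
    have "(lit v e, lit w (e \<noteq> od4 j)) \<in> Edge\<^sup>*"
    proof (cases "od4 j")
      case True
      then have "self_dual v" using v(4) by (auto simp: od4_def)
      then have "(lit v e, lit v (\<not> e)) \<in> Edge\<^sup>*" by (rule lit_self_dual) (rule v(1))
      then show ?thesis using lit_class[OF v(3), of "\<not> e"] True rtrancl_trans by auto
    next
      case False
      then show ?thesis using lit_class[OF v(3), of e] by simp
    qed
    then show "rank (lit (tgt l) (e \<noteq> od4 (amt l))) = rank (lit (src l) e)"
      using rank_cong lit_Vx[OF v(1)] vjw by auto
  next
    fix v u e d assume vu: "v \<in> half" "u \<in> half" "u \<noteq> v"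
      and imp: "\<And>k. \<lbrakk>k \<in> N; (k \<in> v) = e\<rbrakk> \<Longrightarrow> (k \<in> u) = d"
    have V: "v \<in> Vx" "u \<in> Vx" using vu half_Vx by auto
    have "lit v e \<subseteq> lit u d"
    proof
      fix k assume k: "k \<in> lit v e"
      then have "k \<in> N" using lit_Vx[OF V(1)] Vx_compl(3) by blast
      then show "k \<in> lit u d" using imp mem_lit k by blast
    qed
    moreover have "lit v e \<noteq> lit u d"
    proof
      assume a: "lit v e = lit u d"
      have "u = v \<or> u = N - v"
        by (cases e; cases d) (use a Vx_compl(2)[OF V(1)] Vx_compl(2)[OF V(2)] in \<open>metis lit.simps\<close>)+
      then show False using vu half_compl[OF V(1)] by auto
    qed
    ultimately show "rank (lit u d) < rank (lit v e)" using rank_less lit_Vx[OF V(2)] by blast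
  qed
qed

text \<open>
  The isometry that witnesses the congruence of \<open>L\<close> and \<open>R\<close> is the one attached to a link between
  the representatives of \<open>L\<close> and \<open>R\<close> in \<open>half\<close>.
\<close>
lemma congruence_link:
  assumes "(L, R) \<in> set C"
  obtains v j w where "v \<in> half" "w \<in> half" "equiv_class v = equiv_class w" "j = 0 \<or> self_dual v"
    "\<And>k k'. \<lbrakk>k \<in> N; k' \<in> N; (k' \<in> w) = ((k \<in> v) \<noteq> od4 j)\<rbrakk> \<Longrightarrow> k' \<in> R \<longleftrightarrow> k \<in> L"
proof -
  have V: "L \<in> Vx" "R \<in> Vx" using C_Vx assms by auto
  have LR: "(L, R) \<in> Edge\<^sup>*" using assms unfolding Edge_def by blast
  have rep: "\<exists>v e. v \<in> half \<and> X = lit v e" if "X \<in> Vx" for X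
  proof (cases "X \<in> half")
    case True
    then show ?thesis by (intro exI[of _ X] exI[of _ True]) simp
  next
    case False
    then show ?thesis using half_compl[OF that] Vx_compl(2)[OF that]
      by (intro exI[of _ "N - X"] exI[of _ False]) simp
  qed
  obtain v e where v: "v \<in> half" "L = lit v e" using rep[OF V(1)] by blast
  obtain w d where w: "w \<in> half" "R = lit w d" using rep[OF V(2)] by blast
  have vV: "v \<in> Vx" "w \<in> Vx" using v w half_Vx by auto
  have mem: "k \<in> L \<longleftrightarrow> (k \<in> v) = e" "k \<in> R \<longleftrightarrow> (k \<in> w) = d" if "k \<in> N" for k
    using mem_lit[OF that] v w by auto
  have vL: "(v, L) \<in> Edge\<^sup>* \<or> (v = N - L)" using v Vx_compl(2)[OF vV(1)] by (cases e) auto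
  show ?thesis
  proof (cases "self_dual v")
    case True
    then have vL: "(v, L) \<in> Edge\<^sup>*" using lit_self_dual[OF True vV(1), of True e] v by simp
    then have vR: "(v, R) \<in> Edge\<^sup>*" using rtrancl_trans[OF vL LR] by blast
    have "self_dual R" using self_dual_iff[OF vR] True by blast
    then have sw: "self_dual w" using w self_dual_compl[OF vV(2)] by (cases d) auto
    have "(R, w) \<in> Edge\<^sup>*" using lit_self_dual[OF sw vV(2), of d True] w by simp
    then have "equiv_class v = equiv_class w" using rtrancl_trans[OF vR] equiv_class_eq_iff by simp
    \<comment> \<open>The amount absorbs a difference of signs: \<open>0\<close> if
      \<open>e = d\<close>, and the odd amount \<open>1\<close> otherwise.\<close>
    then show ?thesis
      using that[of v w 0] that[of v w 1] v(1) w(1) True mem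
      by (cases "e = d") (auto simp: od4_def)
  next
    case False
    \<comment> \<open>A class that is not self-dual lies inside or outside \<open>half\<close> as a
      whole, so \<open>L\<close> and \<open>R\<close> are represented with the same sign.\<close>
    have "e = d \<and> (v, w) \<in> Edge\<^sup>*"
    proof (cases e)
      case True
      then have "L = v" using v by simp
      then have "R \<in> half" using half_class[OF LR] False v by blast
      then have "d" using w half_compl[OF vV(2)] by (cases d) auto
      then show ?thesis using True w LR \<open>L = v\<close> by simp
    next
      case e: False
      then have "L = N - v" using v by simp
      then have nv: "N - L = v" using Vx_compl(2)[OF vV(1)] by simp
      have "(v, N - R) \<in> Edge\<^sup>*" using Edge_star_compl[OF LR] nv by simp
      moreover from half_class[OF this False v(1)] have "N - R \<in> half" .
      then have "\<not> d" using w half_compl[OF vV(2)] by (cases d) auto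
      ultimately show ?thesis using e w Vx_compl(2)[OF vV(2)] by simp
    qed
    then show ?thesis using that[of v w 0] v(1) w(1) mem equiv_class_eq_iff by (auto simp: od4_def)
  qed
qed

end

section \<open>The pieces on the sphere\<close>

lemma countable_base_S2:
  obtains B :: "nat \<Rightarrow> (real^3) set" where
    "\<And>n. openin (top_of_set S2) (B n) \<and> B n \<noteq> {}"
    "\<And>V. \<lbrakk>openin (top_of_set S2) V; V \<noteq> {}\<rbrakk> \<Longrightarrow> \<exists>n. B n \<subseteq> V"
proof -
  obtain \<B> :: "(real^3) set set" where b: "countable \<B>" "topological_basis \<B>" using ex_countable_basis by blast
  define \<C> where "\<C> = {S2 \<inter> b | b. b \<in> \<B> \<and> S2 \<inter> b \<noteq> {}}"
  have "\<C> \<subseteq> (\<lambda>b. S2 \<inter> b) ` \<B>" unfolding \<C>_def by blast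
  then have cC: "countable \<C>" using b(1) countable_image countable_subset by blast
  have small: "\<exists>U\<in>\<C>. U \<subseteq> V" if V: "openin (top_of_set S2) V" "V \<noteq> {}" for V
  proof -
    obtain T x where T: "open T" "V = S2 \<inter> T" "x \<in> V" using V unfolding openin_open by blast
    then obtain U where U: "U \<in> \<B>" "x \<in> U" "U \<subseteq> T" using topological_basisE[OF b(2) T(1)] by blast
    then have "S2 \<inter> U \<in> \<C>" using T(2,3) unfolding \<C>_def by blast
    then show ?thesis using T(2) U(3) by (intro bexI[of _ "S2 \<inter> U"]) auto
  qed
  have op: "openin (top_of_set S2) U \<and> U \<noteq> {}" if "U \<in> \<C>" for U
    using that b(2) topological_basis_open unfolding \<C>_def by (auto intro: openin_open_Int)
  have "S2 \<noteq> {}" by simp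
  then have ne: "\<C> \<noteq> {}" using small[of S2] by auto
  have "from_nat_into \<C> n \<in> \<C>" for n using ne by (rule from_nat_into)
  moreover have "\<exists>n. from_nat_into \<C> n = U" if "U \<in> \<C>" for U
    using from_nat_into_surj[OF cC that] .
  ultimately show ?thesis using that[of "from_nat_into \<C>"] op small by metis
qed

theorem theorem4p4:
  fixes r :: nat and C :: "congruence list"
  assumes "r \<ge> 1"
    and "\<forall>c \<in> set C. proper_congruence r c"
    and "consistent_system r C"
  shows "\<exists>(A :: nat \<Rightarrow> (real^3) set) (\<sigma> :: nat \<Rightarrow> real^3 \<Rightarrow> real^3).
      disjoint_family_on A {1..r} \<and>
      (\<Union>k\<in>{1..r}. A k) = S2 \<and>
      (\<forall>k\<in>{1..r}. Baire_property_in (top_of_set S2) (A k) \<and>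
                   \<not> meager_in (top_of_set S2) (A k)) \<and>
      (\<forall>i < length C. isometry_of S2 (\<sigma> i) \<and>
         \<sigma> i ` (\<Union>k\<in>fst (C ! i). A k) = (\<Union>k\<in>snd (C ! i). A k))"
proof -
  interpret consistent_congruences r C by unfold_locales (rule assms)+
  obtain \<phi> where "rotation_links half equiv_class self_dual \<phi>" using angles by blast
  then interpret rotation_links half equiv_class self_dual \<phi> .
  obtain \<tau> where "free_chain_system half equiv_class self_dual od4 (link_map \<phi> \<tau>)"
    using free_parameter by blast
  then have csp: "congruence_csp half equiv_class self_dual od4 (link_map \<phi> \<tau>) N (\<lambda>v. v) (\<lambda>v e. rank (lit v e))"
    by (rule congruence_csp_half)
  interpret generic_csp half equiv_class self_dual od4 "link_map \<phi> \<tau>" N "\<lambda>v. v" "\<lambda>v e. rank (lit v e)" S2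
    by (rule generic_csp_sphere(1)[OF csp])
  have D: "meager_in (top_of_set S2) {x \<in> S2. \<not> free x}" by (rule generic_csp_sphere(2)[OF csp])
  obtain B :: "nat \<Rightarrow> (real^3) set" where B: "\<And>n. openM (B n) \<and> B n \<noteq> {}"
    "\<And>V. \<lbrakk>openM V; V \<noteq> {}\<rbrakk> \<Longrightarrow> \<exists>n. B n \<subseteq> V" using countable_base_S2 by blast
  \<comment> \<open>For distinct colours \<open>{k}\<close> is proper, and it or its complement
    belongs to \<open>half\<close> and separates them.\<close>
  have sep: "k = k'" if "k \<in> N" "k' \<in> N" "\<And>v. v \<in> half \<Longrightarrow> (k \<in> v) = (k' \<in> v)" for k k'
  proof (rule ccontr)
    assume ne: "k \<noteq> k'"
    then have V: "{k} \<in> Vx" using that(1,2) unfolding Vx_def by auto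
    show False
    proof (cases "{k} \<in> half")
      case True
      then show ?thesis using that(3)[of "{k}"] ne by simp
    next
      case False
      then show ?thesis using that(3)[of "N - {k}"] half_compl[OF V] ne that(1,2) by auto
    qed
  qed
  have "S2 \<noteq> {}" "finite N" by (simp_all add: N_def)
  obtain c U where c: "solution c S2"
    and U: "\<And>k. k \<in> N \<Longrightarrow> openM (U k) \<and> U k \<noteq> {}" "\<And>k y. \<lbrakk>k \<in> N; y \<in> U k; free y\<rbrakk> \<Longrightarrow> c y = k"
      "\<And>V. \<lbrakk>openM V; V \<noteq> {}\<rbrakk> \<Longrightarrow> V \<inter> (\<Union>k\<in>N. U k) \<noteq> {}"
  proof (rule generic_solution[OF \<open>S2 \<noteq> {}\<close> \<open>finite N\<close> B sep])
    fix c U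
    assume "solution c S2" "\<And>k. k \<in> N \<Longrightarrow> openM (U k) \<and> U k \<noteq> {}"
      "\<And>k y. \<lbrakk>k \<in> N; y \<in> U k; free y\<rbrakk> \<Longrightarrow> c y = k"
      "\<And>V. \<lbrakk>openM V; V \<noteq> {}\<rbrakk> \<Longrightarrow> V \<inter> (\<Union>k\<in>N. U k) \<noteq> {}"
    then show thesis by (rule that)
  qed
  have cN: "c y \<in> N" if "y \<in> S2" for y using c that unfolding solution_def by blast
  define A where "A k = {y \<in> S2. c y = k}" for k
  have A_UN: "(\<Union>k\<in>L. A k) = {y \<in> S2. c y \<in> L}" for L unfolding A_def by blast
  have US: "U k \<subseteq> S2" if "k \<in> N" for k using U(1)[OF that] openM_subset by blast
  define G where "G = S2 - (\<Union>k\<in>N. U k)"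
  have G: "meager_in (top_of_set S2) G"
  proof (rule nowhere_dense_imp_meager[OF closed_nowhere_dense])
    have "openM (\<Union>k\<in>N. U k)" using U(1) by (intro openin_Union) auto
    then show "closedin (top_of_set S2) G" unfolding G_def by (simp add: closedin_diff)
    show "V = {}" if "openM V" "V \<subseteq> G" for V using U(3)[OF that(1)] that(2) unfolding G_def by blast
  qed
  have BP: "Baire_property_in (top_of_set S2) (A k) \<and> \<not> meager_in (top_of_set S2) (A k)" if k: "k \<in> N" for k
  proof
    \<comment> \<open>A free point outside \<open>G\<close> lies in some \<open>U k'\<close> and so
      has colour \<open>k'\<close>; at such points \<open>A k\<close> and \<open>U k\<close>
      agree.\<close>
    have "sym_diff (A k) (U k) \<subseteq> {x \<in> S2. \<not> free x} \<union> G"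
    proof
      fix y assume y: "y \<in> sym_diff (A k) (U k)"
      then have yS: "y \<in> S2" using US[OF k] unfolding A_def by auto
      show "y \<in> {x \<in> S2. \<not> free x} \<union> G"
      proof (rule ccontr)
        assume "y \<notin> {x \<in> S2. \<not> free x} \<union> G"
        then obtain k' where k': "free y" "k' \<in> N" "y \<in> U k'" using yS unfolding G_def by auto
        then have "c y = k'" using U(2) by blast
        then show False using y k' yS U(2)[OF k _ k'(1)] unfolding A_def by auto
      qed
    qed
    then have "meager_in (top_of_set S2) (sym_diff (A k) (U k))"
      using meager_subset meager_Un D G by blast
    then show "Baire_property_in (top_of_set S2) (A k)"
      unfolding Baire_property_in_def using U(1)[OF k] by (auto simp: A_def)
    show "\<not> meager_in (top_of_set S2) (A k)"
    proof
      assume "meager_in (top_of_set S2) (A k)"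
      then have "meager_in (top_of_set S2) (A k \<union> {x \<in> S2. \<not> free x})" using meager_Un D by blast
      moreover have "U k \<subseteq> A k \<union> {x \<in> S2. \<not> free x}" using US[OF k] U(2)[OF k] unfolding A_def by blast
      ultimately have "meager_in (top_of_set S2) (U k)" using meager_subset by blast
      then show False using nonmeager_open[OF completely_metrizable_S2] U(1)[OF k] by blast
    qed
  qed
  have wit: "\<exists>\<sigma>. isometry_of S2 \<sigma> \<and> \<sigma> ` (\<Union>k\<in>L. A k) = (\<Union>k\<in>R. A k)" if LR: "(L, R) \<in> set C" for L R
  proof -
    obtain v j w where l: "v \<in> half" "w \<in> half" "equiv_class v = equiv_class w" "j = 0 \<or> self_dual v"
      and m: "\<And>k k'. \<lbrakk>k \<in> N; k' \<in> N; (k' \<in> w) = ((k \<in> v) \<noteq> od4 j)\<rbrakk> \<Longrightarrow> k' \<in> R \<longleftrightarrow> k \<in> L"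
    proof (rule congruence_link[OF LR])
      fix v j w
      assume "v \<in> half" "w \<in> half" "equiv_class v = equiv_class w" "j = 0 \<or> self_dual v"
        "\<And>k k'. \<lbrakk>k \<in> N; k' \<in> N; (k' \<in> w) = ((k \<in> v) \<noteq> od4 j)\<rbrakk> \<Longrightarrow> k' \<in> R \<longleftrightarrow> k \<in> L"
      then show thesis by (rule that)
    qed
    define \<sigma> where "\<sigma> = link_map \<phi> \<tau> (v, j, w)"
    define \<rho> where "\<rho> = link_map \<phi> \<tau> (inv_link (v, j, w))"
    have val: "valid (v, j, w)" using l by simp
    then have val': "valid (inv_link (v, j, w))" using valid_inv by blast
    have inv: "\<rho> (\<sigma> y) = y" "\<sigma> (\<rho> y) = y" for y
      unfolding \<rho>_def \<sigma>_def using lk_inv[OF val] lk_inv'[OF val] by blast+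
    have S: "\<sigma> y \<in> S2" "\<rho> y \<in> S2" if "y \<in> S2" for y
      unfolding \<rho>_def \<sigma>_def using lk_M[OF val that] lk_M[OF val' that] by simp_all
    have mem: "c (\<sigma> y) \<in> R \<longleftrightarrow> c y \<in> L" if y: "y \<in> S2" for y
    proof (rule m)
      have "obeys c (v, j, w) y" using c y val unfolding solution_def by blast
      then show "(c (\<sigma> y) \<in> w) = ((c y \<in> v) \<noteq> od4 j)" unfolding obeys_def \<sigma>_def by simp
    qed (use cN S y in auto)
    have "bij_betw \<sigma> S2 S2" by (rule bij_betw_byWitness[of _ \<rho>]) (use inv S in auto)
    moreover have "dist (\<sigma> x) (\<sigma> y) = dist x y" for x y
      unfolding \<sigma>_def link_map_def by (rule orthogonal_matrix_dist[OF link_matrix_orthogonal])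
    moreover have "\<sigma> ` (\<Union>k\<in>L. A k) = (\<Union>k\<in>R. A k)"
      unfolding A_UN
    proof (intro equalityI subsetI)
      fix y assume "y \<in> \<sigma> ` {y \<in> S2. c y \<in> L}"
      then show "y \<in> {y \<in> S2. c y \<in> R}" using mem S by auto
    next
      fix y assume "y \<in> {y \<in> S2. c y \<in> R}"
      then show "y \<in> \<sigma> ` {y \<in> S2. c y \<in> L}"
        using mem[of "\<rho> y"] S[of y] inv by (intro image_eqI[of _ _ "\<rho> y"]) auto
    qed
    ultimately show ?thesis unfolding isometry_of_def by blast
  qed
  have "\<forall>i. \<exists>\<sigma>. i < length C \<longrightarrow> isometry_of S2 \<sigma> \<and> \<sigma> ` (\<Union>k\<in>fst (C ! i). A k) = (\<Union>k\<in>snd (C ! i). A k)"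
    using wit by (metis nth_mem prod.collapse)
  then obtain \<sigma> where "\<forall>i < length C. isometry_of S2 (\<sigma> i) \<and>
      \<sigma> i ` (\<Union>k\<in>fst (C ! i). A k) = (\<Union>k\<in>snd (C ! i). A k)" by metis
  moreover have "disjoint_family_on A {1..r}" unfolding disjoint_family_on_def A_def by auto
  moreover have "(\<Union>k\<in>{1..r}. A k) = S2" using cN unfolding A_UN N_def by auto
  ultimately show ?thesis using BP unfolding N_def by blast
qed

end
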